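(* Consider the plant $\dot x\in A(x,u)$, $y=g(x,u)$ with constraint set $K$, and suppose it satisfies the properties "Steady-state behavior", "Compatibility", "Maximal dissipative coupling", "Distinguishability" and "Compactness" stated in the context. Suppose moreover that: (i) the plant is strictly output incrementally passive; (ii) all steady-state pairs are $h$-detectable. Let $r\in Y$ be feasible and let $(x^\star,u^\star)$, with $u^\star\in K$ and $x^\star\in\mathrm{dom}(A(\cdot,u^\star))$, be the unique (among elements of $C\times K$) steady-state pair such that $g(x^\star,u^\star)=r$. Then, for all initial data $(x_0,z_0)\in C\times K$, the corresponding (generalized) solution $(x,z)\in\mathcal C([0,+\infty),X\times Y)$ of the closed loop $$\dot x\in A(x,z),\qquad \dot z\in r-g(x,z)-N_K(z)$$ satisfies $$(x(t),z(t))\to(x^\star,u^\star)\quad\text{in }X\times Y,\qquad t\to+\infty.$$ Moreover, for any $r\in Y$ and for all initial data $(x_0,z_0)\in C\times K$, the corresponding closed-loop solution satisfies $z(t)\in K$ for all $t\ge 0$.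
   Context: All vector spaces are real. $X$ and $U=Y$ are Hilbert spaces, $C\subset X$ is nonempty, closed and convex, and $K\subset Y$ is nonempty, closed and convex with nonempty interior. A multivalued map $M:E\rightrightarrows F$ assigns to each $x\in E$ a possibly empty set $M(x)\subset F$; $\mathrm{dom}(M)=\{x: M(x)\ne\emptyset\}$, $\mathrm{ran}(M)=\bigcup_x M(x)$. For a Hilbert space $H$, $M:H\rightrightarrows H$ is maximal dissipative if $\langle f_1-f_2,x_1-x_2\rangle_H\le 0$ for all $x_i\in\mathrm{dom}(M)$, $f_i\in M(x_i)$, and there exists $\lambda>0$ with $\mathrm{ran}(\lambda\,\mathrm{id}-M)=H$. Plant: $\dot x\in A(x,u)$, $y=g(x,u)$, where $A:X\times U\rightrightarrows X$ is multivalued and $g:\mathrm{dom}(g)\subset X\times U\to Y$ is single-valued. A steady-state pair is $(x^\star,u^\star)\in C\times K$ with $0\in A(x^\star,u^\star)$. Standing assumptions. - Steady-state behavior: for each $u\in K$ there is a unique $x\in C$ with $0\in A(x,u)$; for each $x\in C$ there is at most one $u\in K$ with $0\in A(x,u)$. - Compatibility: $\mathrm{dom}(A)\subset\mathrm{dom}(g)$ and $U=Y$. - Maximal dissipative coupling: $\mathcal A:X\times Y\rightrightarrows X\times Y$, $\mathcal A(x,u)=A(x,u)\times\{-g(x,u)\}$, is maximal dissipative and $\overline{\mathrm{dom}(\mathcal A)}=C\times Y$. - Distinguishability: if $(x^\star,u^\star)$, $(x^\dagger,u^\dagger)$ are steady-state pairs with $\langle u^\star-u^\dagger,g(x^\star,u^\star)-g(x^\dagger,u^\dagger)\rangle_Y=0$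 (this quantity is $h(x^\star,u^\star;x^\dagger,u^\dagger)$ for the function $h$ below), then $x^\star=x^\dagger$. - Compactness: $Y$ is finite-dimensional, and there is $\lambda>0$ such that for all bounded $F\subset X$, $V\subset U$ the set of all $x$ satisfying $f\in\lambda x-A(x,u)$ for some $f\in F$, $u\in V$ is relatively compact in $X$. A function on $[0,+\infty)$ with values in a Hilbert space is absolutely continuous if on each $[0,T]$ it is a constant plus the indefinite integral of an $L^1$ function. Given $u:[0,+\infty)\to U$ absolutely continuous, a strong solution of $\dot x\in A(x,u)$ with input $u$ is an absolutely continuous $x:[0,+\infty)\to X$ with $x(t)\in\mathrm{dom}(A(\cdot,u(t)))$ for all $t\ge0$ and $\dot x(t)\in A(x(t),u(t))$ a.e. (Constant functions given by a steady-state pair form such a solution.) For strong solutions $x_1,x_2$ with inputs $u_1,u_2$, define a.e. on $(0,+\infty)$ $$h(x_1,u_1;x_2,u_2)=\langle u_1-u_2,g(x_1,u_1)-g(x_2,u_2)\rangle_Y-\tfrac12\tfrac{d}{dt}\|x_1-x_2\|_X^2 .$$ The plant is strictly output incrementally passive if for any strong solutions $x_1,x_2$ with inputs $u_1,u_2$, $h(x_1,u_1;x_2,u_2)=0$ a.e. implies $g(x_1,u_1)=g(x_2,u_2)$ a.e. A steady-state pair $(x^\star,u^\star)$ is $h$-detectable if for any strong solution $x$ with constant input $u^\star$, $h(x,u^\star;x^\star,u^\star)=0$ a.e. implies $x(t)=x^\star$ for all $t\ge0$. A reference $r\in Y$ is feasible if there is $u^\star\in K$ such that the steady-state pair $(x^\star,u^\star)$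 satisfies $g(x^\star,u^\star)=r$. Normal cone: $N_K(z)=\{w\in Y:\langle w,z-y\rangle_Y\ge0\ \forall y\in K\}$ for $z\in K$, $N_K(z)=\emptyset$ otherwise. Closed-loop operator: $\mathcal A_r(x,z)=A(x,z)\times(r-g(x,z)-N_K(z))$ on $\mathrm{dom}(\mathcal A_r)=\{(x,z)\in C\times K: x\in\mathrm{dom}(A(\cdot,z))\}$. A strong solution of the closed loop is an absolutely continuous function with values in $\mathrm{dom}(\mathcal A_r)$ satisfying $(\dot x,\dot z)\in\mathcal A_r(x,z)$ a.e.; a generalized solution is a function that on each $[0,T]$ is the uniform limit of strong solutions. For each $(x_0,z_0)\in C\times K$ there is exactly one generalized solution starting there. *)

theory Defs
  imports "HOL-Analysis.Analysis"
begin

section \<open>Multivalued maps\<close>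

type_synonym ('e, 'f) multimap = "'e \<Rightarrow> 'f set"

definition mdom :: "('e, 'f) multimap \<Rightarrow> 'e set" where
  "mdom M = {x. M x \<noteq> {}}"

definition mran :: "('e, 'f) multimap \<Rightarrow> 'f set" where
  "mran M = (\<Union>x. M x)"

definition maximal_dissipative :: "('h::real_inner, 'h) multimap \<Rightarrow> bool" where
  "maximal_dissipative M \<longleftrightarrow>
     (\<forall>x\<^sub>1 \<in> mdom M. \<forall>x\<^sub>2 \<in> mdom M. \<forall>f\<^sub>1 \<in> M x\<^sub>1. \<forall>f\<^sub>2 \<in> M x\<^sub>2.
        inner (f\<^sub>1 - f\<^sub>2) (x\<^sub>1 - x\<^sub>2) \<le> 0) \<and>
     (\<exists>l>0. mran (\<lambda>x. {l *\<^sub>R x - f |f. f \<in> M x}) = UNIV)"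

definition normal_cone :: "'b::real_inner set \<Rightarrow> ('b, 'b) multimap" where
  "normal_cone K z = (if z \<in> K then {w. \<forall>y\<in>K. inner w (z - y) \<ge> 0} else {})"


section \<open>Absolutely continuous functions with values in a normed space\<close>

text \<open>The library predicate \<open>has_bochner_integral\<close> is restricted to second countable
  spaces. The following is the same definition without that restriction, so that Hilbert
  spaces need not be separable. Strong measurability is enforced by the approximating
  simple functions.\<close>

definition has_Bochner_integral ::
    "'s measure \<Rightarrow> ('s \<Rightarrow> 'h::real_normed_vector) \<Rightarrow> 'h \<Rightarrow> bool" where
  "has_Bochner_integral M f I \<longleftrightarrow>
     f \<in> borel_measurable M \<and>
     (\<exists>s. (\<forall>i. Bochner_Integration.simple_bochner_integrable M (s i)) \<and>
          (\<lambda>i. \<integral>\<^sup>+x. norm (f x - s i x) \<partial>M) \<longlonglongrightarrow> 0 \<and>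
          (\<lambda>i. Bochner_Integration.simple_bochner_integral M (s i)) \<longlonglongrightarrow> I)"

lemma has_Bochner_integral_eq:
  fixes f :: "'s \<Rightarrow> 'h::{real_normed_vector, second_countable_topology}"
  shows "has_Bochner_integral M f I \<longleftrightarrow> has_bochner_integral M f I"
  unfolding has_Bochner_integral_def has_bochner_integral.simps by blast

text \<open>On each \<open>[0,T]\<close> the function is a constant plus the indefinite integral of some
  \<open>v\<close>; the case \<open>t = T\<close> says that \<open>v\<close> is in \<open>L\<^sup>1([0,T])\<close>. Functions on
  \<open>[0,+\<infinity>)\<close> are represented by functions on \<open>real\<close> whose values at negative
  times play no role.\<close>

definition abs_cont :: "(real \<Rightarrow> 'h::real_normed_vector) \<Rightarrow> bool" where
  "abs_cont w \<longleftrightarrow>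
     (\<forall>T\<ge>0. \<exists>c v. \<forall>t\<in>{0..T}.
        has_Bochner_integral lebesgue (\<lambda>s. indicat_real {0..t} s *\<^sub>R v s) (w t - c))"


section \<open>The plant\<close>

text \<open>The map \<open>g\<close> with domain \<open>dom(g)\<close> is represented by a total function together
  with a set \<open>D\<close>.\<close>

definition steady_state_pair ::
    "('a::real_inner \<times> 'b::real_inner, 'a) multimap \<Rightarrow> 'a set \<Rightarrow> 'b set \<Rightarrow> 'a \<times> 'b \<Rightarrow> bool" where
  "steady_state_pair A C K p \<longleftrightarrow> p \<in> C \<times> K \<and> 0 \<in> A p"

definition steady_state_behavior ::
    "('a::real_inner \<times> 'b::real_inner, 'a) multimap \<Rightarrow> 'a set \<Rightarrow> 'b set \<Rightarrow> bool" where
  "steady_state_behavior A C K \<longleftrightarrow>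
     (\<forall>u\<in>K. \<exists>!x. x \<in> C \<and> 0 \<in> A (x, u)) \<and>
     (\<forall>x\<in>C. \<forall>u\<in>K. \<forall>u'\<in>K. 0 \<in> A (x, u) \<and> 0 \<in> A (x, u') \<longrightarrow> u = u')"

definition coupling ::
    "('a \<times> 'b, 'a) multimap \<Rightarrow> ('a \<times> 'b \<Rightarrow> 'b::real_inner) \<Rightarrow> ('a \<times> 'b, 'a \<times> 'b) multimap" where
  "coupling A g p = A p \<times> {- g p}"

definition maximal_dissipative_coupling ::
    "('a::real_inner \<times> 'b::real_inner, 'a) multimap \<Rightarrow> ('a \<times> 'b \<Rightarrow> 'b) \<Rightarrow> 'a set \<Rightarrow> bool" where
  "maximal_dissipative_coupling A g C \<longleftrightarrow>
     maximal_dissipative (coupling A g) \<and> closure (mdom (coupling A g)) = C \<times> UNIV"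

definition distinguishability ::
    "('a::real_inner \<times> 'b::real_inner, 'a) multimap \<Rightarrow> ('a \<times> 'b \<Rightarrow> 'b) \<Rightarrow>
     'a set \<Rightarrow> 'b set \<Rightarrow> bool" where
  "distinguishability A g C K \<longleftrightarrow>
     (\<forall>x u x' u'. steady_state_pair A C K (x, u) \<and> steady_state_pair A C K (x', u') \<and>
        inner (u - u') (g (x, u) - g (x', u')) = 0 \<longrightarrow> x = x')"

text \<open>Finite dimension is stated through a finite spanning set; the class
  \<open>euclidean_space\<close> would exclude the zero space.\<close>

definition compactness_condition ::
    "('a::real_inner \<times> 'b::real_inner, 'a) multimap \<Rightarrow> bool" where
  "compactness_condition A \<longleftrightarrow>
     (\<exists>B::'b set. finite B \<and> span B = UNIV) \<and>
     (\<exists>l>0. \<forall>F V. bounded F \<and> bounded V \<longrightarrow>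
        compact (closure {x. \<exists>f\<in>F. \<exists>u\<in>V. f \<in> {l *\<^sub>R x - a |a. a \<in> A (x, u)}}))"

definition strong_solution ::
    "('a::real_inner \<times> 'b::real_inner, 'a) multimap \<Rightarrow> (real \<Rightarrow> 'b) \<Rightarrow> (real \<Rightarrow> 'a) \<Rightarrow> bool" where
  "strong_solution A u x \<longleftrightarrow>
     abs_cont u \<and> abs_cont x \<and>
     (\<forall>t\<ge>0. x t \<in> mdom (\<lambda>\<xi>. A (\<xi>, u t))) \<and>
     (AE t in lebesgue. t > 0 \<longrightarrow>
        (\<exists>d \<in> A (x t, u t). (x has_vector_derivative d) (at t)))"

definition passivity_defect ::
    "('a::real_inner \<times> 'b::real_inner \<Rightarrow> 'b) \<Rightarrow> (real \<Rightarrow> 'a) \<Rightarrow> (real \<Rightarrow> 'b) \<Rightarrow>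
     (real \<Rightarrow> 'a) \<Rightarrow> (real \<Rightarrow> 'b) \<Rightarrow> real \<Rightarrow> real" where
  "passivity_defect g x\<^sub>1 u\<^sub>1 x\<^sub>2 u\<^sub>2 t =
     inner (u\<^sub>1 t - u\<^sub>2 t) (g (x\<^sub>1 t, u\<^sub>1 t) - g (x\<^sub>2 t, u\<^sub>2 t)) -
     1/2 * deriv (\<lambda>s. (norm (x\<^sub>1 s - x\<^sub>2 s))\<^sup>2) t"

definition strictly_output_incrementally_passive ::
    "('a::real_inner \<times> 'b::real_inner, 'a) multimap \<Rightarrow> ('a \<times> 'b \<Rightarrow> 'b) \<Rightarrow> bool" where
  "strictly_output_incrementally_passive A g \<longleftrightarrow>
     (\<forall>x\<^sub>1 u\<^sub>1 x\<^sub>2 u\<^sub>2. strong_solution A u\<^sub>1 x\<^sub>1 \<and> strong_solution A u\<^sub>2 x\<^sub>2 \<and>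
        (AE t in lebesgue. t > 0 \<longrightarrow> passivity_defect g x\<^sub>1 u\<^sub>1 x\<^sub>2 u\<^sub>2 t = 0) \<longrightarrow>
        (AE t in lebesgue. t > 0 \<longrightarrow> g (x\<^sub>1 t, u\<^sub>1 t) = g (x\<^sub>2 t, u\<^sub>2 t)))"

definition h_detectable ::
    "('a::real_inner \<times> 'b::real_inner, 'a) multimap \<Rightarrow> ('a \<times> 'b \<Rightarrow> 'b) \<Rightarrow> 'a \<times> 'b \<Rightarrow> bool" where
  "h_detectable A g p \<longleftrightarrow>
     (\<forall>x. strong_solution A (\<lambda>_. snd p) x \<and>
        (AE t in lebesgue. t > 0 \<longrightarrow>
           passivity_defect g x (\<lambda>_. snd p) (\<lambda>_. fst p) (\<lambda>_. snd p) t = 0) \<longrightarrow>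
        (\<forall>t\<ge>0. x t = fst p))"

definition feasible ::
    "('a::real_inner \<times> 'b::real_inner, 'a) multimap \<Rightarrow> ('a \<times> 'b \<Rightarrow> 'b) \<Rightarrow>
     'a set \<Rightarrow> 'b set \<Rightarrow> 'b \<Rightarrow> bool" where
  "feasible A g C K r \<longleftrightarrow>
     (\<exists>u\<in>K. \<exists>x. steady_state_pair A C K (x, u) \<and> g (x, u) = r)"


section \<open>The closed loop\<close>

definition closed_loop ::
    "('a::real_inner \<times> 'b::real_inner, 'a) multimap \<Rightarrow> ('a \<times> 'b \<Rightarrow> 'b) \<Rightarrow>
     'a set \<Rightarrow> 'b set \<Rightarrow> 'b \<Rightarrow> ('a \<times> 'b, 'a \<times> 'b) multimap" where
  "closed_loop A g C K r p =
     (if p \<in> C \<times> K then A p \<times> {r - g p - n |n. n \<in> normal_cone K (snd p)} else {})"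

lemma mdom_closed_loop:
  "mdom (closed_loop A g C K r) = {(x, z). (x, z) \<in> C \<times> K \<and> x \<in> mdom (\<lambda>\<xi>. A (\<xi>, z))}"
proof -
  have "0 \<in> normal_cone K z" if "z \<in> K" for z :: 'b
    using that by (simp add: normal_cone_def)
  then show ?thesis
    unfolding mdom_def closed_loop_def by (auto split: if_splits) blast+
qed

definition closed_loop_strong_solution ::
    "('a::real_inner \<times> 'b::real_inner, 'a) multimap \<Rightarrow> ('a \<times> 'b \<Rightarrow> 'b) \<Rightarrow>
     'a set \<Rightarrow> 'b set \<Rightarrow> 'b \<Rightarrow> (real \<Rightarrow> 'a \<times> 'b) \<Rightarrow> bool" where
  "closed_loop_strong_solution A g C K r w \<longleftrightarrow>
     abs_cont w \<and>
     (\<forall>t\<ge>0. w t \<in> mdom (closed_loop A g C K r)) \<and>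
     (AE t in lebesgue. t > 0 \<longrightarrow>
        (\<exists>d \<in> closed_loop A g C K r (w t). (w has_vector_derivative d) (at t)))"

definition closed_loop_generalized_solution ::
    "('a::real_inner \<times> 'b::real_inner, 'a) multimap \<Rightarrow> ('a \<times> 'b \<Rightarrow> 'b) \<Rightarrow>
     'a set \<Rightarrow> 'b set \<Rightarrow> 'b \<Rightarrow> (real \<Rightarrow> 'a \<times> 'b) \<Rightarrow> bool" where
  "closed_loop_generalized_solution A g C K r w \<longleftrightarrow>
     (\<forall>T\<ge>0. \<exists>W. (\<forall>n::nat. closed_loop_strong_solution A g C K r (W n)) \<and>
        uniform_limit {0..T} W w sequentially)"

end

theory Submission
  imports Defs
begin

text \<open>
  The closed-loop map is dissipative, so strong solutions contract and every generalized solution is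
  a uniform limit on \<open>[0, \<infinity>)\<close> of strong ones (\<open>generalized_solution_approx\<close>). Hence it is enough
  to prove convergence for a strong solution \<open>w = (x, z)\<close>. Its distance to the equilibrium
  \<open>(x\<^sub>s, u\<^sub>s)\<close> decreases to a limit \<open>\<delta>\<close>; its velocity is bounded, so the compactness condition and
  the finite dimension of \<open>Y\<close> make the orbit relatively compact (\<open>closed_loop_precompact\<close>). Translates
  of \<open>w\<close> along a suitable sequence of times therefore converge uniformly to a limit trajectory \<open>W\<close>,
  which has constant distance \<open>\<delta>\<close> to the equilibrium and is recurrent
  (\<open>strong_flow_limit_trajectory\<close>). LaSalle's argument (\<open>limit_trajectory_equilibrium\<close>) shows that
  \<open>W\<close> is the equilibrium: constancy of the distance forces the passivity defect to vanish, output
  passivity gives \<open>g = r\<close>, hence the integrator state stands still, and recurrence, detectability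
  and distinguishability identify the remaining steady state. So \<open>\<delta> = 0\<close>.

  The passivity and detectability hypotheses speak of strong solutions only, so the main difficulty is
  that the limit \<open>W\<close> of strong solutions is again one. This rests on two facts. First, the
  closed-loop map is maximal dissipative (\<open>maximal_dissipative_closed_loop\<close>): the normal cone is
  approximated by a penalty, whose forces are bounded because some point of the domain lies over the
  interior of \<open>K\<close>. Secondly, for a maximal dissipative map every limit of strong solutions is
  differentiable off a countable set, with derivative the element of minimal norm
  (\<open>trajectory_differentiable\<close>). The norm of that element decreases along the trajectory, and
  wherever it is continuous the difference quotients converge strongly; this replaces the almost
  everywhere differentiability of Lipschitz functions with values in a Hilbert space. Weak compactness
  enters only through intersections of nested closed convex sets (\<open>ex_weak_cluster_point\<close>).

  Absolute continuity is used in a form free of integrals: over a null set the increments are dominated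
  by those of a monotone function of arbitrarily small total increase (\<open>null_controlled\<close>). Together
  with a continuous induction this yields monotonicity from the sign of the derivative almost
  everywhere (\<open>nonincreasing_ae\<close>).
\<close>

section \<open>Convex sets and weak cluster points in a Hilbert space\<close>

text \<open>A substitute for weak compactness: elements \<open>x n\<close> of almost minimal norm in \<open>S n\<close> form a
  Cauchy sequence, by the parallelogram law applied to \<open>(x m + x n) / 2\<close>, which stays in the
  larger of the two sets.\<close>

lemma nested_convex_Inter_nonempty:
  fixes S :: "nat \<Rightarrow> 'h::{real_inner, complete_space} set"
  assumes closed: "\<And>n. closed (S n)" and convex: "\<And>n. convex (S n)"
    and nonempty: "\<And>n. S n \<noteq> {}" and dec: "decseq S" and bounded: "\<And>n x. x \<in> S n \<Longrightarrow> norm x \<le> R"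
  shows "\<exists>x. \<forall>n. x \<in> S n"
proof -
  define d where "d n = Inf (norm ` S n)" for n
  have bdd: "bdd_below (norm ` S n)" for n by (rule bdd_belowI[of _ 0]) auto
  have d_le: "d n \<le> norm x" if "x \<in> S n" for n x
    unfolding d_def using that bdd by (simp add: cINF_lower)
  have d_nonneg: "0 \<le> d n" for n
    unfolding d_def using nonempty by (intro cINF_greatest) auto
  have "incseq d"
    unfolding d_def incseq_def using dec nonempty bdd
    by (auto intro!: cInf_superset_mono simp: decseq_def)
  moreover have "d n \<le> R" for n
    using nonempty[of n] bounded d_le by (metis ex_in_conv order_trans)
  ultimately obtain l where l: "d \<longlonglongrightarrow> l" and d_le_l: "\<And>n. d n \<le> l"
    by (metis incseq_convergent)
  have "\<exists>x. x \<in> S n \<and> norm x < d n + 1 / Suc n" for n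
  proof -
    have "\<exists>y\<in>norm ` S n. y < d n + 1 / Suc n"
      unfolding d_def using nonempty bdd by (subst cInf_less_iff[symmetric]) auto
    then show ?thesis by blast
  qed
  then obtain x where x_S: "\<And>n. x n \<in> S n" and x_norm: "\<And>n. norm (x n) < d n + 1 / Suc n"
    by metis
  define e where "e n = 4 * ((l + 1 / Suc n)\<^sup>2 - (d n)\<^sup>2)" for n
  have "e \<longlonglongrightarrow> 4 * ((l + 0)\<^sup>2 - l\<^sup>2)"
    unfolding e_def using LIMSEQ_Suc[OF lim_1_over_n] by (intro tendsto_intros l) simp
  then have e_lim: "e \<longlonglongrightarrow> 0" by simp
  have close: "(norm (x m - x n))\<^sup>2 \<le> e n" if "n \<le> m" for m n
  proof -
    have "x m \<in> S n" using x_S[of m] dec that by (auto simp: decseq_def)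
    then have "(1/2) *\<^sub>R x m + (1/2) *\<^sub>R x n \<in> S n"
      using convexD[OF convex, of "x m" n "x n" "1/2" "1/2"] x_S by simp
    then have "d n \<le> norm ((1/2) *\<^sub>R (x m + x n))" using d_le by (simp add: scaleR_add_right)
    then have "2 * d n \<le> norm (x m + x n)" by simp
    then have "(2 * d n)\<^sup>2 \<le> (norm (x m + x n))\<^sup>2" using d_nonneg[of n] by (intro power_mono) auto
    moreover have "norm (x m) \<le> l + 1 / Suc n"
    proof -
      have "(1::real) / Suc m \<le> 1 / Suc n" using that by (simp add: frac_le)
      then show ?thesis using x_norm[of m] d_le_l[of m] by linarith
    qed
    then have "(norm (x m))\<^sup>2 \<le> (l + 1 / Suc n)\<^sup>2" by (intro power_mono) auto
    moreover have "norm (x n) \<le> l + 1 / Suc n" using x_norm[of n] d_le_l[of n] by linarith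
    then have "(norm (x n))\<^sup>2 \<le> (l + 1 / Suc n)\<^sup>2" by (intro power_mono) auto
    moreover have "(norm (x m - x n))\<^sup>2 + (norm (x m + x n))\<^sup>2 = 2 * (norm (x m))\<^sup>2 + 2 * (norm (x n))\<^sup>2"
      by (simp add: power2_norm_eq_inner algebra_simps inner_commute)
    ultimately show ?thesis by (simp add: e_def power_mult_distrib)
  qed
  have "Cauchy x"
  proof (rule metric_CauchyI)
    fix r :: real assume "0 < r"
    then have "0 < (r/2)\<^sup>2" by simp
    then obtain N where N: "e N < (r/2)\<^sup>2" using order_tendstoD(2)[OF e_lim] by (meson eventually_sequentially order_refl)
    have "norm (x m - x N) < r/2" if "N \<le> m" for m
      using close[OF that] N \<open>0 < r\<close> by (intro power2_less_imp_less[of "norm (x m - x N)" "r/2"]) auto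
    then show "\<exists>M. \<forall>m\<ge>M. \<forall>n\<ge>M. dist (x m) (x n) < r"
      by (intro exI[of _ N]) (metis dist_norm dist_triangle_half_l)
  qed
  then obtain y where y: "x \<longlonglongrightarrow> y" using Cauchy_convergent convergent_def by blast
  have "y \<in> S n" for n
  proof (rule Lim_in_closed_set[OF closed _ _ y])
    show "\<forall>\<^sub>F m in sequentially. x m \<in> S n"
      using x_S dec unfolding decseq_def eventually_sequentially by blast
  qed auto
  then show ?thesis by blast
qed

lemma ex_minimal_norm:
  fixes S :: "'h::{real_inner, complete_space} set"
  assumes "closed S" "convex S" "S \<noteq> {}"
  shows "\<exists>x\<in>S. \<forall>y\<in>S. norm x \<le> norm y"
proof -
  define d where "d = Inf (norm ` S)"
  have bdd: "bdd_below (norm ` S)" by (rule bdd_belowI[of _ 0]) auto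
  define T where "T n = S \<inter> cball 0 (d + 1 / Suc n)" for n :: nat
  have "T n \<noteq> {}" for n
  proof -
    have "\<exists>y\<in>norm ` S. y < d + 1 / Suc n"
      unfolding d_def using assms bdd by (subst cInf_less_iff[symmetric]) auto
    then show ?thesis by (auto simp: T_def intro: less_imp_le)
  qed
  moreover have "decseq T"
    unfolding decseq_def T_def
  proof (intro allI impI)
    fix m n :: nat assume "m \<le> n"
    then have "d + 1 / real (Suc n) \<le> d + 1 / real (Suc m)" by (simp add: frac_le)
    then show "S \<inter> cball 0 (d + 1 / real (Suc n)) \<subseteq> S \<inter> cball 0 (d + 1 / real (Suc m))"
      by (intro Int_mono subset_cball) auto
  qed
  moreover have "norm x \<le> d + 1" if "x \<in> T n" for n x
  proof -
    have "1 / real (Suc n) \<le> 1" by simp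
    moreover have "norm x \<le> d + 1 / real (Suc n)" using that unfolding T_def by auto
    ultimately show ?thesis by linarith
  qed
  ultimately obtain x where x: "\<And>n. x \<in> T n"
    using nested_convex_Inter_nonempty[of T "d + 1"] assms unfolding T_def
    by (metis closed_Int closed_cball convex_Int convex_cball)
  have "(\<lambda>n. d + 1 / real (Suc n)) \<longlonglongrightarrow> d + 0"
    using LIMSEQ_Suc[OF lim_1_over_n] by (intro tendsto_intros) simp
  moreover have "norm x \<le> d + 1 / real (Suc n)" for n using x[of n] by (simp add: T_def)
  ultimately have "norm x \<le> d" using LIMSEQ_le_const[of _ "d + 0" "norm x"] by auto
  moreover have "d \<le> norm y" if "y \<in> S" for y
    unfolding d_def using that bdd by (simp add: cINF_lower)
  ultimately show ?thesis using x[of 0] unfolding T_def by (meson IntD1 order_trans)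
qed

lemma minimal_norm_variational:
  fixes x :: "'h::real_inner"
  assumes "convex S" "x \<in> S" and min: "\<And>y. y \<in> S \<Longrightarrow> norm x \<le> norm y" and "y \<in> S"
  shows "0 \<le> inner x (y - x)"
proof (rule ccontr)
  assume neg: "\<not> 0 \<le> inner x (y - x)"
  define s where "s = min 1 (- inner x (y - x) / ((norm (y - x))\<^sup>2 + 1))"
  have den: "0 < (norm (y - x))\<^sup>2 + 1" by (meson zero_le_power2 add_nonneg_pos zero_less_one)
  have s: "0 < s" "s \<le> 1" using neg den by (simp_all add: s_def divide_less_0_iff not_le)
  have "s \<le> - inner x (y - x) / ((norm (y - x))\<^sup>2 + 1)" by (simp add: s_def)
  then have "s * ((norm (y - x))\<^sup>2 + 1) \<le> - inner x (y - x)" using den by (simp only: pos_le_divide_eq)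
  then have le: "s * (norm (y - x))\<^sup>2 \<le> - inner x (y - x)"
    using s by (simp add: algebra_simps)
  have "x + s *\<^sub>R (y - x) \<in> S"
    using convexD[OF assms(1,2,4), of "1 - s" s] s by (simp add: algebra_simps)
  then have "(norm x)\<^sup>2 \<le> (norm (x + s *\<^sub>R (y - x)))\<^sup>2" using min by (intro power_mono) auto
  also have "\<dots> = (norm x)\<^sup>2 + s * (2 * inner x (y - x) + s * (norm (y - x))\<^sup>2)"
    unfolding power2_norm_eq_inner inner_add_left inner_add_right inner_scaleR_left inner_scaleR_right
      inner_commute[of "y - x" x] by (simp add: algebra_simps)
  also have "\<dots> < (norm x)\<^sup>2" using s le neg by (simp add: mult_less_0_iff not_le)
  finally show False by simp
qed

lemma minimal_norm_unique:
  fixes x :: "'h::real_inner"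
  assumes "convex S" "x \<in> S" "\<And>y. y \<in> S \<Longrightarrow> norm x \<le> norm y" "y \<in> S" "norm y \<le> norm x"
  shows "y = x"
proof -
  have "0 \<le> inner x (y - x)" using minimal_norm_variational assms(1-4) by blast
  then have "(norm (y - x))\<^sup>2 \<le> (norm y)\<^sup>2 - (norm x)\<^sup>2"
    by (simp add: power2_norm_eq_inner inner_diff_left inner_diff_right inner_commute)
  also have "\<dots> \<le> 0" using assms(5) by (simp add: power_mono)
  finally show ?thesis by simp
qed

lemma ex_convex_projection:
  fixes K :: "'h::{real_inner, complete_space} set"
  assumes "closed K" "convex K" "K \<noteq> {}"
  shows "\<exists>P. (\<forall>z. P z \<in> K) \<and> (\<forall>z. z - P z \<in> normal_cone K (P z))"
proof -
  have "\<exists>p\<in>K. \<forall>y\<in>K. 0 \<le> inner (z - p) (p - y)" for z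
  proof -
    let ?S = "(\<lambda>y. - z + y) ` K"
    have S: "closed ?S" "convex ?S" "?S \<noteq> {}"
      using assms closed_translation[of K "- z"] convex_translation[of K "- z"] by auto
    then obtain x where x: "x \<in> ?S" "\<forall>y\<in>?S. norm x \<le> norm y" using ex_minimal_norm by blast
    then obtain p where p: "p \<in> K" "x = p - z" by auto
    have "0 \<le> inner (z - p) (p - y)" if "y \<in> K" for y
    proof -
      have "0 \<le> inner x ((- z + y) - x)"
        using minimal_norm_variational[OF S(2) x(1)] x(2) that by blast
      then show ?thesis using p by (simp add: inner_diff_left inner_diff_right algebra_simps)
    qed
    then show ?thesis using p by blast
  qed
  then obtain P where "\<And>z. P z \<in> K \<and> (\<forall>y\<in>K. 0 \<le> inner (z - P z) (P z - y))" by metis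
  then show ?thesis unfolding normal_cone_def by (intro exI[of _ P]) auto
qed

text \<open>Every bounded sequence has a weak cluster point: any point in all closed convex hulls of its
  tails. It inherits every affine bound that holds eventually, and this is the only property of
  weak limits that is used.\<close>

lemma ex_weak_cluster_point:
  fixes q :: "nat \<Rightarrow> 'h::{real_inner, complete_space}"
  assumes "\<And>n. norm (q n) \<le> R"
  shows "\<exists>\<zeta>. \<forall>a c. (\<forall>\<^sub>F n in sequentially. inner a (q n) \<le> c) \<longrightarrow> inner a \<zeta> \<le> c"
proof -
  define S where "S n = closure (convex hull (q ` {n..}))" for n
  have sub: "S n \<subseteq> X" if "q ` {n..} \<subseteq> X" "closed X" "convex X" for n X
    unfolding S_def using that by (simp add: closure_minimal hull_minimal)
  have "\<exists>x. \<forall>n. x \<in> S n"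
  proof (rule nested_convex_Inter_nonempty)
    show "closed (S n)" "convex (S n)" "S n \<noteq> {}" for n by (auto simp: S_def convex_closure)
    show "decseq S" unfolding decseq_def S_def by (auto intro!: closure_mono hull_mono)
    show "norm x \<le> R" if "x \<in> S n" for n x
    proof -
      have "S n \<subseteq> cball 0 R" using assms by (intro sub) auto
      then show ?thesis using that by auto
    qed
  qed
  then obtain \<zeta> where \<zeta>: "\<And>n. \<zeta> \<in> S n" by blast
  have "inner a \<zeta> \<le> c" if "\<forall>\<^sub>F n in sequentially. inner a (q n) \<le> c" for a c
  proof -
    obtain N where "\<And>n. N \<le> n \<Longrightarrow> inner a (q n) \<le> c"
      using \<open>\<forall>\<^sub>F n in sequentially. inner a (q n) \<le> c\<close> by (auto simp: eventually_sequentially)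
    then have "S N \<subseteq> {x. inner a x \<le> c}"
      by (intro sub) (auto simp: closed_halfspace_le convex_halfspace_le)
    then show ?thesis using \<zeta> by auto
  qed
  then show ?thesis by blast
qed

section \<open>Bounded sequences in a finite-dimensional inner product space\<close>

lemma ex_orthonormal_spanning:
  fixes B :: "'b::real_inner set"
  assumes "finite B"
  shows "\<exists>E. finite E \<and> B \<subseteq> span E \<and> (\<forall>e\<in>E. \<forall>f\<in>E. inner e f = (if e = f then 1 else 0))"
  using assms
proof induction
  case empty
  then show ?case by (intro exI[of _ "{}"]) auto
next
  case (insert b B)
  then obtain E where E: "finite E" "B \<subseteq> span E"
    and ortho: "\<And>e f. e \<in> E \<Longrightarrow> f \<in> E \<Longrightarrow> inner e f = (if e = f then 1 else 0)" by blast
  define p where "p = (\<Sum>e\<in>E. inner b e *\<^sub>R e)"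
  have p_span: "p \<in> span E" unfolding p_def by (intro span_sum span_scale span_base)
  have p_inner: "inner p f = inner b f" if "f \<in> E" for f
  proof -
    have "inner p f = (\<Sum>e\<in>E. if e = f then inner b f else 0)"
      unfolding p_def inner_sum_left by (intro sum.cong) (auto simp: ortho that)
    then show ?thesis using E that by simp
  qed
  show ?case
  proof (cases "b = p")
    case True
    then show ?thesis using E ortho p_span by (intro exI[of _ E]) auto
  next
    case False
    define c where "c = norm (b - p)"
    define u where "u = (1/c) *\<^sub>R (b - p)"
    have c: "c > 0" using False by (simp add: c_def)
    have u0: "inner u f = 0" if "f \<in> E" for f
      using p_inner[OF that] by (simp add: u_def inner_diff_left)
    have uu: "inner u u = 1"
      using c by (simp add: u_def flip: power2_norm_eq_inner) (simp add: c_def power2_norm_eq_inner[symmetric] power2_eq_square)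
    have "b = p + c *\<^sub>R u" using c by (simp add: u_def)
    moreover have "p + c *\<^sub>R u \<in> span (insert u E)"
      by (intro span_add span_scale) (auto intro: span_base subsetD[OF span_mono p_span])
    ultimately have "b \<in> span (insert u E)" by simp
    moreover have "B \<subseteq> span (insert u E)"
      using E(2) span_mono[of E "insert u E"] by auto
    moreover have "u \<notin> E" using u0 uu by fastforce
    ultimately show ?thesis using E ortho u0 uu
      by (intro exI[of _ "insert u E"]) (auto simp: inner_commute)
  qed
qed

lemma bounded_real_family_convergent_subseq:
  fixes f :: "'i \<Rightarrow> nat \<Rightarrow> real"
  assumes "finite I" "\<And>i n. i \<in> I \<Longrightarrow> \<bar>f i n\<bar> \<le> R"
  shows "\<exists>r. strict_mono r \<and> (\<forall>i\<in>I. convergent (\<lambda>n. f i (r n)))"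
  using assms
proof induction
  case empty
  then show ?case by (intro exI[of _ id]) (auto simp: strict_mono_def)
next
  case (insert j I)
  then obtain r :: "nat \<Rightarrow> nat" where r: "strict_mono r" "\<And>i. i \<in> I \<Longrightarrow> convergent (\<lambda>n. f i (r n))" by auto
  have "bounded (range (\<lambda>n. f j (r n)))" using insert.prems by (auto simp: bounded_iff)
  then obtain l s where s: "strict_mono s" "(\<lambda>n. f j (r (s n))) \<longlonglongrightarrow> l"
    using bounded_imp_convergent_subsequence[of "\<lambda>n. f j (r n)"] by (auto simp: o_def)
  have "convergent (\<lambda>n. f i (r (s n)))" if "i \<in> I" for i
    using convergent_subseq_convergent[OF r(2)[OF that] s(1)] by (simp add: o_def)
  moreover have "convergent (\<lambda>n. f j (r (s n)))" using s(2) by (auto simp: convergent_def)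
  moreover have "strict_mono (\<lambda>n. r (s n))" using strict_mono_o[OF r(1) s(1)] by (simp add: o_def)
  ultimately show ?case by (intro exI[of _ "\<lambda>n. r (s n)"]) auto
qed

lemma finite_dim_convergent_subseq:
  fixes B :: "'b::real_inner set" and y :: "nat \<Rightarrow> 'b"
  assumes "finite B" "span B = UNIV" "\<And>n. norm (y n) \<le> R"
  shows "\<exists>r l. strict_mono r \<and> (\<lambda>n. y (r n)) \<longlonglongrightarrow> l"
proof -
  obtain E :: "'b set" where E: "finite E" "B \<subseteq> span E"
    and ortho: "\<And>e f. e \<in> E \<Longrightarrow> f \<in> E \<Longrightarrow> inner e f = (if e = f then 1 else 0)"
    using ex_orthonormal_spanning[OF assms(1)] by blast
  have span_E: "x \<in> span E" for x
    using span_mono[OF E(2)] assms(2) by (auto simp: span_span)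
  have expand: "x = (\<Sum>e\<in>E. inner x e *\<^sub>R e)" for x
    using span_E[of x]
  proof (induction x rule: span_induct_alt)
    case base
    then show ?case by simp
  next
    case (step c e x)
    have "(\<Sum>f\<in>E. inner (c *\<^sub>R e) f *\<^sub>R f) = (\<Sum>f\<in>E. if f = e then c *\<^sub>R e else 0)"
      using step by (intro sum.cong) (auto simp: ortho)
    also have "\<dots> = c *\<^sub>R e" using step E by simp
    finally show ?case using step by (simp add: inner_add_left scaleR_add_left sum.distrib)
  qed
  have "\<bar>inner (y n) e\<bar> \<le> R" if "e \<in> E" for e n
  proof -
    have "norm e = 1" using ortho[OF that that] by (simp add: norm_eq_sqrt_inner)
    then show ?thesis using Cauchy_Schwarz_ineq2[of "y n" e] assms(3)[of n] by simp
  qed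
  then obtain r :: "nat \<Rightarrow> nat" where r: "strict_mono r" "\<And>e. e \<in> E \<Longrightarrow> convergent (\<lambda>n. inner (y (r n)) e)"
    using bounded_real_family_convergent_subseq[OF E(1), of "\<lambda>e n. inner (y n) e" R] by auto
  then obtain c where c: "\<And>e. e \<in> E \<Longrightarrow> (\<lambda>n. inner (y (r n)) e) \<longlonglongrightarrow> c e"
    unfolding convergent_def by metis
  have "(\<lambda>n. \<Sum>e\<in>E. inner (y (r n)) e *\<^sub>R e) \<longlonglongrightarrow> (\<Sum>e\<in>E. c e *\<^sub>R e)"
    by (intro tendsto_intros c)
  then show ?thesis using r(1) expand[symmetric] by auto
qed

section \<open>Maximal dissipative maps\<close>

definition dissipative :: "('h::real_inner, 'h) multimap \<Rightarrow> bool" where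
  "dissipative M \<longleftrightarrow> (\<forall>x y. \<forall>f\<in>M x. \<forall>k\<in>M y. inner (f - k) (x - y) \<le> 0)"

definition resolvable :: "real \<Rightarrow> ('h::real_inner, 'h) multimap \<Rightarrow> bool" where
  "resolvable l M \<longleftrightarrow> (\<forall>h. \<exists>x. \<exists>f\<in>M x. l *\<^sub>R x - f = h)"

lemma maximal_dissipative_iff:
  "maximal_dissipative M \<longleftrightarrow> dissipative M \<and> (\<exists>l>0. resolvable l M)"
proof -
  have "(\<Union>x. {l *\<^sub>R x - f |f. f \<in> M x}) = UNIV \<longleftrightarrow> resolvable l M" for l
  proof -
    have "(\<exists>f\<in>M x. l *\<^sub>R x - f = h) \<longleftrightarrow> h \<in> {l *\<^sub>R x - f |f. f \<in> M x}" for x h by auto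
    then show ?thesis unfolding resolvable_def by (simp add: set_eq_iff)
  qed
  moreover have "(\<forall>x\<^sub>1 \<in> mdom M. \<forall>x\<^sub>2 \<in> mdom M. \<forall>f\<^sub>1 \<in> M x\<^sub>1. \<forall>f\<^sub>2 \<in> M x\<^sub>2.
        inner (f\<^sub>1 - f\<^sub>2) (x\<^sub>1 - x\<^sub>2) \<le> 0) \<longleftrightarrow> dissipative M"
    unfolding dissipative_def mdom_def by auto
  ultimately show ?thesis unfolding maximal_dissipative_def mran_def by simp
qed

lemma dissipativeD:
  "dissipative M \<Longrightarrow> f \<in> M x \<Longrightarrow> k \<in> M y \<Longrightarrow> inner (f - k) (x - y) \<le> 0"
  by (auto simp: dissipative_def)

lemma resolvent_Lipschitz:
  assumes "dissipative M" "l > 0" "f \<in> M x" "k \<in> M y"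
  shows "l * norm (x - y) \<le> norm ((l *\<^sub>R x - f) - (l *\<^sub>R y - k))"
proof -
  have "l * (norm (x - y))\<^sup>2 \<le> inner ((l *\<^sub>R x - f) - (l *\<^sub>R y - k)) (x - y)"
    using dissipativeD[OF assms(1,3,4)]
    by (simp add: power2_norm_eq_inner inner_diff_left inner_diff_right inner_commute algebra_simps)
  also have "\<dots> \<le> norm ((l *\<^sub>R x - f) - (l *\<^sub>R y - k)) * norm (x - y)"
    by (rule norm_cauchy_schwarz)
  finally show ?thesis
    by (cases "x = y") (auto simp: power2_eq_square)
qed

text \<open>Solvability of \<open>l x - M x + m (x - P x) = h\<close> for a nonexpansive \<open>P\<close> is a fixed point problem
  for the resolvent of \<open>M\<close> at \<open>l + m\<close>, with contraction factor \<open>m / (l + m)\<close>. With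
  \<open>P = id\<close> and \<open>m\<close> of either sign this moves the parameter of the resolvent itself.\<close>

lemma resolvable_perturbed:
  fixes M :: "('h::{real_inner, complete_space}, 'h) multimap"
  assumes M: "dissipative M" "resolvable (l + m) M" and l: "l + m > 0" "\<bar>m\<bar> < l + m"
    and P: "\<And>x y. norm (P x - P y) \<le> norm (x - y)"
  shows "\<exists>x. \<exists>f\<in>M x. l *\<^sub>R x - f + m *\<^sub>R (x - P x) = h"
proof -
  obtain J F where J: "\<And>h. F h \<in> M (J h)" "\<And>h. (l + m) *\<^sub>R J h - F h = h"
    using M(2) unfolding resolvable_def by metis
  define T where "T x = J (h + m *\<^sub>R P x)" for x
  have "dist (T x) (T y) \<le> (\<bar>m\<bar> / (l + m)) * dist x y" for x y
  proof -
    have "(l + m) * norm (T x - T y) \<le> norm ((h + m *\<^sub>R P x) - (h + m *\<^sub>R P y))"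
      unfolding T_def using resolvent_Lipschitz[OF M(1) l(1) J(1) J(1)] by (simp only: J(2))
    also have "\<dots> = \<bar>m\<bar> * norm (P x - P y)" by (simp flip: scaleR_diff_right)
    also have "\<dots> \<le> \<bar>m\<bar> * norm (x - y)" using P by (intro mult_left_mono) auto
    finally show ?thesis using l(1) by (simp add: dist_norm pos_le_divide_eq mult.commute)
  qed
  then obtain x where x: "T x = x"
    using banach_fix_type[of "\<bar>m\<bar> / (l + m)" T] l by auto
  have "F (h + m *\<^sub>R P x) \<in> M x" using J(1)[of "h + m *\<^sub>R P x"] x by (simp add: T_def)
  moreover have "l *\<^sub>R x - F (h + m *\<^sub>R P x) + m *\<^sub>R (x - P x) = h"
    using J(2)[of "h + m *\<^sub>R P x"] x by (simp add: T_def algebra_simps)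
  ultimately show ?thesis by blast
qed

lemma resolvable_all:
  fixes M :: "('h::{real_inner, complete_space}, 'h) multimap"
  assumes M: "dissipative M" and l0: "resolvable l0 M" "l0 > 0" and "l > 0"
  shows "resolvable l M"
proof -
  have step: "resolvable k' M" if "resolvable k M" "0 < k" "0 < k'" "k' < 2 * k" for k k'
    unfolding resolvable_def
  proof
    fix h
    have "\<exists>x. \<exists>f\<in>M x. k' *\<^sub>R x - f + (k - k') *\<^sub>R (x - x) = h"
      using resolvable_perturbed[of M k' "k - k'" "\<lambda>x. x"] that M by simp
    then show "\<exists>x. \<exists>f\<in>M x. k' *\<^sub>R x - f = h" by simp
  qed
  have grow: "resolvable ((3/2)^n * l0) M" for n :: nat
  proof (induction n)
    case (Suc n)
    then show ?case using l0(2) by (intro step[OF Suc]) auto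
  qed (use l0 in simp)
  obtain n where "l / l0 < (3/2)^n" using real_arch_pow[of "3/2" "l/l0"] by auto
  then have "l < (3/2)^n * l0" using l0(2) by (simp add: pos_divide_less_eq)
  moreover have "0 < (3/2)^n * l0" using l0(2) by simp
  ultimately show ?thesis using grow[of n] step \<open>l > 0\<close> by (smt (verit))
qed

text \<open>Minty: the range condition makes the graph maximal among dissipative graphs.\<close>

lemma maximal_dissipative_graph:
  assumes "maximal_dissipative M" and rel: "\<And>\<xi> \<eta>. \<eta> \<in> M \<xi> \<Longrightarrow> inner (\<zeta> - \<eta>) (p - \<xi>) \<le> 0"
  shows "\<zeta> \<in> M p"
proof -
  obtain l where l: "l > 0" "resolvable l M" using assms(1) by (auto simp: maximal_dissipative_iff)
  obtain x f where x: "f \<in> M x" "l *\<^sub>R x - f = l *\<^sub>R p - \<zeta>"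
    using l(2) unfolding resolvable_def by metis
  then have "\<zeta> - f = l *\<^sub>R (p - x)" by (simp add: algebra_simps)
  then have "l * (norm (p - x))\<^sup>2 \<le> 0" using rel[OF x(1)] by (simp add: power2_norm_eq_inner)
  then have "p = x" using l(1) by (simp add: mult_le_0_iff)
  then show ?thesis using x by auto
qed

text \<open>By maximality each value is an intersection of half-spaces.\<close>

lemma maximal_dissipative_values:
  assumes M: "maximal_dissipative M"
  shows "closed (M p)" "convex (M p)"
proof -
  define G where "G = {(\<xi>, \<eta>). \<eta> \<in> M \<xi>}"
  define H where "H = (\<lambda>(\<xi>, \<eta>). {\<zeta>. inner (p - \<xi>) \<zeta> \<le> inner (p - \<xi>) \<eta>})"
  have H: "\<zeta> \<in> H (\<xi>, \<eta>) \<longleftrightarrow> inner (\<zeta> - \<eta>) (p - \<xi>) \<le> 0" for \<xi> \<eta> \<zeta>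
    by (simp add: H_def inner_diff_left inner_commute)
  have "M p = (\<Inter>x\<in>G. H x)"
  proof (intro equalityI subsetI)
    fix \<zeta> assume "\<zeta> \<in> M p"
    then show "\<zeta> \<in> (\<Inter>x\<in>G. H x)"
      using M dissipativeD[of M \<zeta> p] by (auto simp: G_def H maximal_dissipative_iff)
  next
    fix \<zeta> assume "\<zeta> \<in> (\<Inter>x\<in>G. H x)"
    then show "\<zeta> \<in> M p"
      by (intro maximal_dissipative_graph[OF M]) (auto simp: G_def H)
  qed
  moreover have "closed (\<Inter>x\<in>G. H x)" "convex (\<Inter>x\<in>G. H x)"
    by (auto intro!: closed_INT convex_INT simp: H_def closed_halfspace_le convex_halfspace_le)
  ultimately show "closed (M p)" "convex (M p)" by simp_all
qed

text \<open>Weak limits of such \<open>q\<close> are values at \<open>p\<close>, by maximality of the graph. The \<open>q n\<close> need not be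
  values of \<open>M\<close> themselves: the difference quotients of a solution at a point \<open>p\<close> of its path are
  the case of interest.\<close>

definition asymptotic_value :: "('h::real_inner, 'h) multimap \<Rightarrow> 'h \<Rightarrow> (nat \<Rightarrow> 'h) \<Rightarrow> bool" where
  "asymptotic_value M p q \<longleftrightarrow>
     (\<forall>\<xi> \<eta> \<epsilon>. \<eta> \<in> M \<xi> \<longrightarrow> \<epsilon> > 0 \<longrightarrow> (\<forall>\<^sub>F n in sequentially. inner (q n - \<eta>) (p - \<xi>) \<le> \<epsilon>))"

lemma asymptotic_value_cluster:
  fixes M :: "('h::{real_inner, complete_space}, 'h) multimap"
  assumes M: "maximal_dissipative M" and q: "asymptotic_value M p q" "\<And>n. norm (q n) \<le> R"
  shows "\<exists>\<zeta>\<in>M p. \<forall>a c. (\<forall>\<^sub>F n in sequentially. inner a (q n) \<le> c) \<longrightarrow> inner a \<zeta> \<le> c"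
proof -
  obtain \<zeta> where \<zeta>: "\<And>a c. (\<forall>\<^sub>F n in sequentially. inner a (q n) \<le> c) \<Longrightarrow> inner a \<zeta> \<le> c"
    using ex_weak_cluster_point[of q R] q(2) by blast
  have "\<zeta> \<in> M p"
  proof (rule maximal_dissipative_graph[OF M])
    fix \<xi> \<eta> assume "\<eta> \<in> M \<xi>"
    have "inner (\<zeta> - \<eta>) (p - \<xi>) \<le> 0 + \<epsilon>" if "\<epsilon> > 0" for \<epsilon>
    proof -
      have "\<forall>\<^sub>F n in sequentially. inner (p - \<xi>) (q n) \<le> inner \<eta> (p - \<xi>) + \<epsilon>"
      proof -
        have "\<forall>\<^sub>F n in sequentially. inner (q n - \<eta>) (p - \<xi>) \<le> \<epsilon>"
          using q(1) \<open>\<eta> \<in> M \<xi>\<close> that by (simp add: asymptotic_value_def)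
        then show ?thesis by eventually_elim (simp add: inner_diff_left inner_diff_right inner_commute)
      qed
      from \<zeta>[OF this] show ?thesis by (simp add: inner_diff_left inner_commute)
    qed
    then show "inner (\<zeta> - \<eta>) (p - \<xi>) \<le> 0" by (rule field_le_epsilon)
  qed
  then show ?thesis using \<zeta> by blast
qed

text \<open>Weak lower semicontinuity of the norm: test with \<open>a = \<zeta>\<close>.\<close>

lemma weak_cluster_norm_le:
  assumes "\<And>a c. (\<forall>\<^sub>F n in sequentially. inner a (q n) \<le> c) \<Longrightarrow> inner a \<zeta> \<le> c"
    and b: "\<And>n. norm (q n) \<le> b n" "b \<longlonglongrightarrow> l"
  shows "norm (\<zeta>::'h::real_inner) \<le> l"
proof (rule field_le_epsilon)
  fix \<epsilon> :: real assume "\<epsilon> > 0"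
  have "\<forall>\<^sub>F n in sequentially. inner \<zeta> (q n) \<le> norm \<zeta> * (l + \<epsilon>)"
  proof -
    have "\<forall>\<^sub>F n in sequentially. b n < l + \<epsilon>" using order_tendstoD(2)[OF b(2)] \<open>\<epsilon> > 0\<close> by simp
    then show ?thesis
    proof eventually_elim
      case (elim n)
      then have "norm \<zeta> * norm (q n) \<le> norm \<zeta> * (l + \<epsilon>)"
        using b(1)[of n] by (intro mult_left_mono) auto
      then show ?case using norm_cauchy_schwarz[of \<zeta> "q n"] by linarith
    qed
  qed
  then have *: "(norm \<zeta>)\<^sup>2 \<le> norm \<zeta> * (l + \<epsilon>)" using assms(1) by (simp add: power2_norm_eq_inner)
  have "0 \<le> l" using b by (meson LIMSEQ_le_const norm_ge_zero order_trans)
  with * show "norm \<zeta> \<le> l + \<epsilon>"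
    using \<open>\<epsilon> > 0\<close> by (cases "\<zeta> = 0") (auto simp: power2_eq_square)
qed

text \<open>The element of minimal norm of a value is singled out by its norm alone, so that an upper
  bound on the norms turns weak convergence into strong convergence.\<close>

lemma asymptotic_value_tendsto:
  fixes M :: "('h::{real_inner, complete_space}, 'h) multimap"
  assumes M: "maximal_dissipative M" and q: "asymptotic_value M p q"
    and b: "\<And>n. norm (q n) \<le> b n" "b \<longlonglongrightarrow> norm v"
    and v: "v \<in> M p" "\<And>y. y \<in> M p \<Longrightarrow> norm v \<le> norm y"
  shows "q \<longlonglongrightarrow> v"
proof -
  obtain R where R: "\<And>n. b n \<le> R"
  proof -
    obtain R where "\<And>n. norm (b n) \<le> R"
      using convergent_imp_Bseq[OF convergentI[OF b(2)]] unfolding Bseq_def by blast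
    then show thesis using that[of R] by (simp add: abs_le_iff)
  qed
  have inner_lim: "\<forall>\<^sub>F n in sequentially. (norm v)\<^sup>2 - \<delta> \<le> inner v (q n)" if "\<delta> > 0" for \<delta>
  proof (rule ccontr)
    assume "\<not> ?thesis"
    then have freq: "\<exists>\<^sub>F n in sequentially. inner v (q n) < (norm v)\<^sup>2 - \<delta>"
      by (simp add: not_eventually not_le)
    then have "infinite {n. inner v (q n) < (norm v)\<^sup>2 - \<delta>}"
      by (simp flip: frequently_cofinite cofinite_eq_sequentially)
    then obtain r :: "nat \<Rightarrow> nat" where r: "strict_mono r" "\<And>n. inner v (q (r n)) < (norm v)\<^sup>2 - \<delta>"
      using infinite_enumerate by blast
    have ev: "\<forall>\<^sub>F n in sequentially. Q (r n)" if "\<forall>\<^sub>F n in sequentially. Q n" for Q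
      using eventually_subseq[OF r(1) that] .
    have "asymptotic_value M p (\<lambda>n. q (r n))"
      using q ev unfolding asymptotic_value_def by auto
    then obtain \<zeta> where \<zeta>: "\<zeta> \<in> M p"
      "\<And>a c. (\<forall>\<^sub>F n in sequentially. inner a (q (r n)) \<le> c) \<Longrightarrow> inner a \<zeta> \<le> c"
      using asymptotic_value_cluster[OF M, of p "\<lambda>n. q (r n)" R] b(1) R by (meson order_trans)
    have "norm \<zeta> \<le> norm v"
      using weak_cluster_norm_le[OF \<zeta>(2), where b = "\<lambda>n. b (r n)"] b(1)
        LIMSEQ_subseq_LIMSEQ[OF b(2) r(1)] by (simp add: o_def)
    then have "\<zeta> = v"
      using minimal_norm_unique[OF maximal_dissipative_values(2)[OF M] v \<zeta>(1)] by simp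
    moreover have "inner v \<zeta> \<le> (norm v)\<^sup>2 - \<delta>"
      using r(2) by (intro \<zeta>(2) always_eventually allI less_imp_le)
    ultimately show False using \<open>\<delta> > 0\<close> by (simp add: power2_norm_eq_inner)
  qed
  show ?thesis
  proof (rule metric_LIMSEQ_I)
    fix r :: real assume r: "0 < r"
    have "(\<lambda>n. (b n)\<^sup>2) \<longlonglongrightarrow> (norm v)\<^sup>2" by (intro tendsto_intros b)
    then have "\<forall>\<^sub>F n in sequentially. (b n)\<^sup>2 < (norm v)\<^sup>2 + r\<^sup>2/2"
      by (rule order_tendstoD) (use r in simp)
    moreover have "\<forall>\<^sub>F n in sequentially. (norm v)\<^sup>2 - r\<^sup>2/4 \<le> inner v (q n)"
      using r by (intro inner_lim) auto
    ultimately have "\<forall>\<^sub>F n in sequentially. dist (q n) v < r"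
    proof eventually_elim
      case (elim n)
      have "(norm (q n))\<^sup>2 \<le> (b n)\<^sup>2" using b(1) by (intro power_mono) auto
      moreover have "(norm (q n - v))\<^sup>2 = (norm (q n))\<^sup>2 - 2 * inner v (q n) + (norm v)\<^sup>2"
        by (simp add: power2_norm_eq_inner inner_diff_left inner_diff_right inner_commute)
      ultimately have "(norm (q n - v))\<^sup>2 < r\<^sup>2" using elim by linarith
      then show ?case using r by (simp add: dist_norm power2_less_imp_less)
    qed
    then show "\<exists>no. \<forall>n\<ge>no. dist (q n) v < r" by (simp add: eventually_sequentially)
  qed
qed

section \<open>The closed-loop map is maximal dissipative\<close>

lemma dissipative_closed_loop:
  assumes "dissipative (coupling A g)"
  shows "dissipative (closed_loop A g C K r)"
  unfolding dissipative_def
proof (intro allI ballI)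
  fix p q f k assume "f \<in> closed_loop A g C K r p" "k \<in> closed_loop A g C K r q"
  then obtain a m b n where
    f: "a \<in> A p" "m \<in> normal_cone K (snd p)" "f = (a, r - g p - m)" and p: "snd p \<in> K" and
    k: "b \<in> A q" "n \<in> normal_cone K (snd q)" "k = (b, r - g q - n)" and q: "snd q \<in> K"
    unfolding closed_loop_def by (auto split: if_splits)
  have "inner ((a, - g p) - (b, - g q)) (p - q) \<le> 0"
    using f k by (intro dissipativeD[OF assms]) (auto simp: coupling_def)
  moreover have "0 \<le> inner m (snd p - snd q)" "0 \<le> inner n (snd q - snd p)"
    using f k p q by (auto simp: normal_cone_def split: if_splits)
  moreover have "inner (f - k) (p - q) = inner ((a, - g p) - (b, - g q)) (p - q)
      - inner m (snd p - snd q) - inner n (snd q - snd p)"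
    by (simp add: f k inner_prod_def inner_diff_left inner_diff_right)
  ultimately show "inner (f - k) (p - q) \<le> 0" by linarith
qed

lemma mdom_coupling: "mdom (coupling A g) = mdom A"
  by (auto simp: mdom_def coupling_def)

lemma normal_cone_interior_bound:
  fixes n :: "'b::real_inner"
  assumes "n \<in> normal_cone K y" "cball z \<rho> \<subseteq> K" "0 \<le> \<rho>"
  shows "\<rho> * norm n \<le> inner n (y - z)"
proof (cases "n = 0")
  case False
  let ?c = "z + (\<rho> / norm n) *\<^sub>R n"
  have "dist z ?c \<le> \<rho>" using False assms(3) by (simp add: dist_norm)
  then have "?c \<in> K" using assms(2) by auto
  then have "0 \<le> inner n (y - ?c)"
    using assms(1) by (auto simp: normal_cone_def split: if_splits)
  then have "(\<rho> / norm n) * inner n n \<le> inner n (y - z)"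
    by (simp add: inner_diff_right inner_add_right)
  moreover have "(\<rho> / norm n) * inner n n = \<rho> * norm n"
    using False by (simp add: power2_norm_eq_inner[symmetric] power2_eq_square)
  ultimately show ?thesis by simp
qed auto

text \<open>Here a point of the domain whose input is interior to \<open>K\<close> enters: it bounds the
  penalty forces \<open>n\<close> uniformly in the penalty parameter.\<close>

lemma penalty_bound:
  fixes M :: "('a::real_inner \<times> 'b::real_inner, 'a \<times> 'b) multimap"
  assumes M: "dissipative M" and f0: "f0 \<in> M (x0, z0)" and \<rho>: "cball z0 \<rho> \<subseteq> K" "0 < \<rho>"
    and f: "f \<in> M (x, z)" and eq: "(x, z) - f + (0, n) = h"
    and n: "n \<in> normal_cone K y" "0 \<le> inner n (z - y)"
  shows "norm n \<le> (norm (h - (x0, z0) + f0))\<^sup>2 / \<rho>"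
proof -
  let ?d = "(x, z) - (x0, z0)" and ?e = "h - (x0, z0) + f0"
  have "inner (f - f0) ?d \<le> 0" using M f f0 by (rule dissipativeD)
  moreover have "f = (x, z) + (0, n) - h" using eq by (auto simp: algebra_simps)
  then have "f - f0 = ?d + (0, n) - ?e" by (simp add: algebra_simps)
  ultimately have "inner ?d ?d + inner (0, n) ?d \<le> inner ?e ?d"
    by (simp add: inner_diff_left inner_add_left del: diff_Pair add_Pair)
  moreover have "inner (0, n) ?d = inner n (z - y) + inner n (y - z0)"
    by (simp add: inner_diff_right)
  moreover have "\<rho> * norm n \<le> inner n (y - z0)"
    using normal_cone_interior_bound[OF n(1) \<rho>(1)] \<rho>(2) by simp
  moreover have "inner ?e ?d \<le> norm ?e * norm ?d" by (rule norm_cauchy_schwarz)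
  ultimately have "(norm ?d)\<^sup>2 + \<rho> * norm n \<le> norm ?e * norm ?d"
    using n(2) unfolding power2_norm_eq_inner by linarith
  moreover have "2 * (norm ?e * norm ?d) \<le> (norm ?e)\<^sup>2 + (norm ?d)\<^sup>2"
    using sum_squares_bound[of "norm ?e" "norm ?d"] by simp
  moreover have "0 \<le> (norm ?e)\<^sup>2" "0 \<le> (norm ?d)\<^sup>2" by simp_all
  ultimately have "\<rho> * norm n \<le> (norm ?e)\<^sup>2" by linarith
  then show ?thesis using \<rho>(2) by (simp add: pos_le_divide_eq mult.commute)
qed

text \<open>A special case of Rockafellar's theorem on sums of maximal monotone maps. The normal cone is
  replaced by the penalty \<open>k (z - P z)\<close>, with \<open>P\<close> the projection onto \<open>K\<close>, and \<open>k \<rightarrow> \<infinity>\<close>. Since the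
  penalty forces are bounded in a finite-dimensional space, a subsequence of them converges, and
  the solutions converge with them because the resolvent is Lipschitz.\<close>

lemma coupling_plus_normal_cone_range:
  fixes M :: "('a::{real_inner, complete_space} \<times> 'b::{real_inner, complete_space}, 'a \<times> 'b) multimap"
    and B :: "'b set"
  assumes M: "maximal_dissipative M" and K: "closed K" "convex K" "K \<noteq> {}"
    and B: "finite B" "span B = UNIV"
    and f0: "f0 \<in> M (x0, z0)" and z0: "z0 \<in> interior K"
  shows "\<exists>x z f n. f \<in> M (x, z) \<and> n \<in> normal_cone K z \<and> (x, z) - f + (0, n) = h"
proof -
  obtain \<rho> where \<rho>: "0 < \<rho>" "cball z0 \<rho> \<subseteq> K" using z0 by (auto simp: mem_interior_cball)
  obtain P where P: "\<And>z. P z \<in> K" "\<And>z. z - P z \<in> normal_cone K (P z)"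
    using ex_convex_projection K by metis
  have cone: "0 \<le> inner w (y - y')" if "w \<in> normal_cone K y" "y' \<in> K" for w y y'
    using that by (auto simp: normal_cone_def split: if_splits)
  have P_nonexp: "norm (P z - P z') \<le> norm (z - z')" for z z'
  proof -
    have "inner (P z - P z') (P z - P z') \<le> inner (z - z') (P z - P z')"
      using cone[OF P(2) P(1), of z z'] cone[OF P(2) P(1), of z' z]
      by (simp add: inner_diff_left inner_diff_right)
    also have "\<dots> \<le> norm (z - z') * norm (P z - P z')" by (rule norm_cauchy_schwarz)
    finally show ?thesis
      by (cases "P z = P z'") (auto simp: power2_norm_eq_inner[symmetric] power2_eq_square)
  qed
  have M': "dissipative M" "\<And>l. l > 0 \<Longrightarrow> resolvable l M"
    using M resolvable_all unfolding maximal_dissipative_iff by blast+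
  define Q where "Q = (\<lambda>(x::'a, z). (x, P z))"
  have Q_nonexp: "norm (Q p - Q q) \<le> norm (p - q)" for p q
    using P_nonexp[of "snd p" "snd q"]
    by (cases p; cases q) (auto simp: Q_def norm_Pair intro!: real_sqrt_le_mono add_left_mono power_mono)
  have "\<exists>p f. f \<in> M p \<and> p - f + real (Suc k) *\<^sub>R (p - Q p) = h" for k
  proof -
    have "\<exists>p. \<exists>f\<in>M p. 1 *\<^sub>R p - f + real (Suc k) *\<^sub>R (p - Q p) = h"
      using M' Q_nonexp by (intro resolvable_perturbed) simp_all
    then show ?thesis by (simp only: scaleR_one) blast
  qed
  then obtain p f where pf: "\<And>k. f k \<in> M (p k)" "\<And>k. p k - f k + real (Suc k) *\<^sub>R (p k - Q (p k)) = h"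
    by metis
  define x z where "x k = fst (p k)" and "z k = snd (p k)" for k
  define n where "n k = real (Suc k) *\<^sub>R (z k - P (z k))" for k
  have p: "p k = (x k, z k)" for k by (simp add: x_def z_def)
  have eq: "(x k, z k) - f k + (0, n k) = h" for k
    using pf(2)[of k] by (simp add: p Q_def n_def)
  have f: "f k \<in> M (x k, z k)" for k using pf(1)[of k] by (simp add: p)
  have n_cone: "n k \<in> normal_cone K (P (z k))" for k
    using P unfolding n_def normal_cone_def by (auto split: if_splits)
  have "0 \<le> inner (n k) (z k - P (z k))" for k by (simp add: n_def)
  then have "norm (n k) \<le> (norm (h - (x0, z0) + f0))\<^sup>2 / \<rho>" for k
    using penalty_bound[OF M'(1) f0 \<rho>(2,1) f eq n_cone] by simp
  then obtain s n' where s: "strict_mono s" "(\<lambda>k. n (s k)) \<longlonglongrightarrow> n'"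
    using finite_dim_convergent_subseq[OF B, of n] by blast
  have dist_p: "norm (p i - p j) \<le> norm (n i - n j)" for i j
  proof -
    have "norm (p i - p j) \<le> norm ((p i - f i) - (p j - f j))"
      using resolvent_Lipschitz[OF M'(1), of 1 "f i" "p i" "f j" "p j"] pf(1) by simp
    moreover have "p k - f k = h - (0, n k)" for k using eq[of k] by (auto simp: p algebra_simps)
    ultimately show ?thesis by (simp add: norm_Pair norm_minus_commute)
  qed
  have "Cauchy (\<lambda>k. p (s k))"
    using LIMSEQ_imp_Cauchy[OF s(2)] dist_p unfolding Cauchy_def dist_norm
    by (meson le_less_trans)
  then obtain p' where p': "(\<lambda>k. p (s k)) \<longlonglongrightarrow> p'"
    using Cauchy_convergent convergent_def by blast
  obtain x' z' where p'_eq: "p' = (x', z')" by (cases p')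
  have z': "(\<lambda>k. z (s k)) \<longlonglongrightarrow> z'"
    using tendsto_snd[OF p'] by (simp add: z_def p'_eq)
  define f' where "f' = p' + (0, n') - h"
  have f_eq: "f k = p k + (0, n k) - h" for k using eq[of k] by (auto simp: p algebra_simps)
  have f_lim: "(\<lambda>k. f (s k)) \<longlonglongrightarrow> f'"
    unfolding f_eq f'_def by (intro tendsto_intros p' s)
  have "f' \<in> M p'"
  proof (rule maximal_dissipative_graph[OF M])
    fix \<xi> \<eta> assume "\<eta> \<in> M \<xi>"
    show "inner (f' - \<eta>) (p' - \<xi>) \<le> 0"
    proof (rule LIMSEQ_le_const2)
      show "(\<lambda>k. inner (f (s k) - \<eta>) (p (s k) - \<xi>)) \<longlonglongrightarrow> inner (f' - \<eta>) (p' - \<xi>)"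
        by (intro tendsto_intros f_lim p')
    qed (use dissipativeD[OF M'(1) pf(1) \<open>\<eta> \<in> M \<xi>\<close>] in auto)
  qed
  have "(\<lambda>k. z (s k) - (1 / real (Suc (s k))) *\<^sub>R n (s k)) \<longlonglongrightarrow> z' - 0 *\<^sub>R n'"
    using LIMSEQ_subseq_LIMSEQ[OF LIMSEQ_Suc[OF lim_1_over_n] s(1)]
    by (intro tendsto_intros z' s) (simp add: o_def)
  moreover have "z k - (1 / real (Suc k)) *\<^sub>R n k = P (z k)" for k by (simp add: n_def)
  ultimately have Pz: "(\<lambda>k. P (z (s k))) \<longlonglongrightarrow> z'" by simp
  have "z' \<in> K" by (rule closed_sequentially[OF K(1) _ Pz]) (use P in auto)
  moreover have "0 \<le> inner n' (z' - y)" if "y \<in> K" for y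
  proof (rule LIMSEQ_le_const)
    show "(\<lambda>k. inner (n (s k)) (P (z (s k)) - y)) \<longlonglongrightarrow> inner n' (z' - y)"
      by (intro tendsto_intros s Pz)
  qed (use cone[OF n_cone that] in auto)
  ultimately have "n' \<in> normal_cone K z'" by (simp add: normal_cone_def)
  moreover have "(x', z') - f' + (0, n') = h" by (simp add: f'_def flip: p'_eq)
  ultimately show ?thesis using \<open>f' \<in> M p'\<close> p'_eq by blast
qed

lemma maximal_dissipative_closed_loop:
  fixes A :: "('a::{real_inner, complete_space} \<times> 'b::{real_inner, complete_space}, 'a) multimap"
    and B :: "'b set"
  assumes C: "C \<noteq> {}" and K: "closed K" "convex K" "interior K \<noteq> {}"
    and coupling: "maximal_dissipative_coupling A g C"
    and B: "finite B" "span B = UNIV"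
  shows "maximal_dissipative (closed_loop A g C K r)"
proof -
  have M: "maximal_dissipative (coupling A g)" and dom: "closure (mdom A) = C \<times> UNIV"
    using coupling by (auto simp: maximal_dissipative_coupling_def mdom_coupling)
  obtain c k where ck: "c \<in> C" "k \<in> interior K" using C K by blast
  have "(UNIV \<times> interior K) \<inter> closure (mdom A) \<noteq> {}" using ck dom by auto
  then have "(UNIV \<times> interior K) \<inter> mdom A \<noteq> {}"
    by (subst (asm) open_Int_closure_eq_empty) (auto intro: open_Times)
  then obtain x0 z0 a0 where 0: "z0 \<in> interior K" "a0 \<in> A (x0, z0)" by (auto simp: mdom_def)
  have "K \<noteq> {}" using K interior_subset by blast
  have "\<exists>p. \<exists>f\<in>closed_loop A g C K r p. 1 *\<^sub>R p - f = h" for h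
  proof -
    obtain x z f n where f: "f \<in> coupling A g (x, z)" and n: "n \<in> normal_cone K z"
      and eq: "(x, z) - f + (0, n) = h + (0, r)"
      using coupling_plus_normal_cone_range[OF M K(1,2) \<open>K \<noteq> {}\<close> B _ 0(1), of "(a0, - g (x0, z0))" x0 "h + (0, r)"]
        0(2) by (auto simp: coupling_def)
    obtain a where a: "a \<in> A (x, z)" "f = (a, - g (x, z))" using f by (auto simp: coupling_def)
    have "(x, z) \<in> C \<times> UNIV" using a closure_subset[of "mdom A"] dom by (auto simp: mdom_def)
    moreover have "z \<in> K" using n by (auto simp: normal_cone_def split: if_splits)
    ultimately have "(a, r - g (x, z) - n) \<in> closed_loop A g C K r (x, z)"
      using a n by (auto simp: closed_loop_def)
    moreover have "(x, z) - (a, r - g (x, z) - n) = h"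
      using eq by (cases h) (auto simp: a algebra_simps)
    ultimately show ?thesis by (intro exI[of _ "(x, z)"] bexI) auto
  qed
  then have "resolvable 1 (closed_loop A g C K r)" unfolding resolvable_def by blast
  moreover have "dissipative (coupling A g)" using M by (simp add: maximal_dissipative_iff)
  ultimately show ?thesis
    unfolding maximal_dissipative_iff using dissipative_closed_loop zero_less_one by blast
qed

section \<open>Absolutely continuous functions and null sets\<close>

text \<open>Subtraction of measurable functions is delicate in a space that is not separable; it is harmless
  if one of them takes finitely many values.\<close>

lemma borel_measurable_diff_simple:
  fixes f :: "'s \<Rightarrow> 'h::real_normed_vector"
  assumes f: "f \<in> borel_measurable M" and s: "simple_function M s"
  shows "(\<lambda>x. f x - s x) \<in> borel_measurable M"
proof (rule measurable_compose_countable'[where I = "s ` space M" and f = "\<lambda>y x. f x - y" and g = s])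
  show "(\<lambda>x. f x - y) \<in> borel_measurable M" for y
    by (rule measurable_compose[OF f]) (intro borel_measurable_continuous_onI continuous_intros)
  show "s \<in> measurable M (count_space (s ` space M))"
    using s by (simp add: simple_function_def measurable_count_space_eq2)
  show "countable (s ` space M)" using s by (simp add: simple_function_def countable_finite)
qed

lemma simple_bochner_integral_norm_le:
  fixes s :: "'s \<Rightarrow> 'h::real_normed_vector"
  assumes s: "Bochner_Integration.simple_bochner_integrable M s"
  shows "ennreal (norm (Bochner_Integration.simple_bochner_integral M s)) \<le> (\<integral>\<^sup>+x. norm (s x) \<partial>M)"
proof -
  have n: "Bochner_Integration.simple_bochner_integrable M (\<lambda>x. norm (s x))"
    using simple_bochner_integrable_compose2[OF _ s s, of "\<lambda>x y. norm x"] by simp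
  have "ennreal (norm (Bochner_Integration.simple_bochner_integral M s))
      \<le> ennreal (Bochner_Integration.simple_bochner_integral M (\<lambda>x. norm (s x)))"
    by (intro ennreal_leI simple_bochner_integral_norm_bound s)
  also have "\<dots> = (\<integral>\<^sup>+x. norm (s x) \<partial>M)"
    by (rule simple_bochner_integral_eq_nn_integral[OF n]) auto
  finally show ?thesis .
qed

text \<open>The estimate passes through the approximating simple functions, since \<open>f - k\<close> need not be
  measurable.\<close>

lemma has_Bochner_integral_diff_norm_le:
  fixes f k :: "'s \<Rightarrow> 'h::real_normed_vector"
  assumes f: "has_Bochner_integral M f I" and k: "has_Bochner_integral M k J"
    and b: "b \<in> borel_measurable M" "\<And>x. ennreal (norm (f x - k x)) \<le> b x"
  shows "ennreal (norm (I - J)) \<le> (\<integral>\<^sup>+x. b x \<partial>M)"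
proof -
  obtain s where s: "\<And>i. Bochner_Integration.simple_bochner_integrable M (s i)"
    "(\<lambda>i. \<integral>\<^sup>+x. norm (f x - s i x) \<partial>M) \<longlonglongrightarrow> 0"
    "(\<lambda>i. Bochner_Integration.simple_bochner_integral M (s i)) \<longlonglongrightarrow> I"
    and fm: "f \<in> borel_measurable M"
    using f unfolding has_Bochner_integral_def by blast
  obtain r where r: "\<And>i. Bochner_Integration.simple_bochner_integrable M (r i)"
    "(\<lambda>i. \<integral>\<^sup>+x. norm (k x - r i x) \<partial>M) \<longlonglongrightarrow> 0"
    "(\<lambda>i. Bochner_Integration.simple_bochner_integral M (r i)) \<longlonglongrightarrow> J"
    and km: "k \<in> borel_measurable M"
    using k unfolding has_Bochner_integral_def by blast
  have simple: "simple_function M (s i)" "simple_function M (r i)" for i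
    using s(1) r(1) by (auto elim: simple_bochner_integrable.cases)
  have [measurable]: "(\<lambda>x. f x - s i x) \<in> borel_measurable M" "(\<lambda>x. k x - r i x) \<in> borel_measurable M" for i
    using borel_measurable_diff_simple fm km simple by blast+
  note b(1)[measurable]
  have le: "ennreal (norm (Bochner_Integration.simple_bochner_integral M (s i) -
        Bochner_Integration.simple_bochner_integral M (r i)))
      \<le> (\<integral>\<^sup>+x. norm (f x - s i x) \<partial>M) + (\<integral>\<^sup>+x. norm (k x - r i x) \<partial>M) + (\<integral>\<^sup>+x. b x \<partial>M)" for i
  proof -
    have "ennreal (norm (Bochner_Integration.simple_bochner_integral M (s i) -
        Bochner_Integration.simple_bochner_integral M (r i)))
        \<le> (\<integral>\<^sup>+x. norm (s i x - r i x) \<partial>M)"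
      using simple_bochner_integral_norm_le[OF
          simple_bochner_integrable_compose2[OF _ s(1) r(1), of "\<lambda>x y. x - y" i i]]
      by (simp add: simple_bochner_integral_diff[OF s(1) r(1)])
    also have "\<dots> \<le> (\<integral>\<^sup>+x. ennreal (norm (f x - s i x)) + ennreal (norm (k x - r i x)) + b x \<partial>M)"
    proof (rule nn_integral_mono)
      fix x
      have "norm (s i x - r i x) = norm ((f x - k x) - (f x - s i x) + (k x - r i x))" by simp
      also have "\<dots> \<le> norm (f x - k x) + norm (f x - s i x) + norm (k x - r i x)"
        by (intro order_trans[OF norm_triangle_ineq] add_right_mono norm_triangle_ineq4)
      finally have "ennreal (norm (s i x - r i x))
          \<le> ennreal (norm (f x - s i x)) + ennreal (norm (k x - r i x)) + ennreal (norm (f x - k x))"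
        by (simp flip: ennreal_plus)
      also have "\<dots> \<le> ennreal (norm (f x - s i x)) + ennreal (norm (k x - r i x)) + b x"
        by (intro add_left_mono b)
      finally show "ennreal (norm (s i x - r i x))
          \<le> ennreal (norm (f x - s i x)) + ennreal (norm (k x - r i x)) + b x" .
    qed
    also have "\<dots> = (\<integral>\<^sup>+x. norm (f x - s i x) \<partial>M) + (\<integral>\<^sup>+x. norm (k x - r i x) \<partial>M) + (\<integral>\<^sup>+x. b x \<partial>M)"
      by (simp add: nn_integral_add)
    finally show ?thesis .
  qed
  have "(\<lambda>i. ennreal (norm (Bochner_Integration.simple_bochner_integral M (s i) -
        Bochner_Integration.simple_bochner_integral M (r i)))) \<longlonglongrightarrow> ennreal (norm (I - J))"
    by (intro tendsto_intros tendsto_ennrealI s r)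
  moreover have "(\<lambda>i. (\<integral>\<^sup>+x. norm (f x - s i x) \<partial>M) + (\<integral>\<^sup>+x. norm (k x - r i x) \<partial>M) + (\<integral>\<^sup>+x. b x \<partial>M))
      \<longlonglongrightarrow> 0 + 0 + (\<integral>\<^sup>+x. b x \<partial>M)"
    by (intro tendsto_intros s r)
  ultimately show ?thesis using LIMSEQ_le le by fastforce
qed

lemma has_Bochner_integral_norm_finite:
  fixes f :: "'s \<Rightarrow> 'h::real_normed_vector"
  assumes "has_Bochner_integral M f I"
  shows "f \<in> borel_measurable M" "(\<integral>\<^sup>+x. norm (f x) \<partial>M) < \<infinity>"
proof -
  obtain s where s: "\<And>i. Bochner_Integration.simple_bochner_integrable M (s i)"
    "(\<lambda>i. \<integral>\<^sup>+x. norm (f x - s i x) \<partial>M) \<longlonglongrightarrow> 0" and fm: "f \<in> borel_measurable M"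
    using assms unfolding has_Bochner_integral_def by blast
  show "f \<in> borel_measurable M" by (rule fm)
  have "\<forall>\<^sub>F i in sequentially. (\<integral>\<^sup>+x. norm (f x - s i x) \<partial>M) < 1"
    by (rule order_tendstoD(2)[OF s(2)]) simp
  then obtain i where i: "(\<integral>\<^sup>+x. norm (f x - s i x) \<partial>M) < 1"
    by (meson eventually_sequentially order_refl)
  have si: "simple_function M (s i)" using s(1) by (auto elim: simple_bochner_integrable.cases)
  have [measurable]: "(\<lambda>x. f x - s i x) \<in> borel_measurable M" "s i \<in> borel_measurable M"
    using borel_measurable_diff_simple[OF fm si] borel_measurable_simple_function[OF si] by auto
  have "(\<integral>\<^sup>+x. norm (f x) \<partial>M) \<le> (\<integral>\<^sup>+x. ennreal (norm (f x - s i x)) + ennreal (norm (s i x)) \<partial>M)"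
    by (intro nn_integral_mono) (simp flip: ennreal_plus add: norm_triangle_sub add.commute)
  also have "\<dots> = (\<integral>\<^sup>+x. norm (f x - s i x) \<partial>M) + (\<integral>\<^sup>+x. norm (s i x) \<partial>M)"
    by (simp add: nn_integral_add)
  also have "(\<integral>\<^sup>+x. norm (s i x) \<partial>M) < \<infinity>"
  proof -
    have n: "Bochner_Integration.simple_bochner_integrable M (\<lambda>x. norm (s i x))"
      using simple_bochner_integrable_compose2[OF _ s(1) s(1), of "\<lambda>x y. norm x"] by simp
    show ?thesis using simple_bochner_integral_eq_nn_integral[OF n] by (metis ennreal_less_top infinity_ennreal_def norm_ge_zero)
  qed
  finally show "(\<integral>\<^sup>+x. norm (f x) \<partial>M) < \<infinity>"
    using i by (simp add: less_top[symmetric] ennreal_add_eq_top) (metis ennreal_one_less_top less_top order.strict_trans)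
qed

text \<open>The measure with density \<open>norm v\<close>, where \<open>v\<close> is the integrand that represents \<open>w\<close>.\<close>

lemma abs_cont_dominating_measure:
  fixes w :: "real \<Rightarrow> 'h::real_normed_vector"
  assumes "abs_cont w" "0 \<le> T"
  shows "\<exists>\<mu>. finite_measure \<mu> \<and> sets \<mu> = sets lebesgue \<and> (\<forall>N\<in>null_sets lebesgue. measure \<mu> N = 0) \<and>
     (\<forall>a b. 0 \<le> a \<longrightarrow> a \<le> b \<longrightarrow> b \<le> T \<longrightarrow> norm (w b - w a) \<le> measure \<mu> {a<..b})"
proof -
  obtain c v where v: "\<And>t. t \<in> {0..T} \<Longrightarrow>
      has_Bochner_integral lebesgue (\<lambda>s. indicat_real {0..t} s *\<^sub>R v s) (w t - c)"
    using assms unfolding abs_cont_def by blast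
  define k where "k s = norm (indicat_real {0..T} s *\<^sub>R v s)" for s
  have vT: "has_Bochner_integral lebesgue (\<lambda>s. indicat_real {0..T} s *\<^sub>R v s) (w T - c)"
    using v assms(2) by simp
  have [measurable]: "k \<in> borel_measurable lebesgue"
    unfolding k_def using has_Bochner_integral_norm_finite(1)[OF vT] by measurable
  have fin: "(\<integral>\<^sup>+x. ennreal (k x) \<partial>lebesgue) < \<infinity>"
    unfolding k_def using has_Bochner_integral_norm_finite(2)[OF vT] .
  define \<mu> where "\<mu> = density lebesgue (\<lambda>s. ennreal (k s))"
  have em: "emeasure \<mu> X = (\<integral>\<^sup>+x. ennreal (k x) * indicator X x \<partial>lebesgue)" if "X \<in> sets lebesgue" for X
    unfolding \<mu>_def using that by (intro emeasure_density) auto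
  interpret finite_measure \<mu>
  proof
    show "emeasure \<mu> (space \<mu>) \<noteq> \<infinity>" using em[of UNIV] fin by (auto simp: \<mu>_def)
  qed
  have "norm (w b - w a) \<le> measure \<mu> {a<..b}" if "0 \<le> a" "a \<le> b" "b \<le> T" for a b
  proof -
    have "ennreal (norm ((w b - c) - (w a - c))) \<le> (\<integral>\<^sup>+x. ennreal (k x) * indicator {a<..b} x \<partial>lebesgue)"
    proof (rule has_Bochner_integral_diff_norm_le[OF v v])
      show "ennreal (norm (indicat_real {0..b} x *\<^sub>R v x - indicat_real {0..a} x *\<^sub>R v x))
          \<le> ennreal (k x) * indicator {a<..b} x" for x
        using that by (auto simp: k_def indicator_def)
      show "(\<lambda>x. ennreal (k x) * indicator {a<..b} x) \<in> borel_measurable lebesgue"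
        by (intro borel_measurable_times_ennreal borel_measurable_indicator) auto
    qed (use that in auto)
    also have "\<dots> = ennreal (measure \<mu> {a<..b})"
      by (simp add: em[symmetric] emeasure_eq_measure)
    finally show ?thesis by (simp add: ennreal_le_iff)
  qed
  moreover have "measure \<mu> N = 0" if "N \<in> null_sets lebesgue" for N
  proof -
    have "N \<in> null_sets \<mu>"
      using that absolutely_continuousI_density[of "\<lambda>s. ennreal (k s)" lebesgue]
      by (auto simp: \<mu>_def absolutely_continuous_def)
    then show ?thesis by (simp add: measure_eq_0_null_sets)
  qed
  ultimately show ?thesis
    by (intro exI[of _ \<mu>]) (use finite_measure_axioms in \<open>auto simp: \<mu>_def\<close>)
qed

text \<open>The form in which absolute continuity is used: near a null set, the increments of \<open>f\<close> are
  dominated by those of an increasing function of small total increase. Unlike the representation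
  by an integral, this is inherited without effort by translates, pairs and Lipschitz functions
  of \<open>f\<close>.\<close>

definition null_controlled :: "(real \<Rightarrow> 'h::real_normed_vector) \<Rightarrow> real \<Rightarrow> real \<Rightarrow> real set \<Rightarrow> bool" where
  "null_controlled f a b E \<longleftrightarrow>
     (\<forall>\<epsilon>>0. \<exists>G. mono G \<and> (\<forall>t. 0 \<le> G t \<and> G t \<le> \<epsilon>) \<and>
        (\<forall>t\<in>E \<inter> {a..<b}. \<exists>\<delta>>0. \<forall>s\<in>{t..b}. s < t + \<delta> \<longrightarrow> norm (f s - f t) \<le> G s - G t))"

lemma negligible_decreasing_open:
  fixes E :: "real set"
  assumes "negligible E"
  shows "\<exists>U::nat \<Rightarrow> real set. decseq U \<and> (\<forall>n. open (U n)) \<and> (\<forall>n. E \<subseteq> U n) \<and> (\<Inter>n. U n) \<in> null_sets lebesgue"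
proof -
  have E: "E \<in> null_sets lebesgue" using assms by (simp add: negligible_iff_null_sets)
  have "\<exists>U. open U \<and> E \<subseteq> U \<and> emeasure lebesgue U < ennreal (1 / Suc n)" for n
  proof -
    obtain U where U: "open U" "E \<subseteq> U" "emeasure lebesgue (U - E) < ennreal (1 / Suc n)"
    proof (rule sets_lebesgue_outer_open)
      show "E \<in> sets lebesgue" using E by (rule null_setsD2)
      show "0 < 1 / real (Suc n)" by simp
    qed
    have "emeasure lebesgue (U - E) = emeasure lebesgue U"
      using E U(1) by (intro emeasure_Diff_null_set) auto
    then show ?thesis using U by auto
  qed
  then obtain V where V: "\<And>n. open (V n)" "\<And>n. E \<subseteq> V n" "\<And>n. emeasure lebesgue (V n) < ennreal (1 / Suc n)"
    by metis
  define U where "U n = (\<Inter>k\<le>n. V k)" for n :: nat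
  have "(\<Inter>n. U n) \<in> null_sets lebesgue"
  proof (rule null_setsI)
    have le: "emeasure lebesgue (\<Inter>n. U n) \<le> ennreal (1 / Suc n)" for n
    proof -
      have "emeasure lebesgue (\<Inter>n. U n) \<le> emeasure lebesgue (V n)"
        using V(1) by (intro emeasure_mono) (auto simp: U_def)
      then show ?thesis using V(3)[of n] by simp
    qed
    have "(\<lambda>n. ennreal (1 / Suc n)) \<longlonglongrightarrow> ennreal 0"
      by (intro tendsto_ennrealI LIMSEQ_Suc[OF lim_1_over_n])
    then have "emeasure lebesgue (\<Inter>n. U n) \<le> ennreal 0"
      using le by (intro LIMSEQ_le_const) blast+
    then show "emeasure lebesgue (\<Inter>n. U n) = 0" by (simp only: ennreal_0 le_zero_eq)
    show "(\<Inter>n. U n) \<in> sets lebesgue"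
      using V(1) unfolding U_def by (intro sets.countable_INT) (auto intro!: sets.finite_INT)
  qed
  moreover have "open (U n)" for n unfolding U_def using V(1) by (intro open_INT) auto
  moreover have "decseq U" unfolding decseq_def U_def by auto
  moreover have "E \<subseteq> U n" for n unfolding U_def using V(2) by auto
  ultimately show ?thesis by blast
qed

lemma abs_cont_null_controlled:
  fixes w :: "real \<Rightarrow> 'h::real_normed_vector"
  assumes w: "abs_cont w" and E: "negligible E" and ab: "0 \<le> a"
  shows "null_controlled w a b E"
  unfolding null_controlled_def
proof (intro allI impI)
  fix \<epsilon> :: real assume "\<epsilon> > 0"
  define T where "T = max 0 b"
  obtain \<mu> where \<mu>: "finite_measure \<mu>" "sets \<mu> = sets lebesgue"
    "\<And>N. N \<in> null_sets lebesgue \<Longrightarrow> measure \<mu> N = 0"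
    "\<And>a b. 0 \<le> a \<Longrightarrow> a \<le> b \<Longrightarrow> b \<le> T \<Longrightarrow> norm (w b - w a) \<le> measure \<mu> {a<..b}"
    using abs_cont_dominating_measure[OF w, of T] by (auto simp: T_def)
  interpret finite_measure \<mu> by (rule \<mu>(1))
  have sets: "X \<in> sets \<mu>" if "X \<in> sets borel" for X
    using that by (simp add: \<mu>(2))
  obtain U where U: "decseq U" "\<And>n. open (U n)" "\<And>n. E \<subseteq> U n" "(\<Inter>n. U n) \<in> null_sets lebesgue"
    using negligible_decreasing_open[OF E] by blast
  have "(\<lambda>n. measure \<mu> (U n)) \<longlonglongrightarrow> measure \<mu> (\<Inter>n. U n)"
    using U by (intro finite_Lim_measure_decseq) (auto intro: sets)
  then have "\<forall>\<^sub>F n in sequentially. measure \<mu> (U n) < \<epsilon>"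
    using \<mu>(3)[OF U(4)] \<open>\<epsilon> > 0\<close> by (auto dest: order_tendstoD(2))
  then obtain n where n: "measure \<mu> (U n) < \<epsilon>" by (meson eventually_sequentially order_refl)
  define G where "G t = measure \<mu> ({..t} \<inter> U n)" for t
  have meas: "{..t} \<inter> U n \<in> sets \<mu>" "U n \<in> sets \<mu>" "{t<..s} \<in> sets \<mu>" for t s using U(2) by (auto intro!: sets)
  have "mono G" unfolding G_def by (intro monoI finite_measure_mono meas) auto
  moreover have "0 \<le> G t \<and> G t \<le> \<epsilon>" for t
  proof -
    have "measure \<mu> ({..t} \<inter> U n) \<le> measure \<mu> (U n)" by (intro finite_measure_mono meas) auto
    then show ?thesis using n by (simp add: G_def)
  qed
  moreover have "\<exists>\<delta>>0. \<forall>s\<in>{t..b}. s < t + \<delta> \<longrightarrow> norm (w s - w t) \<le> G s - G t"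
    if t: "t \<in> E \<inter> {a..<b}" for t
  proof -
    obtain \<delta> where \<delta>: "\<delta> > 0" "ball t \<delta> \<subseteq> U n" using U t by (meson IntD1 open_contains_ball subsetD)
    have "norm (w s - w t) \<le> G s - G t" if s: "s \<in> {t..b}" "s < t + \<delta>" for s
    proof -
      have "norm (w s - w t) \<le> measure \<mu> {t<..s}"
        using s t ab by (intro \<mu>(4)) (auto simp: T_def)
      moreover have "{t<..s} \<subseteq> U n" using \<delta>(2) s by (auto simp: subset_iff dist_real_def)
      then have "{..s} \<inter> U n = ({..t} \<inter> U n) \<union> {t<..s}" using s by auto
      then have "G s = G t + measure \<mu> {t<..s}"
        unfolding G_def using meas by (subst finite_measure_Union[symmetric]) auto
      ultimately show ?thesis by simp
    qed
    then show ?thesis using \<delta>(1) by blast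
  qed
  ultimately show "\<exists>G. mono G \<and> (\<forall>t. 0 \<le> G t \<and> G t \<le> \<epsilon>) \<and>
      (\<forall>t\<in>E \<inter> {a..<b}. \<exists>\<delta>>0. \<forall>s\<in>{t..b}. s < t + \<delta> \<longrightarrow> norm (w s - w t) \<le> G s - G t)"
    by blast
qed

lemma abs_cont_continuous_on:
  fixes w :: "real \<Rightarrow> 'h::real_normed_vector"
  assumes w: "abs_cont w"
  shows "continuous_on {0..} w"
proof -
  have "continuous_on {0..T} w" if "0 \<le> T" for T
  proof -
    obtain \<mu> where \<mu>: "finite_measure \<mu>" "sets \<mu> = sets lebesgue"
      "\<And>N. N \<in> null_sets lebesgue \<Longrightarrow> measure \<mu> N = 0"
      "\<And>a b. 0 \<le> a \<Longrightarrow> a \<le> b \<Longrightarrow> b \<le> T \<Longrightarrow> norm (w b - w a) \<le> measure \<mu> {a<..b}"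
      using abs_cont_dominating_measure[OF w \<open>0 \<le> T\<close>] by auto
    interpret finite_measure \<mu> by (rule \<mu>(1))
    have sets: "X \<in> sets \<mu>" if "X \<in> sets borel" for X using that by (simp add: \<mu>(2))
    show ?thesis
      unfolding continuous_on_iff
    proof (intro ballI allI impI)
      fix t e :: real assume t: "t \<in> {0..T}" and "0 < e"
      define S where "S n = cball t (1 / Suc n)" for n :: nat
      have "(\<Inter>n. S n) = {t}"
      proof -
        have "s = t" if "\<And>n. dist t s \<le> 1 / real (Suc n)" for s
        proof -
          have "dist t s \<le> 0"
            by (rule LIMSEQ_le_const[OF LIMSEQ_Suc[OF lim_1_over_n]]) (use that in auto)
          then show ?thesis by simp
        qed
        then show ?thesis by (auto simp: S_def)
      qed
      moreover have "(\<lambda>n. measure \<mu> (S n)) \<longlonglongrightarrow> measure \<mu> (\<Inter>n. S n)"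
        by (intro finite_Lim_measure_decseq)
           (auto intro!: sets simp: S_def decseq_def frac_le subset_cball)
      moreover have "measure \<mu> {t} = 0"
        by (intro \<mu>(3)) (simp flip: negligible_iff_null_sets)
      ultimately have "\<forall>\<^sub>F n in sequentially. measure \<mu> (S n) < e"
        using \<open>0 < e\<close> by (auto dest: order_tendstoD(2))
      then obtain n where n: "measure \<mu> (S n) < e" by (meson eventually_sequentially order_refl)
      have "dist (w s) (w t) < e" if s: "s \<in> {0..T}" "dist s t < 1 / Suc n" for s
      proof -
        have "norm (w (max s t) - w (min s t)) \<le> measure \<mu> {min s t<..max s t}"
          using s t by (intro \<mu>(4)) auto
        also have "\<dots> \<le> measure \<mu> (S n)"
          using s by (intro finite_measure_mono) (auto intro!: sets simp: S_def dist_real_def)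
        finally show ?thesis using n by (cases "s \<le> t") (auto simp: dist_norm norm_minus_commute max_def min_def)
      qed
      then show "\<exists>d>0. \<forall>s\<in>{0..T}. dist s t < d \<longrightarrow> dist (w s) (w t) < e"
        by (intro exI[of _ "1 / Suc n"]) auto
    qed
  qed
  then show ?thesis
    unfolding continuous_on_eq_continuous_within
  proof (intro ballI)
    fix t :: real assume *: "\<And>T. 0 \<le> T \<Longrightarrow> \<forall>x\<in>{0..T}. continuous (at x within {0..T}) w" and "t \<in> {0..}"
    then have "continuous (at t within {0..t+1}) w" by auto
    moreover have "at t within {0..t+1} = at t within {0..}"
      using \<open>t \<in> {0..}\<close> by (intro at_within_nhd[of _ "{..<t+1}"]) auto
    ultimately show "continuous (at t within {0..}) w" by simp
  qed
qed

section \<open>Increments from the derivative almost everywhere\<close>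

lemma null_controlled_Pair:
  assumes "null_controlled u a b E" "null_controlled v a b E"
  shows "null_controlled (\<lambda>t. (u t, v t)) a b E"
  unfolding null_controlled_def
proof (intro allI impI)
  fix \<epsilon> :: real assume "\<epsilon> > 0"
  then have "\<epsilon>/2 > 0" by simp
  obtain G where G: "mono G" "\<And>t. 0 \<le> G t \<and> G t \<le> \<epsilon>/2"
    "\<forall>t\<in>E \<inter> {a..<b}. \<exists>\<delta>>0. \<forall>s\<in>{t..b}. s < t + \<delta> \<longrightarrow> norm (u s - u t) \<le> G s - G t"
    using assms(1) \<open>\<epsilon>/2 > 0\<close> unfolding null_controlled_def by meson
  obtain H where H: "mono H" "\<And>t. 0 \<le> H t \<and> H t \<le> \<epsilon>/2"
    "\<forall>t\<in>E \<inter> {a..<b}. \<exists>\<delta>>0. \<forall>s\<in>{t..b}. s < t + \<delta> \<longrightarrow> norm (v s - v t) \<le> H s - H t"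
    using assms(2) \<open>\<epsilon>/2 > 0\<close> unfolding null_controlled_def by meson
  have "mono (\<lambda>t. G t + H t)" using G(1) H(1) by (simp add: mono_def add_mono)
  moreover have "0 \<le> G t + H t \<and> G t + H t \<le> \<epsilon>" for t using G(2)[of t] H(2)[of t] by auto
  moreover have "\<exists>\<delta>>0. \<forall>s\<in>{t..b}. s < t + \<delta> \<longrightarrow>
      norm ((u s, v s) - (u t, v t)) \<le> (G s + H s) - (G t + H t)" if t: "t \<in> E \<inter> {a..<b}" for t
  proof -
    obtain d e where d: "d > 0" "\<forall>s\<in>{t..b}. s < t + d \<longrightarrow> norm (u s - u t) \<le> G s - G t"
      and e: "e > 0" "\<forall>s\<in>{t..b}. s < t + e \<longrightarrow> norm (v s - v t) \<le> H s - H t"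
      using G(3) H(3) t by meson
    have "norm ((u s, v s) - (u t, v t)) \<le> (G s + H s) - (G t + H t)"
      if "s \<in> {t..b}" "s < t + min d e" for s
    proof -
      have "norm ((u s, v s) - (u t, v t)) \<le> norm (u s - u t) + norm (v s - v t)"
        by (simp add: norm_Pair_le)
      moreover have "norm (u s - u t) \<le> G s - G t" "norm (v s - v t) \<le> H s - H t"
        using d(2) e(2) that by auto
      ultimately show ?thesis by linarith
    qed
    then show ?thesis using d(1) e(1) by (intro exI[of _ "min d e"]) auto
  qed
  ultimately show "\<exists>G. mono G \<and> (\<forall>t. 0 \<le> G t \<and> G t \<le> \<epsilon>) \<and>
      (\<forall>t\<in>E \<inter> {a..<b}. \<exists>\<delta>>0. \<forall>s\<in>{t..b}. s < t + \<delta> \<longrightarrow> norm ((u s, v s) - (u t, v t)) \<le> G s - G t)"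
    by (intro exI[of _ "\<lambda>t. G t + H t"]) auto
qed

lemma null_controlled_Lipschitz_image:
  assumes w: "null_controlled w a b E"
    and f: "\<And>s t. s \<in> {a..b} \<Longrightarrow> t \<in> {a..b} \<Longrightarrow> norm (f s - f t) \<le> R * norm (w s - w t)"
  shows "null_controlled f a b E"
  unfolding null_controlled_def
proof (intro allI impI)
  fix \<epsilon> :: real assume "\<epsilon> > 0"
  define Q where "Q = max R 1"
  have Q: "Q > 0" "R \<le> Q" by (auto simp: Q_def)
  then have "\<epsilon>/Q > 0" using \<open>\<epsilon> > 0\<close> by simp
  then obtain G where G: "mono G" "\<And>t. 0 \<le> G t" "\<And>t. G t \<le> \<epsilon>/Q"
    "\<And>t. t\<in>E \<inter> {a..<b} \<Longrightarrow> \<exists>\<delta>>0. \<forall>s\<in>{t..b}. s < t + \<delta> \<longrightarrow> norm (w s - w t) \<le> G s - G t"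
    using w unfolding null_controlled_def by meson
  have "mono (\<lambda>t. Q * G t)" using G(1) Q by (simp add: mono_def)
  moreover have "0 \<le> Q * G t \<and> Q * G t \<le> \<epsilon>" for t
    using G(2,3)[of t] Q by (simp add: pos_le_divide_eq mult.commute)
  moreover have "\<exists>\<delta>>0. \<forall>s\<in>{t..b}. s < t + \<delta> \<longrightarrow> norm (f s - f t) \<le> Q * G s - Q * G t"
    if t: "t \<in> E \<inter> {a..<b}" for t
  proof -
    obtain d where d: "d > 0" "\<And>s. s\<in>{t..b} \<Longrightarrow> s < t + d \<Longrightarrow> norm (w s - w t) \<le> G s - G t"
      using G(4) t by meson
    have "norm (f s - f t) \<le> Q * G s - Q * G t" if s: "s \<in> {t..b}" "s < t + d" for s
    proof -
      have "norm (f s - f t) \<le> R * norm (w s - w t)" using s t by (intro f) auto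
      also have "\<dots> \<le> Q * norm (w s - w t)" using Q by (intro mult_right_mono) auto
      also have "\<dots> \<le> Q * (G s - G t)" using d(2)[OF s] Q by (intro mult_left_mono) auto
      finally show ?thesis by (simp add: algebra_simps)
    qed
    then show ?thesis using d(1) by blast
  qed
  ultimately show "\<exists>G. mono G \<and> (\<forall>t. 0 \<le> G t \<and> G t \<le> \<epsilon>) \<and>
      (\<forall>t\<in>E \<inter> {a..<b}. \<exists>\<delta>>0. \<forall>s\<in>{t..b}. s < t + \<delta> \<longrightarrow> norm (f s - f t) \<le> G s - G t)"
    by (intro exI[of _ "\<lambda>t. Q * G t"]) auto
qed

lemma null_controlled_shift:
  assumes "null_controlled w (c + a) (c + b) ((+) c ` E)"
  shows "null_controlled (\<lambda>t. w (c + t)) a b E"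
  unfolding null_controlled_def
proof (intro allI impI)
  fix \<epsilon> :: real assume "\<epsilon> > 0"
  then obtain G where G: "mono G" "\<And>t. 0 \<le> G t" "\<And>t. G t \<le> \<epsilon>"
    "\<And>t. t\<in>(+) c ` E \<inter> {c+a..<c+b} \<Longrightarrow> \<exists>\<delta>>0. \<forall>s\<in>{t..c+b}. s < t + \<delta> \<longrightarrow> norm (w s - w t) \<le> G s - G t"
    using assms unfolding null_controlled_def by meson
  have "\<exists>\<delta>>0. \<forall>s\<in>{t..b}. s < t + \<delta> \<longrightarrow> norm (w (c + s) - w (c + t)) \<le> G (c + s) - G (c + t)"
    if t: "t \<in> E \<inter> {a..<b}" for t
  proof -
    obtain d where "d > 0" "\<forall>s\<in>{c+t..c+b}. s < c + t + d \<longrightarrow> norm (w s - w (c+t)) \<le> G s - G (c+t)"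
      using G(4)[of "c + t"] t by auto
    then show ?thesis by (intro exI[of _ d]) auto
  qed
  moreover have "mono (\<lambda>t. G (c + t))" using G(1) by (simp add: mono_def)
  ultimately show "\<exists>G. mono G \<and> (\<forall>t. 0 \<le> G t \<and> G t \<le> \<epsilon>) \<and>
      (\<forall>t\<in>E \<inter> {a..<b}. \<exists>\<delta>>0. \<forall>s\<in>{t..b}. s < t + \<delta> \<longrightarrow> norm (w (c + s) - w (c + t)) \<le> G s - G t)"
    using G(2,3) by (intro exI[of _ "\<lambda>t. G (c + t)"]) auto
qed

text \<open>At the supremum of the times reached, the jumps of \<open>G\<close> have the favourable sign, so that only
  \<open>h\<close> has to be continuous.\<close>

lemma real_continuous_induct_le:
  fixes h G :: "real \<Rightarrow> real"
  assumes "a \<le> b" and h: "continuous_on {a..b} h" and G: "mono G"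
    and step: "\<And>t. t \<in> {a..<b} \<Longrightarrow> \<exists>\<delta>>0. \<forall>s\<in>{t..b}. s < t + \<delta> \<longrightarrow> h s - G s \<le> h t - G t"
  shows "h b - G b \<le> h a - G a"
proof -
  define S where "S = {s\<in>{a..b}. \<forall>t\<in>{a..s}. h t - G t \<le> h a - G a}"
  define c where "c = Sup S"
  have S: "a \<in> S" "S \<subseteq> {a..b}" using assms(1) by (auto simp: S_def)
  then have bdd: "bdd_above S" by (meson bdd_above_Icc bdd_above_mono)
  have "S \<noteq> {}" "\<And>s. s \<in> S \<Longrightarrow> s \<le> b" using S by auto
  then have c: "a \<le> c" "c \<le> b"
    unfolding c_def using S(1) bdd by (auto intro: cSup_upper cSup_least)
  have below: "h t - G t \<le> h a - G a" if "a \<le> t" "t < c" for t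
  proof -
    obtain s where "s \<in> S" "t < s"
      using less_cSup_iff[of S t] S bdd \<open>t < c\<close> by (auto simp: c_def)
    then show ?thesis using that by (auto simp: S_def)
  qed
  have at_c: "h c - G c \<le> h a - G a"
  proof (cases "a = c")
    case False
    then have "a < c" using c by simp
    have "closed {t\<in>{a..b}. h t \<le> h a - G a + G c}"
      by (intro closed_Collect_le[of _ h, simplified] continuous_on_closed_Collect_le h continuous_intros closed_atLeastAtMost)
    moreover have "{a..<c} \<subseteq> {t\<in>{a..b}. h t \<le> h a - G a + G c}"
    proof
      fix t assume t: "t \<in> {a..<c}"
      then have "G t \<le> G c" using G by (simp add: monoD)
      then show "t \<in> {t\<in>{a..b}. h t \<le> h a - G a + G c}" using below[of t] t c by auto
    qed
    ultimately have "closure {a..<c} \<subseteq> {t\<in>{a..b}. h t \<le> h a - G a + G c}" by (rule closure_minimal[rotated])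
    moreover have "c \<in> closure {a..<c}" using \<open>a < c\<close> by simp
    ultimately have "h c \<le> h a - G a + G c" by blast
    then show ?thesis by simp
  qed simp
  have "c = b"
  proof (rule ccontr)
    assume "c \<noteq> b"
    then have "c \<in> {a..<b}" using c by auto
    then obtain \<delta> where \<delta>: "\<delta> > 0" "\<And>s. s\<in>{c..b} \<Longrightarrow> s < c + \<delta> \<Longrightarrow> h s - G s \<le> h c - G c"
      using step by meson
    define d where "d = min b (c + \<delta>/2)"
    have d: "c < d" "d \<le> b" "d < c + \<delta>" using \<open>c \<in> {a..<b}\<close> \<delta>(1) by (auto simp: d_def)
    have "h t - G t \<le> h a - G a" if "t \<in> {a..d}" for t
    proof (cases "t < c")
      case True
      then show ?thesis using below that by auto
    next
      case False
      then have "h t - G t \<le> h c - G c" using d that by (intro \<delta>(2)) auto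
      then show ?thesis using at_c by simp
    qed
    then have "d \<in> S" using d c by (auto simp: S_def)
    then have "d \<le> c" unfolding c_def by (rule cSup_upper[OF _ bdd])
    then show False using d by simp
  qed
  then show ?thesis using at_c by simp
qed

text \<open>At points of differentiability \<open>f\<close> grows at a rate at most \<open>\<epsilon>\<close>, and at the exceptional
  points at most as fast as the controlling function; a continuous induction combines the two.\<close>

lemma nonincreasing_ae:
  fixes f :: "real \<Rightarrow> real"
  assumes ab: "a \<le> b" and f: "continuous_on {a..b} f" and E: "null_controlled f a b E"
    and deriv: "\<And>t. t \<in> {a..<b} - E \<Longrightarrow> \<exists>D\<le>0. (f has_real_derivative D) (at t)"
  shows "f b \<le> f a"
proof (rule field_le_epsilon)
  fix e :: real assume "e > 0"
  define \<epsilon> where "\<epsilon> = e / (1 + (b - a))"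
  have \<epsilon>: "\<epsilon> > 0" "\<epsilon> * (b - a) + \<epsilon> = e"
  proof -
    have "1 + (b - a) > 0" using ab by simp
    then have "\<epsilon> * (1 + (b - a)) = e" "\<epsilon> > 0" using \<open>e > 0\<close> by (simp_all add: \<epsilon>_def)
    then show "\<epsilon> > 0" "\<epsilon> * (b - a) + \<epsilon> = e" by (simp_all add: algebra_simps)
  qed
  obtain G where G: "mono G" "\<And>t. 0 \<le> G t" "\<And>t. G t \<le> \<epsilon>"
    "\<And>t. t\<in>E \<inter> {a..<b} \<Longrightarrow> \<exists>\<delta>>0. \<forall>s\<in>{t..b}. s < t + \<delta> \<longrightarrow> norm (f s - f t) \<le> G s - G t"
    using E \<epsilon>(1) unfolding null_controlled_def by meson
  have "(f b - \<epsilon> * b) - G b \<le> (f a - \<epsilon> * a) - G a"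
  proof (rule real_continuous_induct_le[OF ab _ G(1), where h = "\<lambda>t. f t - \<epsilon> * t"])
    show "continuous_on {a..b} (\<lambda>t. f t - \<epsilon> * t)" by (intro continuous_intros f)
    fix t assume t: "t \<in> {a..<b}"
    show "\<exists>\<delta>>0. \<forall>s\<in>{t..b}. s < t + \<delta> \<longrightarrow> (f s - \<epsilon> * s) - G s \<le> (f t - \<epsilon> * t) - G t"
    proof (cases "t \<in> E")
      case True
      then obtain \<delta> where \<delta>: "\<delta> > 0" "\<And>s. s\<in>{t..b} \<Longrightarrow> s < t + \<delta> \<Longrightarrow> norm (f s - f t) \<le> G s - G t"
        using G(4) t by (meson IntI)
      have "(f s - \<epsilon> * s) - G s \<le> (f t - \<epsilon> * t) - G t" if "s \<in> {t..b}" "s < t + \<delta>" for s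
      proof -
        have "\<epsilon> * t \<le> \<epsilon> * s" using that \<epsilon>(1) by (intro mult_left_mono) auto
        then show ?thesis using \<delta>(2)[OF that] by (simp add: abs_le_iff)
      qed
      then show ?thesis using \<delta>(1) by blast
    next
      case False
      then obtain D where D: "D \<le> 0" "(f has_real_derivative D) (at t)" using deriv t by blast
      have "((\<lambda>s. f s - \<epsilon> * s) has_real_derivative D - \<epsilon>) (at t)"
        by (auto intro!: derivative_eq_intros D(2))
      moreover have "D - \<epsilon> < 0" using D(1) \<epsilon>(1) by simp
      ultimately obtain \<delta> where \<delta>: "\<delta> > 0" "\<And>h. 0 < h \<Longrightarrow> h < \<delta> \<Longrightarrow> f (t + h) - \<epsilon> * (t + h) < f t - \<epsilon> * t"
        using DERIV_neg_dec_right by blast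
      have "(f s - \<epsilon> * s) - G s \<le> (f t - \<epsilon> * t) - G t" if s: "s \<in> {t..b}" "s < t + \<delta>" for s
      proof (cases "s = t")
        case False
        then have "f s - \<epsilon> * s < f t - \<epsilon> * t" using \<delta>(2)[of "s - t"] s by simp
        moreover have "G t \<le> G s" using G(1) s by (simp add: monoD)
        ultimately show ?thesis by simp
      qed simp
      then show ?thesis using \<delta>(1) by blast
    qed
  qed
  then have "f b - f a \<le> \<epsilon> * (b - a) + (G b - G a)" by (simp add: algebra_simps)
  also have "\<dots> \<le> e" using G(2)[of a] G(3)[of b] \<epsilon>(2) by linarith
  finally show "f b \<le> f a + e" by simp
qed

section \<open>Lipschitz functions are absolutely continuous\<close>

lemma straddle_quotient_tendsto:
  fixes w :: "real \<Rightarrow> 'h::real_normed_vector"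
  assumes d: "(w has_vector_derivative d) (at \<tau>)"
    and ab: "\<And>i. a i \<le> \<tau>" "\<And>i. \<tau> \<le> b i" "\<And>i. a i < b i" "a \<longlonglongrightarrow> \<tau>" "b \<longlonglongrightarrow> \<tau>"
  shows "(\<lambda>i. (1 / (b i - a i)) *\<^sub>R (w (b i) - w (a i))) \<longlonglongrightarrow> d"
proof (rule metric_LIMSEQ_I)
  fix e :: real assume "0 < e"
  then have "0 < e/2" by simp
  then obtain \<delta> where \<delta>: "\<delta> > 0"
    "\<And>y. norm (y - \<tau>) < \<delta> \<Longrightarrow> norm (w y - w \<tau> - (y - \<tau>) *\<^sub>R d) \<le> (e/2) * norm (y - \<tau>)"
    using d unfolding has_vector_derivative_def has_derivative_within_alt by (meson UNIV_I)
  have "\<forall>\<^sub>F i in sequentially. dist (a i) \<tau> < \<delta>" "\<forall>\<^sub>F i in sequentially. dist (b i) \<tau> < \<delta>"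
    using ab(4,5) \<delta>(1) by (auto intro: tendstoD)
  then have "\<forall>\<^sub>F i in sequentially. dist ((1 / (b i - a i)) *\<^sub>R (w (b i) - w (a i))) d < e"
  proof eventually_elim
    case (elim i)
    let ?l = "b i - a i"
    have l: "?l > 0" using ab(3)[of i] by simp
    have "w (b i) - w (a i) - ?l *\<^sub>R d
        = (w (b i) - w \<tau> - (b i - \<tau>) *\<^sub>R d) - (w (a i) - w \<tau> - (a i - \<tau>) *\<^sub>R d)"
      by (simp add: algebra_simps)
    then have "norm (w (b i) - w (a i) - ?l *\<^sub>R d)
        \<le> norm (w (b i) - w \<tau> - (b i - \<tau>) *\<^sub>R d) + norm (w (a i) - w \<tau> - (a i - \<tau>) *\<^sub>R d)"
      by (simp only: norm_triangle_ineq4)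
    also have "\<dots> \<le> (e/2) * norm (b i - \<tau>) + (e/2) * norm (a i - \<tau>)"
      using elim by (intro add_mono \<delta>(2)) (auto simp: dist_norm)
    also have "\<dots> = (e/2) * ?l"
    proof -
      have "norm (b i - \<tau>) = b i - \<tau>" "norm (a i - \<tau>) = \<tau> - a i" using ab(1,2)[of i] by auto
      then show ?thesis by (simp flip: distrib_left)
    qed
    also have "\<dots> < e * ?l" using l \<open>0 < e\<close> by (intro mult_strict_right_mono) auto
    finally have "norm (w (b i) - w (a i) - ?l *\<^sub>R d) < e * ?l" .
    moreover have "(1 / ?l) *\<^sub>R (w (b i) - w (a i)) - d = (1 / ?l) *\<^sub>R (w (b i) - w (a i) - ?l *\<^sub>R d)"
      using l by (simp add: scaleR_diff_right)
    ultimately show ?case using l by (simp add: dist_norm pos_divide_less_eq)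
  qed
  then show "\<exists>no. \<forall>i\<ge>no. dist ((1 / (b i - a i)) *\<^sub>R (w (b i) - w (a i))) d < e"
    by (simp add: eventually_sequentially)
qed

lemma Lipschitz_derivative_bound:
  fixes w :: "real \<Rightarrow> 'h::real_normed_vector"
  assumes L: "\<And>s t. 0 \<le> s \<Longrightarrow> 0 \<le> t \<Longrightarrow> norm (w s - w t) \<le> L * \<bar>s - t\<bar>"
    and \<tau>: "0 \<le> \<tau>" and d: "(w has_vector_derivative d) (at \<tau>)"
  shows "norm d \<le> L"
proof -
  define b where "b i = \<tau> + 1 / real (Suc i)" for i
  have "b \<longlonglongrightarrow> \<tau> + 0"
    unfolding b_def[abs_def] by (intro tendsto_intros LIMSEQ_Suc[OF lim_1_over_n])
  then have "b \<longlonglongrightarrow> \<tau>" by simp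
  moreover have "\<tau> < b i" for i by (simp add: b_def)
  ultimately have "(\<lambda>i. (1 / (b i - \<tau>)) *\<^sub>R (w (b i) - w \<tau>)) \<longlonglongrightarrow> d"
    by (intro straddle_quotient_tendsto[OF d]) (auto intro: less_imp_le)
  moreover have "norm ((1 / (b i - \<tau>)) *\<^sub>R (w (b i) - w \<tau>)) \<le> L" for i
  proof -
    have "0 < b i - \<tau>" by (simp add: b_def)
    moreover have "norm (w (b i) - w \<tau>) \<le> L * \<bar>b i - \<tau>\<bar>"
      using \<tau> \<open>0 < b i - \<tau>\<close> by (intro L) auto
    ultimately show ?thesis by (simp add: pos_divide_le_eq)
  qed
  ultimately show ?thesis by (intro Lim_norm_ubound) auto
qed

lemma simple_bochner_indicator:
  fixes c :: "'h::real_normed_vector"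
  assumes "X \<in> fmeasurable M"
  shows "Bochner_Integration.simple_bochner_integrable M (\<lambda>x. indicat_real X x *\<^sub>R c)"
    "Bochner_Integration.simple_bochner_integral M (\<lambda>x. indicat_real X x *\<^sub>R c) = measure M X *\<^sub>R c"
proof -
  have X: "X \<in> sets M" "emeasure M X < \<infinity>" using assms by (auto simp: fmeasurable_def)
  have i: "Bochner_Integration.simple_bochner_integrable M (indicat_real X)"
  proof
    show "simple_function M (indicat_real X)" using X by simp
    have "{y \<in> space M. indicat_real X y \<noteq> 0} = X" using sets.sets_into_space[OF X(1)] by (auto simp: indicator_def)
    then show "emeasure M {y \<in> space M. indicat_real X y \<noteq> 0} \<noteq> \<infinity>" using X by simp
  qed
  have "ennreal (Bochner_Integration.simple_bochner_integral M (indicat_real X)) = (\<integral>\<^sup>+x. ennreal (indicat_real X x) \<partial>M)"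
    by (rule simple_bochner_integral_eq_nn_integral[OF i]) simp
  also have "\<dots> = ennreal (measure M X)"
    using X by (simp add: ennreal_indicator emeasure_eq_ennreal_measure)
  finally have int: "Bochner_Integration.simple_bochner_integral M (indicat_real X) = measure M X"
    using i by (subst (asm) ennreal_inj) (auto simp: Bochner_Integration.simple_bochner_integral_def intro!: sum_nonneg)
  show "Bochner_Integration.simple_bochner_integrable M (\<lambda>x. indicat_real X x *\<^sub>R c)"
    using simple_bochner_integrable_compose2[OF _ i i, of "\<lambda>x y. x *\<^sub>R c"] by simp
  show "Bochner_Integration.simple_bochner_integral M (\<lambda>x. indicat_real X x *\<^sub>R c) = measure M X *\<^sub>R c"
    using simple_bochner_integral_linear[OF _ i, of "\<lambda>r. r *\<^sub>R c"] int
    by (simp add: linear_scaleR_left)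
qed

lemma simple_bochner_sum:
  fixes f :: "nat \<Rightarrow> 's \<Rightarrow> 'h::real_normed_vector"
  assumes "\<And>k. k < n \<Longrightarrow> Bochner_Integration.simple_bochner_integrable M (f k)"
  shows "Bochner_Integration.simple_bochner_integrable M (\<lambda>x. \<Sum>k<n. f k x)
    \<and> Bochner_Integration.simple_bochner_integral M (\<lambda>x. \<Sum>k<n. f k x)
      = (\<Sum>k<n. Bochner_Integration.simple_bochner_integral M (f k))"
  using assms
proof (induction n)
  case 0
  have "Bochner_Integration.simple_bochner_integrable M (\<lambda>x. 0 :: 'h)"
    by (intro simple_bochner_integrable.intros) auto
  then show ?case by (auto simp: Bochner_Integration.simple_bochner_integral_def image_constant_conv)
next
  case (Suc n)
  then show ?case
    using simple_bochner_integral_add[of M "\<lambda>x. \<Sum>k<n. f k x" "f n"]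
      simple_bochner_integrable_compose2[of "(+)" M "\<lambda>x. \<Sum>k<n. f k x" "f n"] by simp
qed

text \<open>The approximating simple functions are the difference quotients of \<open>w\<close> on a uniform grid.
  Their integrals telescope to the increment of \<open>w\<close>, and they converge to the derivative of \<open>w\<close>
  wherever it exists.\<close>

lemma Lipschitz_imp_abs_cont:
  fixes w :: "real \<Rightarrow> 'h::real_normed_vector"
  assumes L: "\<And>s t. 0 \<le> s \<Longrightarrow> 0 \<le> t \<Longrightarrow> norm (w s - w t) \<le> L * \<bar>s - t\<bar>"
    and N: "countable N" and diff: "\<And>t. 0 < t \<Longrightarrow> t \<notin> N \<Longrightarrow> \<exists>d. (w has_vector_derivative d) (at t)"
  shows "abs_cont w"
proof -
  have "norm (w 1 - w 0) \<le> L * \<bar>1 - 0\<bar>" by (intro L) auto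
  then have "0 \<le> L" by (simp add: order_trans[OF norm_ge_zero])
  define S where "S = {0<..} - N"
  have S_meas[measurable]: "S \<in> sets borel" unfolding S_def
  proof (rule sets.Diff)
    show "N \<in> sets borel" by (rule sets.countable[OF _ N]) simp
  qed simp
  define v where "v t = (if t \<in> S then vector_derivative w (at t) else 0)" for t
  have v: "(w has_vector_derivative v t) (at t)" if "t \<in> S" for t
  proof -
    obtain d where d: "(w has_vector_derivative d) (at t)" using diff[of t] \<open>t \<in> S\<close> by (auto simp: S_def)
    then have "v t = d" using that by (simp add: v_def vector_derivative_at)
    then show ?thesis using d by simp
  qed
  define W where "W t = w (max 0 t)" for t
  have "L-lipschitz_on UNIV W"
  proof (rule lipschitz_onI)
    fix s t :: real
    have "norm (W s - W t) \<le> L * \<bar>max 0 s - max 0 t\<bar>" unfolding W_def by (intro L) auto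
    also have "\<dots> \<le> L * \<bar>s - t\<bar>" using \<open>0 \<le> L\<close> by (intro mult_left_mono) auto
    finally show "dist (W s) (W t) \<le> L * dist s t" by (simp add: dist_norm)
  qed (fact \<open>0 \<le> L\<close>)
  then have W_cont: "continuous_on UNIV W" by (rule lipschitz_on_continuous_on)
  define D where "D i \<tau> = real (Suc i) *\<^sub>R (W (\<tau> + 1 / Suc i) - W \<tau>)" for i \<tau>
  have D_lim: "(\<lambda>i. D i \<tau>) \<longlonglongrightarrow> v \<tau>" if "\<tau> \<in> S" for \<tau>
  proof -
    have "(\<lambda>i. \<tau> + 1 / real (Suc i)) \<longlonglongrightarrow> \<tau> + 0"
      by (intro tendsto_intros LIMSEQ_Suc[OF lim_1_over_n])
    then have "(\<lambda>i. (1 / (\<tau> + 1 / real (Suc i) - \<tau>)) *\<^sub>R (w (\<tau> + 1 / real (Suc i)) - w \<tau>)) \<longlonglongrightarrow> v \<tau>"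
      by (intro straddle_quotient_tendsto[OF v[OF that]]) auto
    moreover have "(1 / (\<tau> + 1 / real (Suc i) - \<tau>)) *\<^sub>R (w (\<tau> + 1 / real (Suc i)) - w \<tau>) = D i \<tau>" for i
      using that by (simp add: D_def W_def S_def)
    ultimately show ?thesis by simp
  qed
  have v_bound: "norm (v \<tau>) \<le> L" for \<tau>
  proof (cases "\<tau> \<in> S")
    case True
    then show ?thesis using Lipschitz_derivative_bound[OF L _ v[OF True]] by (simp add: S_def)
  qed (simp add: v_def \<open>0 \<le> L\<close>)
  have v_meas: "v \<in> borel_measurable borel"
  proof (rule borel_measurable_LIMSEQ_metric)
    show "(\<lambda>\<tau>. if \<tau> \<in> S then D i \<tau> else 0) \<in> borel_measurable borel" for i
    proof (intro measurable_If_set)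
      show "D i \<in> borel_measurable borel"
        unfolding D_def
        by (intro borel_measurable_continuous_onI continuous_intros
            continuous_on_compose2[OF W_cont]) auto
    qed auto
    show "(\<lambda>i. if \<tau> \<in> S then D i \<tau> else 0) \<longlonglongrightarrow> v \<tau>" for \<tau>
      using D_lim[of \<tau>] by (cases "\<tau> \<in> S") (auto simp: v_def)
  qed
  have main: "has_Bochner_integral lebesgue (\<lambda>s. indicat_real {0..t} s *\<^sub>R v s) (w t - w 0)" if "0 \<le> t" for t
  proof -
    define f where "f s = indicat_real {0..t} s *\<^sub>R v s" for s
    have f_meas: "f \<in> borel_measurable lebesgue"
    proof -
      have "(\<lambda>s. if s \<in> {0..t} then v s else 0) \<in> borel_measurable borel"
        by (intro measurable_If_set v_meas) auto
      moreover have "f = (\<lambda>s. if s \<in> {0..t} then v s else 0)" by (auto simp: f_def indicator_def)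
      ultimately show ?thesis by (simp add: measurable_completion)
    qed
    define h where "h n = t / Suc n" for n
    have h: "0 \<le> h n" for n using \<open>0 \<le> t\<close> by (simp add: h_def)
    define I where "I n k = {real k * h n..<real (Suc k) * h n}" for n k
    define c where "c n k = (1 / h n) *\<^sub>R (w (real (Suc k) * h n) - w (real k * h n))" for n k
    define s where "s n \<tau> = (\<Sum>k<Suc n. indicat_real (I n k) \<tau> *\<^sub>R c n k)" for n \<tau>
    have I: "I n k \<in> lmeasurable" "measure lebesgue (I n k) = h n" for n k
      using h[of n] by (auto intro!: bounded_set_imp_lmeasurable simp: I_def algebra_simps)
    have s_int: "Bochner_Integration.simple_bochner_integrable lebesgue (s n)"
      and s_val: "Bochner_Integration.simple_bochner_integral lebesgue (s n) = w t - w 0" for n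
    proof -
      have *: "measure lebesgue (I n k) *\<^sub>R c n k = w (real (Suc k) * h n) - w (real k * h n)" for k
        unfolding I(2) by (cases "h n = 0") (auto simp: c_def)
      have "(\<Sum>k<Suc n. w (real (Suc k) * h n) - w (real k * h n)) = w (real (Suc n) * h n) - w (real 0 * h n)"
        by (rule sum_lessThan_telescope)
      also have "\<dots> = w t - w 0" by (simp add: h_def)
      finally have tele: "(\<Sum>k<Suc n. w (real (Suc k) * h n) - w (real k * h n)) = w t - w 0" .
      note sum = simple_bochner_sum[of "Suc n" lebesgue "\<lambda>k \<tau>. indicat_real (I n k) \<tau> *\<^sub>R c n k",
          OF simple_bochner_indicator(1)[OF I(1)]]
      show "Bochner_Integration.simple_bochner_integrable lebesgue (s n)"
        unfolding s_def[abs_def] by (rule conjunct1[OF sum])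
      have "Bochner_Integration.simple_bochner_integral lebesgue (s n)
          = (\<Sum>k<Suc n. Bochner_Integration.simple_bochner_integral lebesgue (\<lambda>\<tau>. indicat_real (I n k) \<tau> *\<^sub>R c n k))"
        unfolding s_def[abs_def] by (rule conjunct2[OF sum])
      then show "Bochner_Integration.simple_bochner_integral lebesgue (s n) = w t - w 0"
        by (simp only: simple_bochner_indicator(2)[OF I(1)] * tele)
    qed
    have s_simple: "simple_function lebesgue (s n)" for n
      using s_int by (auto elim: simple_bochner_integrable.cases)
    have s_at: "\<exists>k. s n \<tau> = c n k \<and> real k * h n \<le> \<tau> \<and> \<tau> < real (Suc k) * h n"
      if "0 \<le> \<tau>" "\<tau> < t" for n \<tau>
    proof -
      have hp: "h n > 0" using that by (simp add: h_def)
      define k where "k = nat \<lfloor>\<tau> / h n\<rfloor>"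
      have "0 \<le> \<tau> / h n" using that hp by simp
      then have "real k \<le> \<tau> / h n" "\<tau> / h n < real (Suc k)" unfolding k_def by linarith+
      then have k: "real k * h n \<le> \<tau>" "\<tau> < real (Suc k) * h n"
        using hp by (simp_all only: pos_le_divide_eq pos_divide_less_eq)
      have "real k * h n < real (Suc n) * h n" using k(1) that by (simp add: h_def)
      then have "k < Suc n" using hp by simp
      have "indicat_real (I n j) \<tau> = (if j = k then 1 else 0)" for j
      proof -
        have "j = k" if "real j * h n \<le> \<tau>" "\<tau> < real (Suc j) * h n"
        proof -
          have "real j * h n < real (Suc k) * h n" "real k * h n < real (Suc j) * h n"
            using that k by linarith+
          then show ?thesis using hp by simp
        qed
        then have "\<tau> \<in> I n j \<longleftrightarrow> j = k" unfolding I_def atLeastLessThan_iff using k by blast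
        then show ?thesis by (simp add: indicator_def)
      qed
      then have "s n \<tau> = (\<Sum>j<Suc n. if j = k then c n k else 0)"
        unfolding s_def by (intro sum.cong) auto
      also have "\<dots> = c n k" using \<open>k < Suc n\<close> by (simp del: sum.lessThan_Suc)
      finally show ?thesis using k by blast
    qed
    have s_out: "s n \<tau> = 0" if "\<tau> < 0 \<or> t \<le> \<tau>" for n \<tau>
    proof -
      have "\<tau> \<notin> I n k" if "k < Suc n" for k
      proof -
        have "real (Suc k) * h n \<le> real (Suc n) * h n" using that h[of n] by (intro mult_right_mono) auto
        moreover have "real (Suc n) * h n = t" by (simp add: h_def)
        moreover have "0 \<le> real k * h n" using h by simp
        ultimately show ?thesis using \<open>\<tau> < 0 \<or> t \<le> \<tau>\<close> by (auto simp: I_def)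
      qed
      then show ?thesis unfolding s_def by (intro sum.neutral) auto
    qed
    have c_bound: "norm (c n k) \<le> L" if "h n > 0" for n k
    proof -
      have "norm (w (real (Suc k) * h n) - w (real k * h n)) \<le> L * \<bar>real (Suc k) * h n - real k * h n\<bar>"
        using that by (intro L) auto
      also have "\<dots> = L * h n" using that by (simp add: algebra_simps)
      finally show ?thesis using that by (simp add: c_def pos_divide_le_eq)
    qed
    have s_lim: "(\<lambda>n. s n \<tau>) \<longlonglongrightarrow> f \<tau>" if \<tau>: "\<tau> \<in> S" "\<tau> < t" for \<tau>
    proof -
      have "0 < \<tau>" using \<tau> by (simp add: S_def)
      then obtain k where k: "\<And>n. s n \<tau> = c n (k n)" "\<And>n. real (k n) * h n \<le> \<tau>"
        "\<And>n. \<tau> < real (Suc (k n)) * h n"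
        using s_at[of \<tau>] \<tau>(2) by (metis less_imp_le)
      define a b where "a n = real (k n) * h n" and "b n = real (Suc (k n)) * h n" for n
      have len: "b n = a n + h n" for n by (simp add: a_def b_def algebra_simps)
      have "(\<lambda>n. t * (1 / real (Suc n))) \<longlonglongrightarrow> t * 0"
        by (intro tendsto_intros LIMSEQ_Suc[OF lim_1_over_n])
      then have h0: "h \<longlonglongrightarrow> 0" by (simp add: h_def[abs_def])
      have ab: "a n \<le> \<tau>" "\<tau> < b n" for n using k by (auto simp: a_def b_def)
      have a: "a \<longlonglongrightarrow> \<tau>"
      proof (rule tendsto_sandwich[OF _ _ _ tendsto_const])
        show "(\<lambda>n. \<tau> - h n) \<longlonglongrightarrow> \<tau>" using tendsto_diff[OF tendsto_const h0, of \<tau>] by simp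
      qed (use ab len in \<open>auto intro!: always_eventually less_imp_le simp: algebra_simps\<close>)
      have b: "b \<longlonglongrightarrow> \<tau>" using tendsto_add[OF a h0] by (simp add: len[abs_def] fun_eq_iff)
      have "(\<lambda>n. (1 / (b n - a n)) *\<^sub>R (w (b n) - w (a n))) \<longlonglongrightarrow> v \<tau>"
        using ab by (intro straddle_quotient_tendsto[OF v[OF \<tau>(1)]] a b) (auto intro: less_imp_le le_less_trans)
      moreover have "(1 / (b n - a n)) *\<^sub>R (w (b n) - w (a n)) = s n \<tau>" for n
      proof -
        have "b n - a n = h n" by (simp add: len)
        then show ?thesis unfolding k(1) c_def a_def b_def by simp
      qed
      ultimately show ?thesis using \<tau> by (simp add: f_def S_def)
    qed
    have "(\<lambda>n. \<integral>\<^sup>+\<tau>. ennreal (norm (f \<tau> - s n \<tau>)) \<partial>lebesgue) \<longlonglongrightarrow> (\<integral>\<^sup>+\<tau>. 0 \<partial>(lebesgue :: real measure))"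
    proof (rule nn_integral_dominated_convergence[where w = "\<lambda>\<tau>. ennreal (2 * L) * indicator {0..t} \<tau>"])
      show "(\<lambda>\<tau>. ennreal (norm (f \<tau> - s n \<tau>))) \<in> borel_measurable lebesgue" for n
        using borel_measurable_diff_simple[OF f_meas s_simple] by measurable
      show "(\<lambda>\<tau>. ennreal (2 * L) * indicator {0..t} \<tau>) \<in> borel_measurable lebesgue"
        by (intro borel_measurable_times_ennreal borel_measurable_indicator) auto
      have "(\<integral>\<^sup>+\<tau>. ennreal (2 * L) * indicator {0..t} \<tau> \<partial>lebesgue) = ennreal (2 * L) * ennreal t"
        using \<open>0 \<le> t\<close> by (subst nn_integral_cmult_indicator) auto
      also have "\<dots> < \<infinity>" by (simp add: ennreal_mult_less_top)
      finally show "(\<integral>\<^sup>+\<tau>. ennreal (2 * L) * indicator {0..t} \<tau> \<partial>lebesgue) < \<infinity>" .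
      have "ennreal (norm (f \<tau> - s n \<tau>)) \<le> ennreal (2 * L) * indicator {0..t} \<tau>" for n \<tau>
      proof (cases "\<tau> \<in> {0..t}")
        case True
        have "norm (s n \<tau>) \<le> L"
        proof (cases "\<tau> = t")
          case False
          then obtain k where "s n \<tau> = c n k" using s_at[of \<tau> n] \<open>\<tau> \<in> {0..t}\<close> by auto
          moreover have "h n > 0" using False True by (simp add: h_def)
          ultimately show ?thesis using c_bound by simp
        qed (simp add: s_out \<open>0 \<le> L\<close>)
        moreover have "norm (f \<tau>) \<le> L" using v_bound True by (simp add: f_def)
        ultimately have "norm (f \<tau> - s n \<tau>) \<le> 2 * L" using norm_triangle_ineq4[of "f \<tau>" "s n \<tau>"] by linarith
        then show ?thesis using True by (simp add: ennreal_leI)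
      next
        case False
        then show ?thesis using s_out[of \<tau> n] by (auto simp: f_def)
      qed
      then show "\<And>n. AE \<tau> in lebesgue. ennreal (norm (f \<tau> - s n \<tau>)) \<le> ennreal (2 * L) * indicator {0..t} \<tau>"
        by simp
      have "(\<lambda>n. ennreal (norm (f \<tau> - s n \<tau>))) \<longlonglongrightarrow> 0" if "\<tau> \<notin> insert 0 (insert t N)" for \<tau>
      proof (cases "\<tau> < 0 \<or> t \<le> \<tau>")
        case True
        then have "f \<tau> = 0" using that by (auto simp: f_def)
        then show ?thesis using s_out True by simp
      next
        case False
        then have "(\<lambda>n. norm (f \<tau> - s n \<tau>)) \<longlonglongrightarrow> norm (f \<tau> - f \<tau>)"
          using that by (intro tendsto_intros s_lim) (auto simp: S_def)
        then have "(\<lambda>n. ennreal (norm (f \<tau> - s n \<tau>))) \<longlonglongrightarrow> ennreal (norm (f \<tau> - f \<tau>))"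
          by (rule tendsto_ennrealI)
        then show ?thesis by simp
      qed
      moreover have "AE \<tau> in lebesgue. \<tau> \<notin> insert 0 (insert t N)"
        using N by (intro AE_not_in null_sets_completionI countable_imp_null_set_lborel) auto
      ultimately show "AE \<tau> in lebesgue. (\<lambda>n. ennreal (norm (f \<tau> - s n \<tau>))) \<longlonglongrightarrow> 0" by auto
    qed auto
    then have "(\<lambda>n. \<integral>\<^sup>+\<tau>. ennreal (norm (f \<tau> - s n \<tau>)) \<partial>lebesgue) \<longlonglongrightarrow> 0" by simp
    moreover have "(\<lambda>n. Bochner_Integration.simple_bochner_integral lebesgue (s n)) \<longlonglongrightarrow> w t - w 0"
      by (simp add: s_val)
    ultimately have "has_Bochner_integral lebesgue f (w t - w 0)"
      unfolding has_Bochner_integral_def using f_meas s_int by blast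
    then show ?thesis by (simp add: f_def[abs_def])
  qed
  then show ?thesis unfolding abs_cont_def by (meson atLeastAtMost_iff)
qed

lemma abs_cont_const: "abs_cont (\<lambda>_. c)"
  by (rule Lipschitz_imp_abs_cont[where L = 0 and N = "{}"]) (auto intro!: exI derivative_eq_intros)

lemma abs_cont_ident: "abs_cont (\<lambda>t::real. t)"
  by (rule Lipschitz_imp_abs_cont[where L = 1 and N = "{}"]) (auto intro!: exI has_vector_derivative_id)

lemma increment_le_ae:
  fixes f :: "real \<Rightarrow> real"
  assumes ab: "0 \<le> a" "a \<le> b" and f: "continuous_on {a..b} f"
    and E: "null_controlled f a b E" "negligible E"
    and deriv: "\<And>t. t \<in> {a..<b} - E \<Longrightarrow> \<exists>D\<le>k. (f has_real_derivative D) (at t)"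
  shows "f b - f a \<le> k * (b - a)"
proof -
  have "f b - k * b \<le> f a - k * a"
  proof (rule nonincreasing_ae[OF ab(2)])
    show "continuous_on {a..b} (\<lambda>t. f t - k * t)" by (intro continuous_intros f)
    have "null_controlled (\<lambda>t. (f t, t)) a b E"
      by (intro null_controlled_Pair E abs_cont_null_controlled abs_cont_ident ab)
    then show "null_controlled (\<lambda>t. f t - k * t) a b E"
    proof (rule null_controlled_Lipschitz_image[where R = "1 + \<bar>k\<bar>"])
      fix s t :: real
      have "norm ((f s - k * s) - (f t - k * t)) = norm ((f s - f t) - k * (s - t))" by (simp add: algebra_simps)
      also have "\<dots> \<le> \<bar>f s - f t\<bar> + \<bar>k\<bar> * \<bar>s - t\<bar>"
        by (metis abs_mult norm_triangle_ineq4 real_norm_def)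
      also have "\<dots> \<le> norm ((f s, s) - (f t, t)) + \<bar>k\<bar> * norm ((f s, s) - (f t, t))"
        using norm_fst_le[of "f s - f t" "s - t"] norm_snd_le[of "s - t" "f s - f t"]
        by (intro add_mono mult_left_mono) auto
      finally show "norm ((f s - k * s) - (f t - k * t)) \<le> (1 + \<bar>k\<bar>) * norm ((f s, s) - (f t, t))"
        by (simp add: algebra_simps)
    qed
    fix t assume "t \<in> {a..<b} - E"
    then obtain D where "D \<le> k" "(f has_real_derivative D) (at t)" using deriv by blast
    then show "\<exists>D\<le>0. ((\<lambda>t. f t - k * t) has_real_derivative D) (at t)"
      by (intro exI[of _ "D - k"]) (auto intro!: derivative_eq_intros)
  qed
  then show ?thesis by (simp add: algebra_simps)
qed

section \<open>Solutions of differential inclusions with a dissipative right-hand side\<close>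

definition strong_flow :: "('h::real_inner, 'h) multimap \<Rightarrow> (real \<Rightarrow> 'h) \<Rightarrow> bool" where
  "strong_flow M w \<longleftrightarrow> abs_cont w \<and> (\<forall>t\<ge>0. w t \<in> mdom M) \<and>
     (AE t in lebesgue. t > 0 \<longrightarrow> (\<exists>d \<in> M (w t). (w has_vector_derivative d) (at t)))"

lemma AE_lebesgue_negligible:
  assumes "AE t in lebesgue. P t"
  shows "\<exists>E. negligible E \<and> (\<forall>t. t \<notin> E \<longrightarrow> P (t::real))"
proof -
  obtain E where "E \<in> null_sets lebesgue" "{t \<in> space lebesgue. \<not> P t} \<subseteq> E"
    using assms unfolding eventually_ae_filter by blast
  then show ?thesis by (intro exI[of _ E]) (auto simp: negligible_iff_null_sets)
qed

lemma strong_flow_negligible: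
  assumes "strong_flow M w"
  shows "\<exists>E. negligible E \<and> (\<forall>t>0. t \<notin> E \<longrightarrow> (\<exists>d \<in> M (w t). (w has_vector_derivative d) (at t)))"
  using AE_lebesgue_negligible[of "\<lambda>t. t > 0 \<longrightarrow> (\<exists>d \<in> M (w t). (w has_vector_derivative d) (at t))"] assms
  unfolding strong_flow_def by blast

lemma has_real_derivative_norm_diff_sq:
  fixes u v :: "real \<Rightarrow> 'h::real_inner"
  assumes "(u has_vector_derivative d) (at t)" "(v has_vector_derivative e) (at t)"
  shows "((\<lambda>s. (norm (u s - v s))\<^sup>2) has_real_derivative 2 * inner (d - e) (u t - v t)) (at t)"
proof -
  have D: "((\<lambda>s. u s - v s) has_derivative (\<lambda>h. h *\<^sub>R (d - e))) (at t)"
    using has_vector_derivative_diff[OF assms] by (simp add: has_vector_derivative_def)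
  have "((\<lambda>s. inner (u s - v s) (u s - v s)) has_derivative
      (\<lambda>h. inner (u t - v t) (h *\<^sub>R (d - e)) + inner (h *\<^sub>R (d - e)) (u t - v t))) (at t)"
    by (rule has_derivative_inner[OF D D])
  moreover have "(\<lambda>h. inner (u t - v t) (h *\<^sub>R (d - e)) + inner (h *\<^sub>R (d - e)) (u t - v t))
      = (*) (2 * inner (d - e) (u t - v t))"
    by (auto simp: inner_commute)
  ultimately show ?thesis by (simp add: has_field_derivative_def power2_norm_eq_inner)
qed

lemma has_vector_derivative_shift:
  fixes w :: "real \<Rightarrow> 'h::real_normed_vector"
  assumes "(w has_vector_derivative d) (at (c + t))"
  shows "((\<lambda>s. w (c + s)) has_vector_derivative d) (at t)"
proof -
  have "((\<lambda>s. c + s) has_vector_derivative 1) (at t)" by (auto intro!: derivative_eq_intros)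
  from vector_diff_chain_at[OF this assms] show ?thesis by (simp add: o_def)
qed

lemma null_controlled_norm_diff_sq:
  fixes u v :: "real \<Rightarrow> 'h::real_inner"
  assumes cont: "continuous_on {a..b} u" "continuous_on {a..b} v"
    and E: "null_controlled u a b E" "null_controlled v a b E"
  shows "null_controlled (\<lambda>t. (norm (u t - v t))\<^sup>2) a b E"
proof -
  have "continuous_on {a..b} (\<lambda>t. norm (u t - v t))" by (intro continuous_intros cont)
  then have "bounded ((\<lambda>t. norm (u t - v t)) ` {a..b})"
    by (intro compact_imp_bounded compact_continuous_image) auto
  then obtain R where "\<forall>y\<in>(\<lambda>t. norm (u t - v t)) ` {a..b}. norm y \<le> R" unfolding bounded_iff by blast
  then have R: "norm (u t - v t) \<le> R" if "t \<in> {a..b}" for t using that by simp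
  have "null_controlled (\<lambda>t. (u t, v t)) a b E" by (rule null_controlled_Pair[OF E])
  then show ?thesis
  proof (rule null_controlled_Lipschitz_image[where R = "4 * R"])
    fix s t assume st: "s \<in> {a..b}" "t \<in> {a..b}"
    let ?p = "u s - v s" and ?q = "u t - v t"
    have "norm ((norm ?p)\<^sup>2 - (norm ?q)\<^sup>2) = \<bar>norm ?p - norm ?q\<bar> * (norm ?p + norm ?q)"
      by (simp add: power2_eq_square square_diff_square_factored abs_mult mult.commute)
    also have "\<dots> \<le> norm (?p - ?q) * (2 * R)"
      using R[OF st(1)] R[OF st(2)] by (intro mult_mono norm_triangle_ineq3) auto
    also have "\<dots> \<le> (2 * norm ((u s, v s) - (u t, v t))) * (2 * R)"
    proof (rule mult_right_mono)
      have "?p - ?q = (u s - u t) - (v s - v t)" by simp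
      then have "norm (?p - ?q) \<le> norm (u s - u t) + norm (v s - v t)" by (metis norm_triangle_ineq4)
      then show "norm (?p - ?q) \<le> 2 * norm ((u s, v s) - (u t, v t))"
        using norm_fst_le[of "u s - u t" "v s - v t"] norm_snd_le[of "v s - v t" "u s - u t"] by simp
      show "0 \<le> 2 * R" using order_trans[OF norm_ge_zero R[OF st(1)]] by simp
    qed
    finally show "norm ((norm ?p)\<^sup>2 - (norm ?q)\<^sup>2) \<le> 4 * R * norm ((u s, v s) - (u t, v t))"
      by (simp add: mult.commute mult.left_commute)
  qed
qed

lemma norm_diff_nonincreasing:
  fixes u v :: "real \<Rightarrow> 'h::real_inner"
  assumes "a \<le> b" and cont: "continuous_on {a..b} u" "continuous_on {a..b} v"
    and E: "null_controlled u a b E" "null_controlled v a b E"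
    and deriv: "\<And>t. t \<in> {a..<b} - E \<Longrightarrow> \<exists>d e. (u has_vector_derivative d) (at t) \<and>
      (v has_vector_derivative e) (at t) \<and> inner (d - e) (u t - v t) \<le> 0"
  shows "norm (u b - v b) \<le> norm (u a - v a)"
proof -
  have "(norm (u b - v b))\<^sup>2 \<le> (norm (u a - v a))\<^sup>2"
  proof (rule nonincreasing_ae[OF assms(1) _ null_controlled_norm_diff_sq[OF cont E]])
    show "continuous_on {a..b} (\<lambda>t. (norm (u t - v t))\<^sup>2)" by (intro continuous_intros cont)
    fix t assume "t \<in> {a..<b} - E"
    then obtain d e where "(u has_vector_derivative d) (at t)" "(v has_vector_derivative e) (at t)"
      "inner (d - e) (u t - v t) \<le> 0" using deriv by meson
    then show "\<exists>D\<le>0. ((\<lambda>t. (norm (u t - v t))\<^sup>2) has_real_derivative D) (at t)"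
      by (intro exI[of _ "2 * inner (d - e) (u t - v t)"]) (auto intro: has_real_derivative_norm_diff_sq)
  qed
  then show ?thesis by (rule power2_le_imp_le) simp
qed

lemma strong_flow_contraction:
  fixes w v :: "real \<Rightarrow> 'h::real_inner"
  assumes M: "dissipative M" and w: "strong_flow M w" and v: "strong_flow M v"
    and "0 \<le> c" "0 \<le> k" "0 \<le> t"
  shows "norm (w (c + t) - v (k + t)) \<le> norm (w c - v k)"
proof -
  obtain E where E: "negligible E"
    "\<And>t. t > 0 \<Longrightarrow> t \<notin> E \<Longrightarrow> \<exists>d \<in> M (w t). (w has_vector_derivative d) (at t)"
    using strong_flow_negligible[OF w] by blast
  obtain F where F: "negligible F"
    "\<And>t. t > 0 \<Longrightarrow> t \<notin> F \<Longrightarrow> \<exists>d \<in> M (v t). (v has_vector_derivative d) (at t)"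
    using strong_flow_negligible[OF v] by blast
  define Z where "Z = insert 0 ((+) (- c) ` E \<union> (+) (- k) ` F)"
  have Z: "negligible Z" unfolding Z_def negligible_insert by (intro negligible_Un negligible_translation E(1) F(1))
  have ac: "abs_cont w" "abs_cont v" using w v by (auto simp: strong_flow_def)
  have shift: "null_controlled (\<lambda>t. u (a + t)) 0 t Z" "continuous_on {0..t} (\<lambda>t. u (a + t))"
    if "abs_cont u" "0 \<le> a" for a and u :: "real \<Rightarrow> 'h"
    using that Z by (auto intro!: null_controlled_shift abs_cont_null_controlled negligible_translation
        continuous_on_compose2[OF abs_cont_continuous_on[OF that(1)]] continuous_intros)
  have "norm (w (c + t) - v (k + t)) \<le> norm (w (c + 0) - v (k + 0))"
  proof (rule norm_diff_nonincreasing[OF \<open>0 \<le> t\<close> shift(2,2) shift(1,1)])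
    fix s assume s: "s \<in> {0..<t} - Z"
    have "c + s \<notin> E" "k + s \<notin> F" "0 < s"
      using s unfolding Z_def by (auto simp: image_iff)
    then obtain d e where "d \<in> M (w (c + s))" "(w has_vector_derivative d) (at (c + s))"
      "e \<in> M (v (k + s))" "(v has_vector_derivative e) (at (k + s))"
      using E(2)[of "c + s"] F(2)[of "k + s"] assms(4,5) by auto
    then show "\<exists>d e. ((\<lambda>t. w (c + t)) has_vector_derivative d) (at s) \<and>
        ((\<lambda>t. v (k + t)) has_vector_derivative e) (at s) \<and> inner (d - e) (w (c + s) - v (k + s)) \<le> 0"
      using dissipativeD[OF M] by (intro exI[of _ d] exI[of _ e]) (auto intro: has_vector_derivative_shift)
  qed (use ac assms(4,5) in auto)
  then show ?thesis by simp
qed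

text \<open>The part of the notion of solution that survives pointwise limits. The last two
  inequalities are integrated forms of \<open>\<langle>w' - \<eta>, w - \<xi>\<rangle> \<le> 0\<close>; the last one is sharp to first order in
  \<open>t - s\<close>, and together with the maximality of \<open>M\<close> it will bring back the derivative.\<close>

definition trajectory :: "('h::real_inner, 'h) multimap \<Rightarrow> real \<Rightarrow> (real \<Rightarrow> 'h) \<Rightarrow> bool" where
  "trajectory M L w \<longleftrightarrow>
     (\<forall>s\<ge>0. \<forall>t\<ge>0. norm (w s - w t) \<le> L * \<bar>s - t\<bar>) \<and>
     (\<forall>s\<ge>0. \<forall>t\<ge>0. \<forall>h\<ge>0. norm (w (s + h) - w (t + h)) \<le> norm (w s - w t)) \<and>
     (\<forall>\<xi>. \<forall>\<eta>\<in>M \<xi>. \<forall>s\<ge>0. \<forall>t\<ge>s.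
        norm (w t - \<xi>) \<le> norm (w s - \<xi>) + norm \<eta> * (t - s) \<and>
        (norm (w t - \<xi>))\<^sup>2 / 2 - (norm (w s - \<xi>))\<^sup>2 / 2
          \<le> (inner \<eta> (w s - \<xi>) + norm \<eta> * L * (t - s)) * (t - s))"

lemma trajectoryD:
  assumes "trajectory M L w"
  shows "\<And>s t. 0 \<le> s \<Longrightarrow> 0 \<le> t \<Longrightarrow> norm (w s - w t) \<le> L * \<bar>s - t\<bar>"
    and "\<And>s t h. 0 \<le> s \<Longrightarrow> 0 \<le> t \<Longrightarrow> 0 \<le> h \<Longrightarrow> norm (w (s + h) - w (t + h)) \<le> norm (w s - w t)"
    and "\<And>\<xi> \<eta> s t. \<eta> \<in> M \<xi> \<Longrightarrow> 0 \<le> s \<Longrightarrow> s \<le> t \<Longrightarrow> norm (w t - \<xi>) \<le> norm (w s - \<xi>) + norm \<eta> * (t - s)"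
    and "\<And>\<xi> \<eta> s t. \<eta> \<in> M \<xi> \<Longrightarrow> 0 \<le> s \<Longrightarrow> s \<le> t \<Longrightarrow> (norm (w t - \<xi>))\<^sup>2 / 2 - (norm (w s - \<xi>))\<^sup>2 / 2
          \<le> (inner \<eta> (w s - \<xi>) + norm \<eta> * L * (t - s)) * (t - s)"
  using assms unfolding trajectory_def by auto

lemma trajectory_limit:
  assumes w: "trajectory M L w" and c: "\<And>n. 0 \<le> c n"
    and lim: "\<And>s. 0 \<le> s \<Longrightarrow> (\<lambda>n. w (c n + s)) \<longlonglongrightarrow> W s"
  shows "trajectory M L W"
  unfolding trajectory_def
proof (intro conjI allI impI ballI)
  fix s t :: real assume st: "0 \<le> s" "0 \<le> t"
  have "norm (w (c n + s) - w (c n + t)) \<le> L * \<bar>s - t\<bar>" for n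
    using trajectoryD(1)[OF w, of "c n + s" "c n + t"] c st by simp
  then show "norm (W s - W t) \<le> L * \<bar>s - t\<bar>"
    by (intro LIMSEQ_le_const2[OF tendsto_norm[OF tendsto_diff[OF lim lim]]] st) auto
  fix h :: real assume "0 \<le> h"
  have "norm (w (c n + (s + h)) - w (c n + (t + h))) \<le> norm (w (c n + s) - w (c n + t))" for n
    using trajectoryD(2)[OF w, of "c n + s" "c n + t" h] c st \<open>0 \<le> h\<close> by (simp add: add.assoc)
  then show "norm (W (s + h) - W (t + h)) \<le> norm (W s - W t)"
    using st \<open>0 \<le> h\<close>
    by (intro LIMSEQ_le[OF tendsto_norm[OF tendsto_diff[OF lim lim]] tendsto_norm[OF tendsto_diff[OF lim lim]]]) auto
next
  fix \<xi> \<eta> and s t :: real assume \<eta>: "\<eta> \<in> M \<xi>" and st: "0 \<le> s" "s \<le> t"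
  have "norm (w (c n + t) - \<xi>) \<le> norm (w (c n + s) - \<xi>) + norm \<eta> * (t - s)" for n
    using trajectoryD(3)[OF w \<eta>, of "c n + s" "c n + t"] c st by simp
  moreover have "(\<lambda>n. norm (w (c n + t) - \<xi>)) \<longlonglongrightarrow> norm (W t - \<xi>)"
    "(\<lambda>n. norm (w (c n + s) - \<xi>) + norm \<eta> * (t - s)) \<longlonglongrightarrow> norm (W s - \<xi>) + norm \<eta> * (t - s)"
    using st by (intro tendsto_intros lim; simp)+
  ultimately show "norm (W t - \<xi>) \<le> norm (W s - \<xi>) + norm \<eta> * (t - s)"
    by (intro LIMSEQ_le) auto
  have "(norm (w (c n + t) - \<xi>))\<^sup>2 / 2 - (norm (w (c n + s) - \<xi>))\<^sup>2 / 2
      \<le> (inner \<eta> (w (c n + s) - \<xi>) + norm \<eta> * L * (t - s)) * (t - s)" for n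
    using trajectoryD(4)[OF w \<eta>, of "c n + s" "c n + t"] c st by simp
  moreover have "(\<lambda>n. (norm (w (c n + t) - \<xi>))\<^sup>2 / 2 - (norm (w (c n + s) - \<xi>))\<^sup>2 / 2)
      \<longlonglongrightarrow> (norm (W t - \<xi>))\<^sup>2 / 2 - (norm (W s - \<xi>))\<^sup>2 / 2"
    "(\<lambda>n. (inner \<eta> (w (c n + s) - \<xi>) + norm \<eta> * L * (t - s)) * (t - s))
      \<longlonglongrightarrow> (inner \<eta> (W s - \<xi>) + norm \<eta> * L * (t - s)) * (t - s)"
    using st by (intro tendsto_intros lim; simp)+
  ultimately show "(norm (W t - \<xi>))\<^sup>2 / 2 - (norm (W s - \<xi>))\<^sup>2 / 2
      \<le> (inner \<eta> (W s - \<xi>) + norm \<eta> * L * (t - s)) * (t - s)"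
    by (intro LIMSEQ_le) auto
qed

lemma strong_flow_dist_growth:
  fixes w :: "real \<Rightarrow> 'h::real_inner"
  assumes M: "dissipative M" and w: "strong_flow M w" and \<eta>: "\<eta> \<in> M \<xi>" and st: "0 \<le> s" "s \<le> t"
  shows "norm (w t - \<xi>) \<le> norm (w s - \<xi>) + norm \<eta> * (t - s)"
proof (rule field_le_epsilon)
  fix \<epsilon> :: real assume \<epsilon>: "0 < \<epsilon>"
  obtain E where E: "negligible E"
    "\<And>t. t > 0 \<Longrightarrow> t \<notin> E \<Longrightarrow> \<exists>d \<in> M (w t). (w has_vector_derivative d) (at t)"
    using strong_flow_negligible[OF w] by blast
  have ac: "abs_cont w" using w by (simp add: strong_flow_def)
  have cont: "continuous_on {s..t} w"
    using abs_cont_continuous_on[OF ac] by (rule continuous_on_subset) (use st in auto)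
  \<comment> \<open>The norm is not differentiable at zero.\<close>
  define f where "f \<tau> = sqrt ((norm (w \<tau> - \<xi>))\<^sup>2 + \<epsilon>\<^sup>2)" for \<tau>
  have f_norm: "f \<tau> = norm (w \<tau> - \<xi>, \<epsilon>)" for \<tau> by (simp add: f_def norm_Pair)
  have "f t - f s \<le> norm \<eta> * (t - s)"
  proof (rule increment_le_ae[OF st, where E = "insert 0 E"])
    show "continuous_on {s..t} f" unfolding f_def by (intro continuous_intros cont)
    show "negligible (insert 0 E)" using E by simp
    then have "null_controlled w s t (insert 0 E)" by (intro abs_cont_null_controlled ac st)
    then show "null_controlled f s t (insert 0 E)"
    proof (rule null_controlled_Lipschitz_image[where R = 1])
      fix a b
      have "norm (f a - f b) \<le> norm ((w a - \<xi>, \<epsilon>) - (w b - \<xi>, \<epsilon>))"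
        unfolding f_norm real_norm_def by (rule norm_triangle_ineq3)
      also have "\<dots> = norm (w a - w b)" by (simp add: norm_Pair)
      finally show "norm (f a - f b) \<le> 1 * norm (w a - w b)" by simp
    qed
    fix \<tau> assume \<tau>: "\<tau> \<in> {s..<t} - insert 0 E"
    then obtain d where d: "d \<in> M (w \<tau>)" "(w has_vector_derivative d) (at \<tau>)" using E(2)[of \<tau>] st by auto
    have pos: "(norm (w \<tau> - \<xi>))\<^sup>2 + \<epsilon>\<^sup>2 > 0" using \<epsilon> by (simp add: add_nonneg_pos)
    have "((\<lambda>\<tau>. (norm (w \<tau> - \<xi>))\<^sup>2 + \<epsilon>\<^sup>2) has_real_derivative 2 * inner (d - 0) (w \<tau> - \<xi>) + 0) (at \<tau>)"
      by (intro DERIV_add has_real_derivative_norm_diff_sq d) auto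
    from DERIV_chain2[OF DERIV_real_sqrt[OF pos] this]
    have "(f has_real_derivative inner d (w \<tau> - \<xi>) / f \<tau>) (at \<tau>)"
      by (simp add: f_def[abs_def] field_simps)
    moreover have "inner d (w \<tau> - \<xi>) / f \<tau> \<le> norm \<eta>"
    proof -
      have "inner d (w \<tau> - \<xi>) \<le> inner \<eta> (w \<tau> - \<xi>)"
        using dissipativeD[OF M d(1) \<eta>] by (simp add: inner_diff_left)
      also have "\<dots> \<le> norm \<eta> * norm (w \<tau> - \<xi>)" by (rule norm_cauchy_schwarz)
      also have "\<dots> \<le> norm \<eta> * f \<tau>" unfolding f_norm by (intro mult_left_mono norm_fst_le) auto
      finally show ?thesis using pos by (simp add: f_def pos_divide_le_eq)
    qed
    ultimately show "\<exists>D\<le>norm \<eta>. (f has_real_derivative D) (at \<tau>)" by blast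
  qed
  moreover have "norm (w t - \<xi>) \<le> f t" unfolding f_norm by (rule norm_fst_le)
  moreover have "f s \<le> norm (w s - \<xi>) + \<epsilon>" unfolding f_norm using norm_Pair_le[of "w s - \<xi>" \<epsilon>] \<epsilon> by simp
  ultimately show "norm (w t - \<xi>) \<le> norm (w s - \<xi>) + norm \<eta> * (t - s) + \<epsilon>" by linarith
qed

lemma strong_flow_trajectory:
  fixes w :: "real \<Rightarrow> 'h::real_inner"
  assumes M: "dissipative M" and w: "strong_flow M w"
  shows "\<exists>L. trajectory M L w"
proof -
  obtain d0 where d0: "d0 \<in> M (w 0)" using w unfolding strong_flow_def mdom_def by fastforce
  define L where "L = norm d0"
  have contr: "norm (w (s + h) - w (t + h)) \<le> norm (w s - w t)" if "0 \<le> s" "0 \<le> t" "0 \<le> h" for s t h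
    using strong_flow_contraction[OF M w w] that by blast
  have Lip_le: "norm (w t - w s) \<le> L * (t - s)" if "0 \<le> s" "s \<le> t" for s t
  proof -
    have "norm (w (t - s + s) - w (0 + s)) \<le> norm (w (t - s) - w 0)" using that by (intro contr) auto
    also have "\<dots> \<le> norm (w 0 - w 0) + norm d0 * (t - s - 0)"
      using that by (intro strong_flow_dist_growth[OF M w d0]) auto
    finally show ?thesis by (simp add: L_def)
  qed
  have Lip: "norm (w s - w t) \<le> L * \<bar>s - t\<bar>" if "0 \<le> s" "0 \<le> t" for s t
    using Lip_le[of s t] Lip_le[of t s] that by (cases "s \<le> t") (auto simp: norm_minus_commute)
  have first_order: "(norm (w t - \<xi>))\<^sup>2 / 2 - (norm (w s - \<xi>))\<^sup>2 / 2
      \<le> (inner \<eta> (w s - \<xi>) + norm \<eta> * L * (t - s)) * (t - s)"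
    if \<eta>: "\<eta> \<in> M \<xi>" and st: "0 \<le> s" "s \<le> t" for \<xi> \<eta> s t
  proof -
    obtain E where E: "negligible E"
      "\<And>t. t > 0 \<Longrightarrow> t \<notin> E \<Longrightarrow> \<exists>d \<in> M (w t). (w has_vector_derivative d) (at t)"
      using strong_flow_negligible[OF w] by blast
    have ac: "abs_cont w" using w by (simp add: strong_flow_def)
    have cont: "continuous_on {s..t} w"
      using abs_cont_continuous_on[OF ac] by (rule continuous_on_subset) (use st in auto)
    let ?k = "2 * (inner \<eta> (w s - \<xi>) + norm \<eta> * L * (t - s))"
    have "(norm (w t - \<xi>))\<^sup>2 - (norm (w s - \<xi>))\<^sup>2 \<le> ?k * (t - s)"
    proof (rule increment_le_ae[OF st, where E = "insert 0 E"])
      show "continuous_on {s..t} (\<lambda>\<tau>. (norm (w \<tau> - \<xi>))\<^sup>2)" by (intro continuous_intros cont)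
      show ngl: "negligible (insert 0 E)" using E by simp
      show "null_controlled (\<lambda>\<tau>. (norm (w \<tau> - \<xi>))\<^sup>2) s t (insert 0 E)"
        by (intro null_controlled_norm_diff_sq abs_cont_null_controlled ac abs_cont_const ngl st cont continuous_on_const)
      fix \<tau> assume \<tau>: "\<tau> \<in> {s..<t} - insert 0 E"
      then obtain d where d: "d \<in> M (w \<tau>)" "(w has_vector_derivative d) (at \<tau>)" using E(2)[of \<tau>] st by auto
      have "((\<lambda>\<tau>. (norm (w \<tau> - \<xi>))\<^sup>2) has_real_derivative 2 * inner (d - 0) (w \<tau> - \<xi>)) (at \<tau>)"
        by (intro has_real_derivative_norm_diff_sq d) auto
      moreover have "inner d (w \<tau> - \<xi>) \<le> inner \<eta> (w s - \<xi>) + norm \<eta> * L * (t - s)"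
      proof -
        have "inner d (w \<tau> - \<xi>) \<le> inner \<eta> (w \<tau> - \<xi>)"
          using dissipativeD[OF M d(1) \<eta>] by (simp add: inner_diff_left)
        also have "\<dots> = inner \<eta> (w s - \<xi>) + inner \<eta> (w \<tau> - w s)" by (simp add: inner_diff_right)
        also have "inner \<eta> (w \<tau> - w s) \<le> norm \<eta> * norm (w \<tau> - w s)" by (rule norm_cauchy_schwarz)
        also have "norm \<eta> * norm (w \<tau> - w s) \<le> norm \<eta> * (L * (t - s))"
        proof (rule mult_left_mono)
          have "norm (w \<tau> - w s) \<le> L * (\<tau> - s)" using \<tau> st by (intro Lip_le) auto
          also have "\<dots> \<le> L * (t - s)" using \<tau> by (intro mult_left_mono) (auto simp: L_def)
          finally show "norm (w \<tau> - w s) \<le> L * (t - s)" .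
        qed simp
        finally show ?thesis by simp
      qed
      ultimately show "\<exists>D\<le>?k. ((\<lambda>\<tau>. (norm (w \<tau> - \<xi>))\<^sup>2) has_real_derivative D) (at \<tau>)"
        by (intro exI[of _ "2 * inner (d - 0) (w \<tau> - \<xi>)"]) auto
    qed
    then show ?thesis by (simp add: field_simps)
  qed
  show ?thesis
  proof
    show "trajectory M L w"
      unfolding trajectory_def
      by (intro conjI allI impI ballI Lip contr first_order strong_flow_dist_growth[OF M w])
  qed
qed

section \<open>Regularity of trajectories\<close>

lemma trajectory_quotient:
  fixes w :: "real \<Rightarrow> 'h::real_inner"
  assumes w: "trajectory M L w" and \<eta>: "\<eta> \<in> M \<xi>" and t: "0 \<le> t" "0 \<le> t + h" "h \<noteq> 0"
  shows "inner ((1 / h) *\<^sub>R (w (t + h) - w t) - \<eta>) (w t - \<xi>) \<le> (2 * norm \<eta> * L + L * L) * \<bar>h\<bar>"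
proof -
  define q where "q = (1 / h) *\<^sub>R (w (t + h) - w t)"
  have Lip: "norm (w (t + h) - w t) \<le> L * \<bar>h\<bar>" using trajectoryD(1)[OF w, of "t + h" t] t by simp
  have "0 \<le> L * \<bar>h\<bar>" using Lip norm_ge_zero order_trans by blast
  then have L: "0 \<le> L" using t(3) by (simp add: zero_le_mult_iff)
  have sq: "inner (y - x) (x - \<xi>) \<le> (norm (y - \<xi>))\<^sup>2 / 2 - (norm (x - \<xi>))\<^sup>2 / 2" for x y
  proof -
    have "(norm (y - \<xi>))\<^sup>2 - (norm (x - \<xi>))\<^sup>2 = (norm (y - x))\<^sup>2 + 2 * inner (y - x) (x - \<xi>)"
      by (simp add: power2_norm_eq_inner inner_diff_left inner_diff_right inner_commute)
    then show ?thesis using zero_le_power2[of "norm (y - x)"] by linarith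
  qed
  have q_norm: "norm q \<le> L"
    using Lip t(3) by (simp add: q_def divide_le_eq)
  show ?thesis
  proof (cases "0 < h")
    case True
    have "h * inner q (w t - \<xi>) = inner (w (t + h) - w t) (w t - \<xi>)" using True by (simp add: q_def)
    also have "\<dots> \<le> (inner \<eta> (w t - \<xi>) + norm \<eta> * L * (t + h - t)) * (t + h - t)"
      by (rule order_trans[OF sq trajectoryD(4)[OF w \<eta>]]) (use t True in auto)
    finally have "h * inner q (w t - \<xi>) \<le> h * (inner \<eta> (w t - \<xi>) + norm \<eta> * L * h)" by (simp add: mult.commute)
    then have "inner q (w t - \<xi>) \<le> inner \<eta> (w t - \<xi>) + norm \<eta> * L * h" using True by simp
    moreover have "0 \<le> (norm \<eta> * L + L * L) * h" using L True by simp
    ultimately show ?thesis using True unfolding q_def[symmetric] by (simp add: inner_diff_left algebra_simps)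
  next
    case False
    then have h: "h < 0" using t(3) by simp
    define s where "s = t + h"
    have "- h * inner q (w s - \<xi>) = inner (w t - w s) (w s - \<xi>)"
      using h by (simp add: q_def s_def inner_diff_left)
    also have "\<dots> \<le> (inner \<eta> (w s - \<xi>) + norm \<eta> * L * (t - s)) * (t - s)"
      by (rule order_trans[OF sq trajectoryD(4)[OF w \<eta>]]) (use t h in \<open>auto simp: s_def\<close>)
    finally have "- h * inner q (w s - \<xi>) \<le> - h * (inner \<eta> (w s - \<xi>) + norm \<eta> * L * - h)"
      by (simp add: s_def mult.commute)
    then have "inner q (w s - \<xi>) \<le> inner \<eta> (w s - \<xi>) + norm \<eta> * L * - h"
      using h by (subst (asm) mult_le_cancel_left_pos) auto
    moreover have "inner (q - \<eta>) (w t - w s) \<le> (L + norm \<eta>) * (L * \<bar>h\<bar>)"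
    proof -
      have "inner (q - \<eta>) (w t - w s) \<le> norm (q - \<eta>) * norm (w t - w s)" by (rule norm_cauchy_schwarz)
      also have "\<dots> \<le> (L + norm \<eta>) * (L * \<bar>h\<bar>)"
        using Lip q_norm norm_triangle_ineq4[of q \<eta>] L
        by (intro mult_mono) (auto simp: s_def norm_minus_commute)
      finally show ?thesis .
    qed
    moreover have "inner (q - \<eta>) (w t - \<xi>) = inner q (w s - \<xi>) - inner \<eta> (w s - \<xi>) + inner (q - \<eta>) (w t - w s)"
      by (simp add: inner_diff_left inner_diff_right)
    ultimately show ?thesis using h unfolding q_def[symmetric] by (simp add: algebra_simps)
  qed
qed

lemma trajectory_asymptotic_value:
  fixes w :: "real \<Rightarrow> 'h::real_inner"
  assumes w: "trajectory M L w" and t: "0 \<le> t" "\<And>n. 0 \<le> t + h n" "\<And>n. h n \<noteq> 0" "h \<longlonglongrightarrow> 0"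
  shows "asymptotic_value M (w t) (\<lambda>n. (1 / h n) *\<^sub>R (w (t + h n) - w t))"
  unfolding asymptotic_value_def
proof (intro allI impI)
  fix \<xi> \<eta> and \<epsilon> :: real assume \<eta>: "\<eta> \<in> M \<xi>" and "0 < \<epsilon>"
  have "(\<lambda>n. (2 * norm \<eta> * L + L * L) * \<bar>h n\<bar>) \<longlonglongrightarrow> (2 * norm \<eta> * L + L * L) * \<bar>0\<bar>"
    by (intro tendsto_intros t)
  then have "\<forall>\<^sub>F n in sequentially. (2 * norm \<eta> * L + L * L) * \<bar>h n\<bar> < \<epsilon>"
    using \<open>0 < \<epsilon>\<close> by (intro order_tendstoD(2)) auto
  then show "\<forall>\<^sub>F n in sequentially. inner ((1 / h n) *\<^sub>R (w (t + h n) - w t) - \<eta>) (w t - \<xi>) \<le> \<epsilon>"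
  proof eventually_elim
    case (elim n)
    then show ?case using trajectory_quotient[OF w \<eta> t(1,2,3), of n] by simp
  qed
qed

lemma trajectory_value:
  fixes w :: "real \<Rightarrow> 'h::{real_inner, complete_space}"
  assumes M: "maximal_dissipative M" and w: "trajectory M L w" and t: "0 \<le> t"
    and R: "\<And>h. 0 < h \<Longrightarrow> norm (w (t + h) - w t) \<le> R * h"
  shows "\<exists>\<zeta>\<in>M (w t). norm \<zeta> \<le> R"
proof -
  define q where "q n = (1 / (1 / real (Suc n))) *\<^sub>R (w (t + 1 / real (Suc n)) - w t)" for n
  have "asymptotic_value M (w t) q"
    unfolding q_def[abs_def] using t by (intro trajectory_asymptotic_value[OF w] LIMSEQ_Suc[OF lim_1_over_n]) auto
  moreover have q: "norm (q n) \<le> R" for n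
  proof -
    have "real (Suc n) * norm (w (t + 1 / real (Suc n)) - w t) \<le> real (Suc n) * (R * (1 / real (Suc n)))"
      by (intro mult_left_mono R) auto
    then show ?thesis by (simp add: q_def del: of_nat_Suc)
  qed
  ultimately obtain \<zeta> where \<zeta>: "\<zeta> \<in> M (w t)"
    "\<And>a c. (\<forall>\<^sub>F n in sequentially. inner a (q n) \<le> c) \<Longrightarrow> inner a \<zeta> \<le> c"
    using asymptotic_value_cluster[OF M] by meson
  then show ?thesis using weak_cluster_norm_le[of q \<zeta> "\<lambda>_. R" R] q by auto
qed

lemma has_vector_derivative_quotient:
  fixes w :: "real \<Rightarrow> 'h::real_normed_vector"
  assumes "((\<lambda>h. (1 / h) *\<^sub>R (w (t + h) - w t)) \<longlongrightarrow> d) (at 0)"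
  shows "(w has_vector_derivative d) (at t)"
proof -
  have "((\<lambda>h. norm ((1 / h) *\<^sub>R (w (t + h) - w t) - d)) \<longlongrightarrow> 0) (at 0)"
    using assms by (simp add: LIM_zero tendsto_norm_zero)
  moreover have "\<forall>\<^sub>F h in at 0. norm ((1 / h) *\<^sub>R (w (t + h) - w t) - d) = norm (w (t + h) - w t - h *\<^sub>R d) / norm h"
  proof (rule eventually_at_topological[THEN iffD2], intro exI[of _ UNIV] conjI ballI impI)
    fix h :: real assume "h \<noteq> 0"
    then have "(1 / h) *\<^sub>R (w (t + h) - w t) - d = (1 / h) *\<^sub>R (w (t + h) - w t - h *\<^sub>R d)"
      by (simp add: scaleR_diff_right)
    then show "norm ((1 / h) *\<^sub>R (w (t + h) - w t) - d) = norm (w (t + h) - w t - h *\<^sub>R d) / norm h"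
      by (simp add: divide_inverse mult.commute)
  qed auto
  ultimately have "((\<lambda>h. norm (w (t + h) - w t - h *\<^sub>R d) / norm h) \<longlongrightarrow> 0) (at 0)"
    by (rule Lim_transform_eventually)
  then show ?thesis
    unfolding has_vector_derivative_def has_derivative_at by (simp add: bounded_linear_scaleR_left)
qed

text \<open>Komura's theorem for limits of strong solutions. Let \<open>v t\<close> be the element of minimal norm of
  \<open>M (w t)\<close>. Its norm is the Lipschitz constant of \<open>w\<close> on \<open>[t, \<infinity>)\<close>, hence decreasing in \<open>t\<close> and
  continuous off a countable set; where it is continuous, the difference quotients from both sides
  have no norm left to lose in the limit and converge strongly to \<open>v t\<close>.\<close>

lemma trajectory_differentiable:
  fixes w :: "real \<Rightarrow> 'h::{real_inner, complete_space}"
  assumes M: "maximal_dissipative M" and w: "trajectory M L w"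
  shows "\<forall>t\<ge>0. w t \<in> mdom M"
    and "\<exists>N. countable N \<and> (\<forall>t>0. t \<notin> N \<longrightarrow> (\<exists>d\<in>M (w t). (w has_vector_derivative d) (at t)))"
proof -
  note contr = trajectoryD(2)[OF w]
  have ne: "M (w t) \<noteq> {}" if "0 \<le> t" for t
  proof -
    have "norm (w (t + h) - w t) \<le> L * h" if "0 < h" for h
      using trajectoryD(1)[OF w, of "t + h" t] \<open>0 \<le> t\<close> that by simp
    then show ?thesis using trajectory_value[OF M w that] by blast
  qed
  then show "\<forall>t\<ge>0. w t \<in> mdom M" by (simp add: mdom_def)
  have "\<exists>v. 0 \<le> t \<longrightarrow> v \<in> M (w t) \<and> (\<forall>y\<in>M (w t). norm v \<le> norm y)" for t
    using ex_minimal_norm[OF maximal_dissipative_values[OF M] ne] by blast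
  then obtain v where v: "\<And>t. 0 \<le> t \<Longrightarrow> v t \<in> M (w t)"
    and v_min: "\<And>t y. 0 \<le> t \<Longrightarrow> y \<in> M (w t) \<Longrightarrow> norm (v t) \<le> norm y" by metis
  have speed: "norm (w (s + h) - w s) \<le> norm (v t) * h" if "0 \<le> t" "t \<le> s" "0 \<le> h" for s t h
  proof -
    have "norm (w ((t + h) + (s - t)) - w (t + (s - t))) \<le> norm (w (t + h) - w t)"
      using that by (intro contr) auto
    also have "\<dots> \<le> norm (w t - w t) + norm (v t) * (t + h - t)"
      using that by (intro trajectoryD(3)[OF w v]) auto
    finally show ?thesis using that by (simp add: algebra_simps)
  qed
  have v_dec: "norm (v s) \<le> norm (v t)" if "0 \<le> t" "t \<le> s" for s t
  proof -
    have "\<exists>\<zeta>\<in>M (w s). norm \<zeta> \<le> norm (v t)"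
      using that by (intro trajectory_value[OF M w] speed) auto
    then obtain \<zeta> where "\<zeta> \<in> M (w s)" "norm \<zeta> \<le> norm (v t)" by blast
    then show ?thesis using v_min[of s \<zeta>] that by auto
  qed
  define m where "m t = - norm (v (max 0 t))" for t
  have "mono m" unfolding m_def by (intro monoI) (auto intro!: v_dec)
  define N where "N = {t. \<not> isCont m t}"
  have "countable N" unfolding N_def by (rule mono_ctble_discont[OF \<open>mono m\<close>])
  moreover have "(w has_vector_derivative v t) (at t)" if t: "0 < t" "t \<notin> N" for t
  proof (rule has_vector_derivative_quotient)
    have m_cont: "isCont m t" using t by (simp add: N_def)
    have "((\<lambda>h. (1 / h) *\<^sub>R (w (t + h) - w t)) \<longlongrightarrow> v t) (at 0 within {- t<..})"
      unfolding tendsto_at_iff_sequentially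
    proof (intro allI impI)
      fix X assume X: "\<forall>i. X i \<in> {- t<..} - {0}" "X \<longlonglongrightarrow> (0::real)"
      define b where "b i = max (norm (v t)) (norm (v (t + X i)))" for i
      have "(\<lambda>i. m (t + X i)) \<longlonglongrightarrow> m t"
        using isCont_tendsto_compose[OF m_cont] tendsto_add[OF tendsto_const X(2), of t] by simp
      moreover have "- m (t + X i) = norm (v (t + X i))" for i
        using X(1)[rule_format, of i] by (simp add: m_def max_absorb2)
      ultimately have "(\<lambda>i. norm (v (t + X i))) \<longlonglongrightarrow> norm (v t)"
        using tendsto_minus[of "\<lambda>i. m (t + X i)" "m t"] t(1) by (simp add: m_def)
      then have "b \<longlonglongrightarrow> max (norm (v t)) (norm (v t))"
        unfolding b_def[abs_def] by (intro tendsto_max tendsto_const)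
      then have b: "b \<longlonglongrightarrow> norm (v t)" by simp
      have pos: "0 \<le> t + X i" "X i \<noteq> 0" for i using X(1)[rule_format, of i] by auto
      have q: "norm ((1 / X i) *\<^sub>R (w (t + X i) - w t)) \<le> b i" for i
      proof (cases "0 < X i")
        case True
        then show ?thesis using speed[of t t "X i"] t(1) by (simp add: b_def le_max_iff_disj pos_divide_le_eq)
      next
        case False
        then have "X i < 0" using pos(2)[of i] by simp
        moreover have "norm (w (t + X i + - X i) - w (t + X i)) \<le> norm (v (t + X i)) * - X i"
          using pos(1)[of i] \<open>X i < 0\<close> by (intro speed) auto
        ultimately have "norm (w t - w (t + X i)) / - X i \<le> norm (v (t + X i))"
          by (subst pos_divide_le_eq) auto
        then show ?thesis
          using \<open>X i < 0\<close> by (simp add: b_def le_max_iff_disj norm_minus_commute)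
      qed
      have "(\<lambda>i. (1 / X i) *\<^sub>R (w (t + X i) - w t)) \<longlonglongrightarrow> v t"
        using t(1) pos X(2) v v_min
        by (intro asymptotic_value_tendsto[OF M trajectory_asymptotic_value[OF w] q b]) auto
      then show "((\<lambda>h. (1 / h) *\<^sub>R (w (t + h) - w t)) \<circ> X) \<longlonglongrightarrow> v t" by (simp add: o_def)
    qed
    moreover have "at 0 within {- t<..} = at 0" using t(1) by (intro at_within_open) auto
    ultimately show "((\<lambda>h. (1 / h) *\<^sub>R (w (t + h) - w t)) \<longlongrightarrow> v t) (at 0)" by simp
  qed
  ultimately show "\<exists>N. countable N \<and> (\<forall>t>0. t \<notin> N \<longrightarrow> (\<exists>d\<in>M (w t). (w has_vector_derivative d) (at t)))"
    using v by (meson less_imp_le)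
qed

section \<open>Limit trajectories of the closed loop are equilibria\<close>

lemma AE_off_countable:
  assumes "countable N" "\<And>t::real. t \<notin> N \<Longrightarrow> P t"
  shows "AE t in lebesgue. P t"
proof -
  have "AE t in lebesgue. t \<notin> N"
    using assms(1) by (intro AE_not_in null_sets_completionI countable_imp_null_set_lborel)
  then show ?thesis by eventually_elim (rule assms(2))
qed

lemma closed_loop_valueD:
  assumes "d \<in> closed_loop A g C K r p"
  shows "fst p \<in> C" "snd p \<in> K" "fst d \<in> A p" "r - g p - snd d \<in> normal_cone K (snd p)"
  using assms by (auto simp: closed_loop_def split: if_splits)

lemma equilibrium_closed_loop:
  assumes "steady_state_pair A C K p" "g p = r"
  shows "0 \<in> closed_loop A g C K r p"
  using assms by (auto simp: steady_state_pair_def closed_loop_def normal_cone_def zero_prod_def mem_Times_iff)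

lemma coupling_dissipativeD:
  assumes "dissipative (coupling A g)" "a \<in> A (x, z)" "b \<in> A (y, u)"
  shows "inner (a - b) (x - y) \<le> inner (g (x, z) - g (y, u)) (z - u)"
  using dissipativeD[OF assms(1), of "(a, - g (x, z))" "(x, z)" "(b, - g (y, u))" "(y, u)"] assms(2,3)
  by (simp add: coupling_def inner_diff_left)

text \<open>A velocity that points opposite to a normal of \<open>K\<close> vanishes if the point stays in \<open>K\<close>
  before and after: the normal functional is then maximal along the path.\<close>

lemma normal_velocity_zero:
  fixes z :: "real \<Rightarrow> 'b::real_inner"
  assumes z: "(z has_vector_derivative - n) (at t)" "n \<in> normal_cone K (z t)"
    and K: "0 < t" "\<And>s. 0 \<le> s \<Longrightarrow> z s \<in> K"
  shows "n = 0"
proof -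
  have "((\<lambda>s. inner n (z s)) has_vector_derivative inner n (- n)) (at t)"
    by (rule bounded_linear.has_vector_derivative[OF bounded_linear_inner_right z(1)])
  then have D: "((\<lambda>s. inner n (z s)) has_real_derivative - inner n n) (at t)"
    by (simp add: has_real_derivative_iff_has_vector_derivative)
  have "inner n (z s) \<le> inner n (z t)" if "\<bar>t - s\<bar> < t" for s
  proof -
    have "z s \<in> K" using that by (intro K) auto
    then have "0 \<le> inner n (z t - z s)" using z(2) by (auto simp: normal_cone_def split: if_splits)
    then show ?thesis by (simp add: inner_diff_right)
  qed
  then have "- inner n n = 0" using DERIV_local_max[OF D K(1)] by blast
  then show ?thesis by simp
qed

text \<open>LaSalle's argument. Constancy of the distance to \<open>(xs, us)\<close> makes both dissipative terms vanish,
  so that the passivity defect is zero and the output equals \<open>r\<close>; then \<open>z\<close> can only be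
  driven by the normal cone and stands still at some \<open>u\<close>. With \<open>u\<close> frozen, the distance of \<open>x\<close> to the
  steady state \<open>y\<close> for \<open>u\<close> decreases, hence is constant by recurrence; detectability gives \<open>x = y\<close>,
  and distinguishability \<open>y = xs\<close>.\<close>

lemma limit_trajectory_equilibrium:
  fixes A :: "('a::{real_inner, complete_space} \<times> 'b::{real_inner, complete_space}, 'a) multimap"
  assumes steady: "steady_state_behavior A C K"
    and coupling: "dissipative (coupling A g)"
    and distinguishability: "distinguishability A g C K"
    and passivity: "strictly_output_incrementally_passive A g"
    and detectability: "\<forall>p. steady_state_pair A C K p \<longrightarrow> h_detectable A g p"
    and M: "maximal_dissipative (closed_loop A g C K r)"
    and star: "steady_state_pair A C K (xs, us)" "g (xs, us) = r"
    and W: "trajectory (closed_loop A g C K r) L W"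
    and const: "\<And>t. 0 \<le> t \<Longrightarrow> norm (W t - (xs, us)) = \<delta>"
    and rec: "\<And>\<epsilon> T. 0 < \<epsilon> \<Longrightarrow> \<exists>s\<ge>T. norm (W s - W 0) < \<epsilon>"
  shows "W 0 = (xs, us)"
proof -
  define x z where "x t = fst (W t)" and "z t = snd (W t)" for t
  have W_eq: "W t = (x t, z t)" for t by (simp add: x_def z_def)
  have dom: "W t \<in> mdom (closed_loop A g C K r)" if "0 \<le> t" for t
    using trajectory_differentiable(1)[OF M W] that by blast
  obtain N where N: "countable N"
    "\<And>t. 0 < t \<Longrightarrow> t \<notin> N \<Longrightarrow> \<exists>d\<in>closed_loop A g C K r (W t). (W has_vector_derivative d) (at t)"
    using trajectory_differentiable(2)[OF M W] by blast
  have der: "\<exists>a n. a \<in> A (x t, z t) \<and> n \<in> normal_cone K (z t) \<and> (x has_vector_derivative a) (at t) \<and>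
      (z has_vector_derivative r - g (x t, z t) - n) (at t)" if t: "0 < t" "t \<notin> N" for t
  proof -
    obtain d where d: "d \<in> closed_loop A g C K r (W t)" "(W has_vector_derivative d) (at t)"
      using N(2)[OF t] by blast
    have "(x has_vector_derivative fst d) (at t)" "(z has_vector_derivative snd d) (at t)"
      unfolding x_def[abs_def] z_def[abs_def]
      using bounded_linear.has_vector_derivative[OF bounded_linear_fst d(2)]
        bounded_linear.has_vector_derivative[OF bounded_linear_snd d(2)] by auto
    then show ?thesis
      using closed_loop_valueD[OF d(1)]
      by (intro exI[of _ "fst d"] exI[of _ "r - g (x t, z t) - snd d"]) (simp add: W_eq)
  qed
  have in_K: "z t \<in> K" and in_C: "x t \<in> C" and A_ne: "x t \<in> mdom (\<lambda>\<xi>. A (\<xi>, z t))" if "0 \<le> t" for t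
    using dom[OF that] by (auto simp: mdom_closed_loop W_eq)
  have Lip: "norm (x s - x t) \<le> L * \<bar>s - t\<bar>" "norm (z s - z t) \<le> L * \<bar>s - t\<bar>" if "0 \<le> s" "0 \<le> t" for s t
    using trajectoryD(1)[OF W that] norm_fst_le[of "x s - x t" "z s - z t"]
      norm_snd_le[of "z s - z t" "x s - x t"] by (auto simp: W_eq)
  have ac: "abs_cont x" "abs_cont z"
    using Lip N(1) der by (auto intro!: Lipschitz_imp_abs_cont[of _ L N]; meson)+
  have sol: "strong_solution A z x"
    unfolding strong_solution_def
  proof (intro conjI ac allI impI A_ne AE_off_countable[OF N(1)])
    show "\<exists>d\<in>A (x t, z t). (x has_vector_derivative d) (at t)" if "t \<notin> N" "0 < t" for t
      using der[OF that(2,1)] by blast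
  qed
  have const_sol: "strong_solution A (\<lambda>_. u) (\<lambda>_. y)" if "steady_state_pair A C K (y, u)" for u y
    using that unfolding strong_solution_def steady_state_pair_def
    by (auto simp: abs_cont_const mdom_def intro!: always_eventually bexI[of _ 0])
  have defect: "passivity_defect g x z (\<lambda>_. xs) (\<lambda>_. us) t = 0" if t: "0 < t" "t \<notin> N" for t
  proof -
    obtain a n where a: "a \<in> A (x t, z t)" "(x has_vector_derivative a) (at t)"
      and n: "n \<in> normal_cone K (z t)" "(z has_vector_derivative r - g (x t, z t) - n) (at t)"
      using der[OF t] by blast
    let ?e = "r - g (x t, z t) - n"
    have Dx: "((\<lambda>s. (norm (x s - xs))\<^sup>2) has_real_derivative 2 * inner (a - 0) (x t - xs)) (at t)"
      by (intro has_real_derivative_norm_diff_sq a) auto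
    have Dz: "((\<lambda>s. (norm (z s - us))\<^sup>2) has_real_derivative 2 * inner (?e - 0) (z t - us)) (at t)"
      by (intro has_real_derivative_norm_diff_sq n) auto
    have "((\<lambda>s. (norm (x s - xs))\<^sup>2 + (norm (z s - us))\<^sup>2) has_real_derivative 0) (at t)"
    proof (rule has_field_derivative_transform_within_open[of "\<lambda>_. \<delta>\<^sup>2" _ _ "{0<..}"])
      fix s :: real assume "s \<in> {0<..}"
      then have "norm (x s - xs, z s - us) = \<delta>" using const[of s] by (simp add: W_eq)
      then have "\<delta>\<^sup>2 = (norm (x s - xs, z s - us))\<^sup>2" by simp
      then show "\<delta>\<^sup>2 = (norm (x s - xs))\<^sup>2 + (norm (z s - us))\<^sup>2" by (simp add: norm_Pair)
    qed (use t in auto)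
    then have "2 * inner (a - 0) (x t - xs) + 2 * inner (?e - 0) (z t - us) = 0"
      using DERIV_unique[OF DERIV_add[OF Dx Dz]] by blast
    then have sum: "inner a (x t - xs) = - inner ?e (z t - us)" by simp
    have "passivity_defect g x z (\<lambda>_. xs) (\<lambda>_. us) t
        = inner (g (x t, z t) - r) (z t - us) - inner a (x t - xs)"
      using DERIV_imp_deriv[OF Dx] star(2) by (simp add: passivity_defect_def inner_commute)
    moreover have "inner a (x t - xs) \<le> inner (g (x t, z t) - r) (z t - us)"
      using coupling_dissipativeD[OF coupling a(1), of 0 xs us] star by (simp add: steady_state_pair_def)
    moreover have "0 \<le> inner n (z t - us)"
      using n(1) star(1) by (auto simp: normal_cone_def steady_state_pair_def split: if_splits)
    ultimately show ?thesis unfolding sum by (simp add: inner_diff_left)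
  qed
  have "AE t in lebesgue. t > 0 \<longrightarrow> passivity_defect g x z (\<lambda>_. xs) (\<lambda>_. us) t = 0"
    by (rule AE_off_countable[OF N(1)]) (use defect in blast)
  then have "AE t in lebesgue. t > 0 \<longrightarrow> g (x t, z t) = g (xs, us)"
    using passivity sol const_sol[OF star(1)] unfolding strictly_output_incrementally_passive_def by blast
  then obtain E where E: "negligible E" "\<And>t. t \<notin> E \<Longrightarrow> 0 < t \<Longrightarrow> g (x t, z t) = r"
    using AE_lebesgue_negligible star(2) by (metis (mono_tags, lifting))
  have N_null: "negligible N"
    unfolding negligible_iff_null_sets
    using N(1) by (intro null_sets_completionI countable_imp_null_set_lborel)
  define Z where "Z = insert 0 (N \<union> E)"
  have Z: "negligible Z" unfolding Z_def using N_null E(1) by simp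
  have cont: "continuous_on {0..b} x" "continuous_on {0..b} z" for b
    using ac by (auto intro: continuous_on_subset[OF abs_cont_continuous_on])
  define u where "u = z 0"
  have z_const: "z t = u" if "0 \<le> t" for t
  proof -
    have "norm (z t - u) \<le> norm (z 0 - u)"
    proof (rule norm_diff_nonincreasing[OF that cont(2) continuous_on_const, where E = Z])
      fix s assume "s \<in> {0..<t} - Z"
      then have s: "0 < s" "s \<notin> N" "s \<notin> E" by (auto simp: Z_def)
      obtain n where n: "n \<in> normal_cone K (z s)" "(z has_vector_derivative r - g (x s, z s) - n) (at s)"
        using der[OF s(1,2)] by blast
      have dz: "(z has_vector_derivative - n) (at s)" using n(2) E(2)[OF s(3,1)] by simp
      have "n = 0" by (rule normal_velocity_zero[OF dz n(1) s(1) in_K])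
      then show "\<exists>d e. (z has_vector_derivative d) (at s) \<and>
          ((\<lambda>t. u) has_vector_derivative e) (at s) \<and> inner (d - e) (z s - u) \<le> 0"
        using dz by (intro exI[of _ 0]) auto
    qed (auto intro: abs_cont_null_controlled ac abs_cont_const Z)
    then show ?thesis by (simp add: u_def)
  qed
  have "u \<in> K" using in_K[of 0] by (simp add: u_def)
  then obtain y where y: "y \<in> C" "0 \<in> A (y, u)"
    using steady unfolding steady_state_behavior_def by blast
  have pair: "steady_state_pair A C K (y, u)" using y \<open>u \<in> K\<close> by (simp add: steady_state_pair_def)
  have dec: "norm (x t - y) \<le> norm (x s - y)" if "0 \<le> s" "s \<le> t" for s t
  proof (rule norm_diff_nonincreasing[OF that(2) _ continuous_on_const, where E = Z])
    show "continuous_on {s..t} x" using cont(1)[of t] by (rule continuous_on_subset) (use that in auto)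
    fix \<tau> assume \<tau>': "\<tau> \<in> {s..<t} - Z"
    then have \<tau>: "0 < \<tau>" "\<tau> \<notin> N" using that by (auto simp: Z_def less_le)
    obtain a where a: "a \<in> A (x \<tau>, u)" "(x has_vector_derivative a) (at \<tau>)"
      using der[OF \<tau>] z_const[of \<tau>] \<tau>(1) by auto
    have "inner (a - 0) (x \<tau> - y) \<le> 0" using coupling_dissipativeD[OF coupling a(1) y(2)] by simp
    then show "\<exists>d e. (x has_vector_derivative d) (at \<tau>) \<and>
        ((\<lambda>t. y) has_vector_derivative e) (at \<tau>) \<and> inner (d - e) (x \<tau> - y) \<le> 0"
      using a(2) by (intro exI[of _ a] exI[of _ 0]) auto
  qed (use that in \<open>auto intro: abs_cont_null_controlled ac abs_cont_const Z\<close>)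
  have x_dist: "norm (x t - y) = norm (x 0 - y)" if "0 \<le> t" for t
  proof (rule antisym)
    show "norm (x t - y) \<le> norm (x 0 - y)" using that by (intro dec) auto
    show "norm (x 0 - y) \<le> norm (x t - y)"
    proof (rule field_le_epsilon)
      fix \<epsilon> :: real assume "0 < \<epsilon>"
      then obtain s where s: "t \<le> s" "norm (W s - W 0) < \<epsilon>" using rec by blast
      have "norm (x s - x 0) \<le> norm (W s - W 0)"
        using norm_fst_le[of "x s - x 0" "z s - z 0"] by (simp add: W_eq)
      moreover have "norm (x s - y) \<le> norm (x t - y)" using that s by (intro dec) auto
      moreover have "norm (x 0 - y) \<le> norm (x s - x 0) + norm (x s - y)"
        using norm_triangle_ineq4[of "x s - y" "x s - x 0"] by simp
      ultimately show "norm (x 0 - y) \<le> norm (x t - y) + \<epsilon>" using s(2) by linarith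
    qed
  qed
  have "strong_solution A (\<lambda>_. u) x"
    unfolding strong_solution_def
  proof (intro conjI ac abs_cont_const allI impI AE_off_countable[OF N(1)])
    show "x t \<in> mdom (\<lambda>\<xi>. A (\<xi>, u))" if "0 \<le> t" for t using A_ne[OF that] z_const[OF that] by simp
    show "\<exists>d\<in>A (x t, u). (x has_vector_derivative d) (at t)" if "t \<notin> N" "0 < t" for t
      using der[OF that(2,1)] z_const[of t] that by auto
  qed
  moreover have "passivity_defect g x (\<lambda>_. u) (\<lambda>_. y) (\<lambda>_. u) t = 0" if "0 < t" for t
  proof -
    have "((\<lambda>s. (norm (x s - y))\<^sup>2) has_real_derivative 0) (at t)"
    proof (rule has_field_derivative_transform_within_open[of "\<lambda>_. (norm (x 0 - y))\<^sup>2" _ _ "{0<..}"])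
      fix s :: real assume "s \<in> {0<..}"
      then have "norm (x s - y) = norm (x 0 - y)" by (intro x_dist) simp
      then show "(norm (x 0 - y))\<^sup>2 = (norm (x s - y))\<^sup>2" by simp
    qed (use that in auto)
    then show ?thesis by (simp add: passivity_defect_def DERIV_imp_deriv)
  qed
  then have "AE t in lebesgue. t > 0 \<longrightarrow> passivity_defect g x (\<lambda>_. u) (\<lambda>_. y) (\<lambda>_. u) t = 0" by simp
  ultimately have xy: "x t = y" if "0 \<le> t" for t
    using detectability pair that unfolding h_detectable_def by fastforce
  have "\<not> negligible {0<..<1::real}" by (intro open_not_negligible) auto
  then obtain t where t: "0 < t" "t \<notin> E" using E(1) negligible_subset[of E "{0<..<1}"] by fastforce
  have "g (y, u) = r" using E(2)[OF t(2,1)] xy[of t] z_const[of t] t(1) by simp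
  then have "inner (u - us) (g (y, u) - g (xs, us)) = 0" using star(2) by simp
  then have "y = xs" using distinguishability pair star(1) unfolding distinguishability_def by blast
  moreover have "u = us"
  proof -
    have "\<forall>x\<in>C. \<forall>u\<in>K. \<forall>u'\<in>K. 0 \<in> A (x, u) \<and> 0 \<in> A (x, u') \<longrightarrow> u = u'"
      using steady unfolding steady_state_behavior_def by (rule conjunct2)
    then show ?thesis
      using pair star(1) unfolding steady_state_pair_def \<open>y = xs\<close> mem_Sigma_iff by blast
  qed
  ultimately show ?thesis using xy[of 0] z_const[of 0] by (simp add: W_eq)
qed

section \<open>Convergence\<close>

lemma antimono_tendsto_at_top:
  fixes f :: "real \<Rightarrow> real"
  assumes dec: "\<And>s t. 0 \<le> s \<Longrightarrow> s \<le> t \<Longrightarrow> f t \<le> f s" and nonneg: "\<And>t. 0 \<le> f t"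
  shows "\<exists>l. (f \<longlongrightarrow> l) at_top"
proof -
  define l where "l = Inf (f ` {0..})"
  have bdd: "bdd_below (f ` {0..})" using nonneg by (intro bdd_belowI[of _ 0]) auto
  have l: "l \<le> f t" if "0 \<le> t" for t unfolding l_def using that bdd by (intro cINF_lower) auto
  have "(f \<longlongrightarrow> l) at_top"
  proof (rule tendstoI)
    fix e :: real assume "0 < e"
    then obtain T where T: "0 \<le> T" "f T < l + e"
      using cInf_less_iff[of "f ` {0..}" "l + e"] bdd by (auto simp: l_def)
    show "\<forall>\<^sub>F t in at_top. dist (f t) l < e"
      unfolding eventually_at_top_linorder
    proof (intro exI[of _ T] allI impI)
      fix t assume "T \<le> t"
      then have "f t \<le> f T" "l \<le> f t" using T(1) dec l by auto
      then show "dist (f t) l < e" using T(2) by (simp add: dist_real_def)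
    qed
  qed
  then show ?thesis by blast
qed

text \<open>Since \<open>w\<close> is Lipschitz, \<open>l *\<^sub>R x - x'\<close> stays bounded, so the compactness condition confines the
  first component to a compact set at all times where the derivative exists; the second component is
  bounded in a finite-dimensional space.\<close>

lemma closed_loop_precompact:
  fixes A :: "('a::{real_inner, complete_space} \<times> 'b::{real_inner, complete_space}, 'a) multimap"
  assumes compactness: "compactness_condition A"
    and w: "strong_flow (closed_loop A g C K r) w" and traj: "trajectory (closed_loop A g C K r) L w"
    and R: "\<And>t. 0 \<le> t \<Longrightarrow> norm (w t) \<le> R"
  shows "\<exists>c p. (\<forall>n. real n \<le> c n) \<and> (\<lambda>n. w (c n)) \<longlonglongrightarrow> p"
proof -
  obtain B :: "'b set" where B: "finite B" "span B = UNIV"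
    using compactness unfolding compactness_condition_def by blast
  obtain l where l: "0 < l" "\<And>F V. bounded F \<Longrightarrow> bounded V \<Longrightarrow>
      compact (closure {x. \<exists>f\<in>F. \<exists>u\<in>V. f \<in> {l *\<^sub>R x - a |a. a \<in> A (x, u)}})"
    using compactness unfolding compactness_condition_def by blast
  define S where "S = closure {x. \<exists>f\<in>cball 0 (l * R + L). \<exists>u\<in>cball 0 R. f \<in> {l *\<^sub>R x - a |a. a \<in> A (x, u)}}"
  have S: "compact S" unfolding S_def by (rule l(2)) auto
  obtain E where E: "negligible E"
    "\<And>t. t > 0 \<Longrightarrow> t \<notin> E \<Longrightarrow> \<exists>d \<in> closed_loop A g C K r (w t). (w has_vector_derivative d) (at t)"
    using strong_flow_negligible[OF w] by blast
  have in_S: "fst (w t) \<in> S" if t: "0 < t" "t \<notin> E" for t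
  proof -
    obtain d where d: "d \<in> closed_loop A g C K r (w t)" "(w has_vector_derivative d) (at t)"
      using E(2)[OF t] by blast
    have "norm d \<le> L" using Lipschitz_derivative_bound[OF trajectoryD(1)[OF traj] _ d(2)] t(1) by simp
    then have "norm (fst d) \<le> L" using norm_fst_le[of "fst d" "snd d"] by simp
    moreover have "norm (fst (w t)) \<le> R" "norm (snd (w t)) \<le> R"
      using R[of t] t(1) norm_fst_le[of "fst (w t)" "snd (w t)"] norm_snd_le[of "snd (w t)" "fst (w t)"] by auto
    moreover have "norm (l *\<^sub>R fst (w t) - fst d) \<le> l * norm (fst (w t)) + norm (fst d)"
      using norm_triangle_ineq4[of "l *\<^sub>R fst (w t)" "fst d"] l(1) by simp
    ultimately have "norm (l *\<^sub>R fst (w t) - fst d) \<le> l * R + L"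
      using l(1) by (smt (verit) mult_left_mono)
    moreover have "fst d \<in> A (fst (w t), snd (w t))" using closed_loop_valueD(3)[OF d(1)] by simp
    ultimately show ?thesis
      unfolding S_def using \<open>norm (snd (w t)) \<le> R\<close>
      by (intro subsetD[OF closure_subset] CollectI bexI[of _ "l *\<^sub>R fst (w t) - fst d"] bexI[of _ "snd (w t)"]) auto
  qed
  have "\<exists>t. real n < t \<and> t \<notin> E" for n
  proof -
    have "\<not> negligible {real n<..<real n + 1}" by (intro open_not_negligible) auto
    then have "\<not> {real n<..<real n + 1} \<subseteq> E" using E(1) negligible_subset by blast
    then show ?thesis by auto
  qed
  then obtain c where c: "\<And>n. real n < c n" "\<And>n. c n \<notin> E" by metis
  have c_pos: "0 < c n" for n using c(1)[of n] by (meson le_less_trans of_nat_0_le_iff)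
  obtain a s where s: "strict_mono s" "(\<lambda>n. fst (w (c (s n)))) \<longlonglongrightarrow> a"
  proof -
    have "\<forall>n. fst (w (c n)) \<in> S" using in_S c_pos c(2) by blast
    then obtain a s where "strict_mono s" "((\<lambda>n. fst (w (c n))) \<circ> s) \<longlonglongrightarrow> a"
      using spec[OF S[unfolded compact_def], of "\<lambda>n. fst (w (c n))"] by blast
    then show thesis using that by (simp add: o_def)
  qed
  have "norm (snd (w (c (s n)))) \<le> R" for n
    using R[of "c (s n)"] c_pos[of "s n"] norm_snd_le[of "snd (w (c (s n)))" "fst (w (c (s n)))"] by simp
  then obtain q b where q: "strict_mono q" "(\<lambda>n. snd (w (c (s (q n))))) \<longlonglongrightarrow> b"
    using finite_dim_convergent_subseq[OF B, of "\<lambda>n. snd (w (c (s n)))" R] by blast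
  have "(\<lambda>n. (fst (w (c (s (q n)))), snd (w (c (s (q n)))))) \<longlonglongrightarrow> (a, b)"
    using LIMSEQ_subseq_LIMSEQ[OF s(2) q(1)] q(2) by (intro tendsto_Pair) (auto simp: o_def)
  then have "(\<lambda>n. w (c (s (q n)))) \<longlonglongrightarrow> (a, b)" by simp
  moreover have "real n \<le> c (s (q n))" for n
  proof -
    have "n \<le> s (q n)" using seq_suble[OF s(1)] seq_suble[OF q(1)] order_trans by blast
    then show ?thesis using c(1)[of "s (q n)"] by linarith
  qed
  ultimately show ?thesis by (intro exI[of _ "\<lambda>n. c (s (q n))"]) auto
qed

text \<open>Every sequence of translates \<open>w (c n + _)\<close> with \<open>w (c n) \<rightarrow> p\<close> converges uniformly, by the
  contraction property, to a trajectory through \<open>p\<close>. Its distance to any equilibrium is constant and it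
  returns arbitrarily close to \<open>p\<close> at arbitrarily late times.\<close>

lemma strong_flow_limit_trajectory:
  fixes w :: "real \<Rightarrow> 'h::{real_inner, complete_space}"
  assumes w: "trajectory M L w" and c: "\<And>n. real n \<le> c n" "(\<lambda>n. w (c n)) \<longlonglongrightarrow> p"
    and dist: "((\<lambda>t. norm (w t - q)) \<longlongrightarrow> \<delta>) at_top"
  shows "\<exists>W. trajectory M L W \<and> W 0 = p \<and> (\<forall>t\<ge>0. norm (W t - q) = \<delta>) \<and>
    (\<forall>\<epsilon>>0. \<forall>T. \<exists>s\<ge>T. norm (W s - W 0) < \<epsilon>)"
proof -
  note contr = trajectoryD(2)[OF w]
  have c_pos: "0 \<le> c n" for n using c(1)[of n] by (meson of_nat_0_le_iff order_trans)
  have "convergent (\<lambda>n. w (c n + s))" if "0 \<le> s" for s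
  proof -
    have "norm (w (c n + s) - w (c m + s)) \<le> norm (w (c n) - w (c m))" for m n
      using that by (intro contr c_pos)
    then have "Cauchy (\<lambda>n. w (c n + s))"
      using LIMSEQ_imp_Cauchy[OF c(2)] unfolding Cauchy_def dist_norm by (meson le_less_trans)
    then show ?thesis by (rule Cauchy_convergent)
  qed
  then obtain W where W: "\<And>s. 0 \<le> s \<Longrightarrow> (\<lambda>n. w (c n + s)) \<longlonglongrightarrow> W s"
    unfolding convergent_def by metis
  have W0: "W 0 = p" using LIMSEQ_unique[OF W[of 0]] c(2) by simp
  have c_top: "filterlim c at_top sequentially"
    by (rule filterlim_at_top_mono[OF filterlim_real_sequentially]) (simp add: c(1))
  have "norm (W t - q) = \<delta>" if "0 \<le> t" for t
  proof (rule LIMSEQ_unique)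
    show "(\<lambda>n. norm (w (c n + t) - q)) \<longlonglongrightarrow> norm (W t - q)" by (intro tendsto_intros W that)
    have "filterlim (\<lambda>n. c n + t) at_top sequentially"
      by (rule filterlim_at_top_mono[OF c_top]) (simp add: that)
    then show "(\<lambda>n. norm (w (c n + t) - q)) \<longlonglongrightarrow> \<delta>" by (rule filterlim_compose[OF dist])
  qed
  moreover have "\<exists>s\<ge>T. norm (W s - W 0) < \<epsilon>" if "0 < \<epsilon>" for \<epsilon> T
  proof -
    have "\<forall>\<^sub>F n in sequentially. norm (w (c n) - p) < \<epsilon>/2"
      using tendstoD[OF c(2), of "\<epsilon>/2"] \<open>0 < \<epsilon>\<close> by (simp add: dist_norm)
    then obtain n0 where n0: "\<And>n. n0 \<le> n \<Longrightarrow> norm (w (c n) - p) < \<epsilon>/2"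
      by (auto simp: eventually_sequentially)
    have "\<forall>\<^sub>F m in sequentially. c n0 + max 0 T \<le> c m"
      using c_top unfolding filterlim_at_top by blast
    then obtain m1 where "\<And>m. m1 \<le> m \<Longrightarrow> c n0 + max 0 T \<le> c m" by (auto simp: eventually_sequentially)
    then obtain m where m: "n0 \<le> m" "c n0 + max 0 T \<le> c m" by (metis max.cobounded1 max.cobounded2)
    define s where "s = c m - c n0"
    have s: "0 \<le> s" "T \<le> s" using m(2) by (auto simp: s_def)
    have "norm (W s - w (c n0 + s)) \<le> norm (p - w (c n0))"
    proof (rule LIMSEQ_le)
      show "(\<lambda>k. norm (w (c k + s) - w (c n0 + s))) \<longlonglongrightarrow> norm (W s - w (c n0 + s))"
        by (intro tendsto_intros W s)
      show "(\<lambda>k. norm (w (c k) - w (c n0))) \<longlonglongrightarrow> norm (p - w (c n0))" by (intro tendsto_intros c)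
    qed (use contr c_pos s in auto)
    also have "\<dots> < \<epsilon>/2" using n0[of n0] by (simp add: norm_minus_commute)
    finally have "norm (W s - w (c m)) < \<epsilon>/2" by (simp add: s_def)
    moreover have "norm (w (c m) - p) < \<epsilon>/2" using n0 m by blast
    ultimately have "norm (W s - p) < \<epsilon>"
      using norm_triangle_ineq[of "W s - w (c m)" "w (c m) - p"] by simp
    then show ?thesis using s W0 by auto
  qed
  ultimately show ?thesis using trajectory_limit[OF w c_pos W] W0 by blast
qed

lemma closed_loop_strong_solution_tendsto:
  fixes A :: "('a::{real_inner, complete_space} \<times> 'b::{real_inner, complete_space}, 'a) multimap"
  assumes steady: "steady_state_behavior A C K"
    and coupling: "dissipative (coupling A g)"
    and distinguishability: "distinguishability A g C K"
    and compactness: "compactness_condition A"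
    and passivity: "strictly_output_incrementally_passive A g"
    and detectability: "\<forall>p. steady_state_pair A C K p \<longrightarrow> h_detectable A g p"
    and M: "maximal_dissipative (closed_loop A g C K r)"
    and star: "steady_state_pair A C K (xs, us)" "g (xs, us) = r"
    and w: "strong_flow (closed_loop A g C K r) w"
  shows "(w \<longlongrightarrow> (xs, us)) at_top"
proof -
  let ?M = "closed_loop A g C K r"
  have diss: "dissipative ?M" using M by (simp add: maximal_dissipative_iff)
  obtain L where traj: "trajectory ?M L w" using strong_flow_trajectory[OF diss w] by blast
  have dec: "norm (w t - (xs, us)) \<le> norm (w s - (xs, us))" if "0 \<le> s" "s \<le> t" for s t
    using trajectoryD(3)[OF traj equilibrium_closed_loop[of A C K "(xs, us)" g r, OF star] that] by simp
  have "\<exists>\<delta>. ((\<lambda>t. norm (w t - (xs, us))) \<longlongrightarrow> \<delta>) at_top"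
    by (rule antimono_tendsto_at_top[OF dec norm_ge_zero])
  then obtain \<delta> where \<delta>: "((\<lambda>t. norm (w t - (xs, us))) \<longlongrightarrow> \<delta>) at_top" by (rule exE)
  have "norm (w t) \<le> norm (w 0 - (xs, us)) + norm (xs, us)" if "0 \<le> t" for t
    using dec[of 0 t] that norm_triangle_sub[of "w t" "(xs, us)"] by linarith
  then obtain c p where c: "\<And>n. real n \<le> c n" "(\<lambda>n. w (c n)) \<longlonglongrightarrow> p"
    using closed_loop_precompact[OF compactness w traj] by blast
  obtain W where W: "trajectory ?M L W" "W 0 = p" "\<And>t. 0 \<le> t \<Longrightarrow> norm (W t - (xs, us)) = \<delta>"
    "\<And>\<epsilon> T. 0 < \<epsilon> \<Longrightarrow> \<exists>s\<ge>T. norm (W s - W 0) < \<epsilon>"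
    using strong_flow_limit_trajectory[OF traj c \<delta>] by blast
  have "W 0 = (xs, us)"
    by (rule limit_trajectory_equilibrium[OF steady coupling distinguishability passivity detectability M star W(1,3,4)])
  then have "\<delta> = 0" using W(3)[of 0] by simp
  then show ?thesis using \<delta> by (simp add: LIM_zero_iff tendsto_norm_zero_iff)
qed

text \<open>Strong solutions are dense among generalized ones in the topology of uniform convergence on
  \<open>[0, \<infinity>)\<close>: the approximating sequences for different \<open>T\<close> are compared by contraction.\<close>

lemma generalized_solution_approx:
  fixes w :: "real \<Rightarrow> 'a::{real_inner, complete_space} \<times> 'b::{real_inner, complete_space}"
  assumes diss: "dissipative (closed_loop A g C K r)"
    and w: "closed_loop_generalized_solution A g C K r w" and "0 < \<epsilon>"
  shows "\<exists>v. strong_flow (closed_loop A g C K r) v \<and> (\<forall>t\<ge>0. dist (v t) (w t) < \<epsilon>)"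
proof -
  have approx: "\<exists>v. strong_flow (closed_loop A g C K r) v \<and> (\<forall>t\<in>{0..T}. dist (v t) (w t) < e)"
    if T: "0 \<le> T" and e: "0 < e" for T e
  proof -
    obtain V where V: "\<And>n. closed_loop_strong_solution A g C K r (V n)"
      "uniform_limit {0..T} V w sequentially"
      using w[unfolded closed_loop_generalized_solution_def, rule_format, OF T] by auto
    have "\<forall>\<^sub>F n in sequentially. \<forall>t\<in>{0..T}. dist (V n t) (w t) < e" using uniform_limitD[OF V(2) e] .
    from eventually_happens'[OF sequentially_bot this]
    obtain n where "\<forall>t\<in>{0..T}. dist (V n t) (w t) < e" by (rule exE)
    then show ?thesis
      using V(1)[of n] unfolding closed_loop_strong_solution_def strong_flow_def by blast
  qed
  obtain v where v: "strong_flow (closed_loop A g C K r) v" "dist (v 0) (w 0) < \<epsilon>/4"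
    using approx[of 0 "\<epsilon>/4"] \<open>0 < \<epsilon>\<close> by auto
  have "dist (v t) (w t) < \<epsilon>" if t: "0 \<le> t" for t
  proof -
    obtain u where u: "strong_flow (closed_loop A g C K r) u" "\<forall>s\<in>{0..t}. dist (u s) (w s) < \<epsilon>/4"
      using approx[OF t, of "\<epsilon>/4"] \<open>0 < \<epsilon>\<close> by auto
    have "dist (u 0) (w 0) < \<epsilon>/4" "dist (u t) (w t) < \<epsilon>/4" using u(2) that by auto
    moreover have "dist (v t) (u t) \<le> dist (v 0) (u 0)"
      using strong_flow_contraction[OF diss v(1) u(1), of 0 0 t] that by (simp add: dist_norm)
    moreover have "dist (v 0) (u 0) \<le> dist (v 0) (w 0) + dist (u 0) (w 0)" by (rule dist_triangle2)
    moreover have "dist (v t) (w t) \<le> dist (v t) (u t) + dist (u t) (w t)" by (rule dist_triangle)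
    ultimately show ?thesis using v(2) \<open>0 < \<epsilon>\<close> by linarith
  qed
  then show ?thesis using v(1) by blast
qed

theorem mainTheorem1:
  fixes A :: "('a::{real_inner, complete_space} \<times> 'b::{real_inner, complete_space}, 'a) multimap"
    and g :: "'a \<times> 'b \<Rightarrow> 'b"
    and D :: "('a \<times> 'b) set"
    and C :: "'a set"
    and K :: "'b set"
  assumes C: "C \<noteq> {}" "closed C" "convex C"
    and K: "K \<noteq> {}" "closed K" "convex K" "interior K \<noteq> {}"
    and steady: "steady_state_behavior A C K"
    and compatibility: "mdom A \<subseteq> D"
    and coupling: "maximal_dissipative_coupling A g C"
    and distinguishability: "distinguishability A g C K"
    and compactness: "compactness_condition A"
    and passivity: "strictly_output_incrementally_passive A g"
    and detectability: "\<forall>p. steady_state_pair A C K p \<longrightarrow> h_detectable A g p"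
  shows "(\<forall>r. feasible A g C K r \<longrightarrow>
            (\<exists>!p. steady_state_pair A C K p \<and> g p = r) \<and>
            (\<forall>x\<^sub>s u\<^sub>s. steady_state_pair A C K (x\<^sub>s, u\<^sub>s) \<and> g (x\<^sub>s, u\<^sub>s) = r \<longrightarrow>
               (\<forall>x\<^sub>0\<in>C. \<forall>z\<^sub>0\<in>K. \<forall>x z.
                  closed_loop_generalized_solution A g C K r (\<lambda>t. (x t, z t)) \<and>
                  x 0 = x\<^sub>0 \<and> z 0 = z\<^sub>0 \<longrightarrow>
                    continuous_on {0..} (\<lambda>t. (x t, z t)) \<and>
                    ((\<lambda>t. (x t, z t)) \<longlongrightarrow> (x\<^sub>s, u\<^sub>s)) at_top))) \<and>
         (\<forall>r. \<forall>x\<^sub>0\<in>C. \<forall>z\<^sub>0\<in>K. \<forall>x z.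
            closed_loop_generalized_solution A g C K r (\<lambda>t. (x t, z t)) \<and>
            x 0 = x\<^sub>0 \<and> z 0 = z\<^sub>0 \<longrightarrow> (\<forall>t\<ge>0. z t \<in> K))"
proof -
  obtain B :: "'b set" where B: "finite B" "span B = UNIV"
    using compactness unfolding compactness_condition_def by blast
  have coupling': "dissipative (coupling A g)"
    using coupling by (auto simp: maximal_dissipative_coupling_def maximal_dissipative_iff)
  have M: "maximal_dissipative (closed_loop A g C K r)" for r
    by (rule maximal_dissipative_closed_loop[OF C(1) K(2-4) coupling B])
  have diss: "dissipative (closed_loop A g C K r)" for r using M by (simp add: maximal_dissipative_iff)
  have unique: "\<exists>!p. steady_state_pair A C K p \<and> g p = r" if "feasible A g C K r" for r
  proof (rule ex_ex1I)
    show "\<exists>p. steady_state_pair A C K p \<and> g p = r" using that unfolding feasible_def by blast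
    fix p q assume "steady_state_pair A C K p \<and> g p = r" "steady_state_pair A C K q \<and> g q = r"
    moreover obtain x u y v where "p = (x, u)" "q = (y, v)" by (cases p; cases q)
    ultimately have pq: "p = (x, u)" "q = (y, v)" "steady_state_pair A C K (x, u)" "steady_state_pair A C K (y, v)"
      "inner (u - v) (g (x, u) - g (y, v)) = 0" by auto
    then have "x = y" using distinguishability unfolding distinguishability_def by blast
    moreover have "\<forall>x\<in>C. \<forall>u\<in>K. \<forall>u'\<in>K. 0 \<in> A (x, u) \<and> 0 \<in> A (x, u') \<longrightarrow> u = u'"
      using steady unfolding steady_state_behavior_def by (rule conjunct2)
    ultimately show "p = q" using pq(3,4) unfolding pq(1,2) steady_state_pair_def by auto
  qed
  have cont: "continuous_on {0..} w" if w: "closed_loop_generalized_solution A g C K r w" for r w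
    unfolding continuous_on_iff
  proof (intro ballI allI impI)
    fix t e :: real assume t: "t \<in> {0..}" and e: "0 < e"
    then obtain v where v: "strong_flow (closed_loop A g C K r) v" "\<And>t. 0 \<le> t \<Longrightarrow> dist (v t) (w t) < e/3"
      using generalized_solution_approx[OF diss w, of "e/3"] by auto
    have "continuous_on {0..} v" using v(1) abs_cont_continuous_on by (auto simp: strong_flow_def)
    then obtain d where d: "0 < d" "\<forall>s\<in>{0..}. dist s t < d \<longrightarrow> dist (v s) (v t) < e/3"
    proof -
      have "0 < e/3" using e by simp
      then show thesis using that \<open>continuous_on {0..} v\<close> t unfolding continuous_on_iff by blast
    qed
    have "dist (w s) (w t) < e" if "s \<in> {0..}" "dist s t < d" for s
      using v(2)[of s] v(2)[of t] d(2) that t dist_triangle_third[of "w s" "v s" e "v t" "w t"]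
      by (simp add: dist_commute)
    then show "\<exists>d>0. \<forall>s\<in>{0..}. dist s t < d \<longrightarrow> dist (w s) (w t) < e" using d(1) by blast
  qed
  have lim: "(w \<longlongrightarrow> (xs, us)) at_top"
    if star: "steady_state_pair A C K (xs, us)" "g (xs, us) = r"
      and w: "closed_loop_generalized_solution A g C K r w" for r xs us w
  proof (rule tendstoI)
    fix e :: real assume "0 < e"
    then obtain v where v: "strong_flow (closed_loop A g C K r) v" "\<And>t. 0 \<le> t \<Longrightarrow> dist (v t) (w t) < e/2"
      using generalized_solution_approx[OF diss w, of "e/2"] by auto
    have "(v \<longlongrightarrow> (xs, us)) at_top"
      by (rule closed_loop_strong_solution_tendsto[OF steady coupling' distinguishability compactness
            passivity detectability M star v(1)])
    then have "\<forall>\<^sub>F t in at_top. dist (v t) (xs, us) < e/2" using \<open>0 < e\<close> by (intro tendstoD) auto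
    moreover have "\<forall>\<^sub>F t::real in at_top. 0 \<le> t" by (rule eventually_ge_at_top)
    ultimately show "\<forall>\<^sub>F t in at_top. dist (w t) (xs, us) < e"
    proof eventually_elim
      case (elim t)
      then show ?case using v(2)[of t] dist_triangle_half_r[of "v t" "w t" e "(xs, us)"] by blast
    qed
  qed
  have in_K: "z t \<in> K" if w: "closed_loop_generalized_solution A g C K r (\<lambda>t. (x t, z t))" and "0 \<le> t"
    for r x z t
  proof -
    have "\<exists>y\<in>K. dist y (z t) < e" if "0 < e" for e
    proof -
      obtain v where v: "strong_flow (closed_loop A g C K r) v" "dist (v t) (x t, z t) < e"
        using generalized_solution_approx[OF diss w \<open>0 < e\<close>] \<open>0 \<le> t\<close> by auto
      have "snd (v t) \<in> K"
        using v(1) \<open>0 \<le> t\<close> unfolding strong_flow_def mdom_closed_loop by (auto simp: split_beta)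
      moreover have "dist (snd (v t)) (z t) < e" using dist_snd_le[of "v t" "(x t, z t)"] v(2) by simp
      ultimately show ?thesis by blast
    qed
    then show ?thesis using closed_approachable[OF K(2)] by blast
  qed
  show ?thesis
    by (intro conjI allI impI ballI; (elim conjE)?) (rule unique cont lim in_K; assumption)+
qed

end
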